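(* Let $k$ be a field with $\mathrm{char}(k)=0$. Let $\boldsymbol{w}(x_1,\ldots,x_n)\in k[[x_1,\ldots,x_n]]$ be an isolated singularity with a diagonal symmetry $t=(t_1,\ldots,t_n)\in(k^* )^n$ of prime order $p$, such that $t_i\neq 1$ for all $i$. Let $\bar{A}$ be a $\mathbb{Z}/p$-equivariant matrix factorization of $\boldsymbol{w}$, so that the complex of $\mathbb{Z}/p$-modules $\bar{A}|_0$ defines a class $[\bar{A}|_0]$ in the representation ring $R_{\mathbb{Z}/p}$. Assume that $\lceil\frac{n}{2}\rceil-1\ge m(p-1)$. Then $[\bar{A}|_0]$ is divisible by $p^m$ in $R_{\mathbb{Z}/p}$.
   Context: $R=k[[x_1,\ldots,x_n]]$ with maximal ideal $\mathfrak m$. "Isolated singularity" means $\boldsymbol{w}\in\mathfrak m$ and $R/(\partial_1\boldsymbol{w},\ldots,\partial_n\boldsymbol{w})$ is finite-dimensional over $k$. "Diagonal symmetry" means $\boldsymbol{w}(t_1x_1,\ldots,t_nx_n)=\boldsymbol{w}(x_1,\ldots,x_n)$; order $p$ means order in the group $(k^* )^n$. A matrix factorization $\bar{A}=(A,\delta)$ of $\boldsymbol{w}$ is a $\mathbb{Z}/2$-graded finitely generated free $R$-module $A=A^0\oplus A^1$ with odd endomorphism $\delta$, $\delta^2=\boldsymbol{w}\cdot\mathrm{id}$. It is $\mathbb{Z}/p$-equivariant if it is equipped with an isomorphism $\alpha:\bar{A}\to t^*\bar{A}$ of matrix factorizations ($t^*$ induced by $f\mapsto f\circ t$) defining an action of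 $\mathbb{Z}/p=\langle t\rangle$, i.e. $(t^{p-1})^*\alpha\circ\cdots\circ t^*\alpha\circ\alpha=\mathrm{id}$. $\bar{A}|_0=A/\mathfrak m A$ is then a $\mathbb{Z}/2$-graded representation of $\mathbb{Z}/p$ over $k$, and $[\bar{A}|_0]=[A^0/\mathfrak m A^0]-[A^1/\mathfrak m A^1]\in R_{\mathbb{Z}/p}$, where $R_{\mathbb{Z}/p}$ is the representation ring of $\mathbb{Z}/p$ (over $k$, which contains the $p$th roots of unity); $m$ is a nonnegative integer. *)

theory Defs
  imports
    "HOL-Library.Poly_Mapping"
    "HOL-Library.Cardinality"
    "HOL-Computational_Algebra.Primes"
    "HOL-Algebra.Elementary_Groups"
    "Jordan_Normal_Form.Matrix"
begin

section \<open>Formal power series in several variables\<close>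

text \<open>The variables are indexed by the type \<open>'n\<close>, and a series is given by its coefficients at
  the monomials \<open>x\<^sup>a\<close>. For \<open>k[[x_1,...,x_n]]\<close> the type \<open>'n\<close> is taken in class \<open>finite\<close> and
  \<open>n = CARD('n)\<close>.\<close>

typedef ('n, 'k) mfps = "UNIV :: (('n \<Rightarrow>\<^sub>0 nat) \<Rightarrow> 'k) set"
  morphisms mcoeff Abs_mfps ..

setup_lifting type_definition_mfps

lemma mfps_eqI: "(\<And>a. mcoeff f a = mcoeff g a) \<Longrightarrow> f = g"
  by transfer auto

definition splits :: "('n \<Rightarrow>\<^sub>0 nat) \<Rightarrow> (('n \<Rightarrow>\<^sub>0 nat) \<times> ('n \<Rightarrow>\<^sub>0 nat)) set" where
  "splits c = {(a, b). a + b = c}"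

lemma finite_splits: "finite (splits c)"
proof -
  let ?K = "Poly_Mapping.keys c" and ?l = "Poly_Mapping.lookup :: _ \<Rightarrow> 'a \<Rightarrow> nat"
  let ?S = "{f. \<forall>i. (i \<in> ?K \<longrightarrow> f i \<in> {..\<Sum>i\<in>?K. ?l c i}) \<and> (i \<notin> ?K \<longrightarrow> f i = 0)}"
  let ?A = "{a. \<exists>b. a + b = c}"
  have *: "?l a \<in> ?S" if "a + b = c" for a b
  proof -
    have 1: "?l a i \<le> ?l c i" for i
      unfolding that[symmetric] by (simp add: lookup_add)
    have 2: "?l c i \<le> (\<Sum>i\<in>?K. ?l c i)" if "i \<in> ?K" for i
      by (rule member_le_sum[OF that]) simp_all
    have 3: "?l a i = 0" if "i \<notin> ?K" for i
      using 1[of i] that by (simp add: in_keys_iff)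
    show ?thesis
      using le_trans[OF 1 2] 3 by simp
  qed
  have "?l ` ?A \<subseteq> ?S"
  proof (rule image_subsetI)
    fix a assume "a \<in> ?A"
    then obtain b where "a + b = c"
      by blast
    then show "?l a \<in> ?S"
      by (rule *)
  qed
  moreover have "finite ?S"
    by (rule finite_set_of_finite_funs) simp_all
  moreover have "inj_on ?l ?A"
    by (rule inj_onI) (simp only: lookup_inject)
  ultimately have "finite ?A"
    using inj_on_finite[of ?l ?A ?S] by simp
  moreover have "splits c \<subseteq> ?A \<times> ?A"
  proof (rule subrelI)
    fix a b assume "(a, b) \<in> splits c"
    then have "a + b = c" "b + a = c"
      by (simp_all add: splits_def add.commute)
    then show "(a, b) \<in> ?A \<times> ?A"
      by blast
  qed
  ultimately show ?thesis
    using finite_subset[of "splits c" "?A \<times> ?A"] by simp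
qed

instantiation mfps :: (type, comm_ring_1) comm_ring_1
begin

lift_definition zero_mfps :: "('a, 'b) mfps" is "\<lambda>_. 0" .
lift_definition one_mfps :: "('a, 'b) mfps" is "\<lambda>a. if a = 0 then 1 else 0" .
lift_definition plus_mfps :: "('a, 'b) mfps \<Rightarrow> ('a, 'b) mfps \<Rightarrow> ('a, 'b) mfps"
  is "\<lambda>f g a. f a + g a" .
lift_definition minus_mfps :: "('a, 'b) mfps \<Rightarrow> ('a, 'b) mfps \<Rightarrow> ('a, 'b) mfps"
  is "\<lambda>f g a. f a - g a" .
lift_definition uminus_mfps :: "('a, 'b) mfps \<Rightarrow> ('a, 'b) mfps"
  is "\<lambda>f a. - f a" .
lift_definition times_mfps :: "('a, 'b) mfps \<Rightarrow> ('a, 'b) mfps \<Rightarrow> ('a, 'b) mfps"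
  is "\<lambda>f g c. \<Sum>(a, b)\<in>splits c. f a * g b" .

instance
proof
  fix f g h :: "('a, 'b) mfps"
  show "f + g + h = f + (g + h)" "f + g = g + f" "0 + f = f" "- f + f = 0" "f - g = f + - g"
    by (transfer; simp add: fun_eq_iff algebra_simps)+
  show "(0 :: ('a, 'b) mfps) \<noteq> 1"
    by transfer (auto simp: fun_eq_iff)
  show "f * g = g * f"
  proof (transfer, rule ext)
    fix f g :: "('a \<Rightarrow>\<^sub>0 nat) \<Rightarrow> 'b" and c
    show "(\<Sum>(a, b)\<in>splits c. f a * g b) = (\<Sum>(a, b)\<in>splits c. g a * f b)"
      by (rule sum.reindex_bij_witness[of _ prod.swap prod.swap])
        (simp_all add: splits_def case_prod_unfold mult.commute add.commute)
  qed
  show "(f + g) * h = f * h + g * h"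
    by transfer (simp add: fun_eq_iff case_prod_unfold distrib_right sum.distrib)
  show "1 * f = f"
  proof (transfer, rule ext)
    fix f :: "('a \<Rightarrow>\<^sub>0 nat) \<Rightarrow> 'b" and c
    have "(\<Sum>(a, b)\<in>splits c. (if a = 0 then 1 else 0) * f b) =
        (\<Sum>(a, b)\<in>{(0 :: 'a \<Rightarrow>\<^sub>0 nat, c)}. (if a = 0 then 1 else 0) * f b)"
      by (rule sum.mono_neutral_right[OF finite_splits]) (auto simp: splits_def split: if_splits)
    then show "(\<Sum>(a, b)\<in>splits c. (if a = 0 then 1 else 0) * f b) = f c"
      by simp
  qed
  show "f * g * h = f * (g * h)"
  proof (transfer, rule ext)
    fix f g h :: "('a \<Rightarrow>\<^sub>0 nat) \<Rightarrow> 'b" and c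
    have "(\<Sum>(a, b)\<in>splits c. (\<Sum>(d, e)\<in>splits a. f d * g e) * h b) =
        (\<Sum>(x, y)\<in>(SIGMA x:splits c. splits (fst x)). f (fst y) * g (snd y) * h (snd x))"
      by (simp add: sum.Sigma finite_splits case_prod_unfold sum_distrib_right)
    also have "\<dots> =
        (\<Sum>(x, y)\<in>(SIGMA x:splits c. splits (snd x)). f (fst x) * (g (fst y) * h (snd y)))"
      by (rule sum.reindex_bij_witness
          [of _ "\<lambda>(x, y). ((fst x + fst y, snd y), (fst x, fst y))"
                "\<lambda>(x, y). ((fst y, snd y + snd x), (snd y, snd x))"])
        (clarsimp simp: splits_def add.assoc mult.assoc)+
    also have "\<dots> = (\<Sum>(a, b)\<in>splits c. f a * (\<Sum>(d, e)\<in>splits b. g d * h e))"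
      by (simp add: sum.Sigma finite_splits case_prod_unfold sum_distrib_left)
    finally show "(\<Sum>(a, b)\<in>splits c. (\<Sum>(d, e)\<in>splits a. f d * g e) * h b) =
        (\<Sum>(a, b)\<in>splits c. f a * (\<Sum>(d, e)\<in>splits b. g d * h e))" .
  qed
qed

end

lift_definition mconst :: "'k::comm_ring_1 \<Rightarrow> ('n, 'k) mfps" is
  "\<lambda>c a. if a = 0 then c else 0" .

text \<open>The residue map from \<open>R\<close> to \<open>R / \<mm> = k\<close>.\<close>

definition const_term :: "('n, 'k) mfps \<Rightarrow> 'k" where
  "const_term f = mcoeff f 0"

lift_definition pderiv_mfps :: "'n \<Rightarrow> ('n, 'k::comm_ring_1) mfps \<Rightarrow> ('n, 'k) mfps" is
  "\<lambda>i f a. of_nat (Poly_Mapping.lookup a i + 1) * f (a + Poly_Mapping.single i 1)" .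

text \<open>Since the substitution \<open>x_i \<mapsto> t_i x_i\<close> sends the monomial \<open>x\<^sup>a\<close> to \<open>t\<^sup>a x\<^sup>a\<close>, the series
  \<open>f \<circ> t = f(t_1 x_1, ..., t_n x_n)\<close> has the following coefficients.\<close>

lift_definition subst_diag ::
  "('n::finite \<Rightarrow> 'k::comm_ring_1) \<Rightarrow> ('n, 'k) mfps \<Rightarrow> ('n, 'k) mfps" is
  "\<lambda>t f a. (\<Prod>i\<in>UNIV. t i ^ Poly_Mapping.lookup a i) * f a" .


section \<open>Isolated singularities and diagonal symmetries\<close>

definition jacobian_ideal :: "('n::finite, 'k::comm_ring_1) mfps \<Rightarrow> ('n, 'k) mfps set" where
  "jacobian_ideal w = {\<Sum>i\<in>UNIV. g i * pderiv_mfps i w | g. True}"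

text \<open>The quotient of the power series ring by \<open>J\<close> is spanned over \<open>k\<close> by the residue classes
  of finitely many series.\<close>

definition finite_dim_quotient :: "('n, 'k::field) mfps set \<Rightarrow> bool" where
  "finite_dim_quotient J \<longleftrightarrow>
     (\<exists>B. finite B \<and> (\<forall>f. \<exists>c. f - (\<Sum>b\<in>B. mconst (c b) * b) \<in> J))"

definition isolated_singularity :: "('n::finite, 'k::field) mfps \<Rightarrow> bool" where
  "isolated_singularity w \<longleftrightarrow> const_term w = 0 \<and> finite_dim_quotient (jacobian_ideal w)"

definition diagonal_symmetry ::
  "('n::finite \<Rightarrow> 'k::field) \<Rightarrow> ('n, 'k) mfps \<Rightarrow> bool" where
  "diagonal_symmetry t w \<longleftrightarrow> (\<forall>i. t i \<noteq> 0) \<and> subst_diag t w = w"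

text \<open>\<open>t\<close> has order \<open>p\<close> in the group \<open>(k\<^sup>*)\<^sup>n\<close>.\<close>

definition torus_order :: "('n \<Rightarrow> 'k::field) \<Rightarrow> nat \<Rightarrow> bool" where
  "torus_order t p \<longleftrightarrow> p > 0 \<and> (\<forall>i. t i \<noteq> 0) \<and> (\<forall>i. t i ^ p = 1) \<and>
     (\<forall>q. 0 < q \<and> q < p \<longrightarrow> (\<exists>i. t i ^ q \<noteq> 1))"


section \<open>The representation ring of a group\<close>

text \<open>A finite-dimensional representation over \<open>k\<close> is a pair \<open>(d, \<rho>)\<close>, where \<open>\<rho>\<close> is a
  homomorphism from \<open>G\<close> to \<open>GL_d(k)\<close>; the values of \<open>\<rho>\<close> off the carrier are irrelevant.\<close>

type_synonym ('g, 'k) rep = "nat \<times> ('g \<Rightarrow> 'k mat)"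

definition reps :: "('g, 'b) monoid_scheme \<Rightarrow> ('g, 'k::field) rep set" where
  "reps G = {(d, \<rho>). (\<forall>g\<in>carrier G. \<rho> g \<in> carrier_mat d d) \<and> \<rho> \<one>\<^bsub>G\<^esub> = 1\<^sub>m d \<and>
     (\<forall>g\<in>carrier G. \<forall>h\<in>carrier G. \<rho> (g \<otimes>\<^bsub>G\<^esub> h) = \<rho> g * \<rho> h)}"

definition rep_iso ::
  "('g, 'b) monoid_scheme \<Rightarrow> ('g, 'k::field) rep \<Rightarrow> ('g, 'k) rep \<Rightarrow> bool" where
  "rep_iso G V W \<longleftrightarrow>
     (\<exists>P\<in>carrier_mat (fst W) (fst V). \<exists>Q\<in>carrier_mat (fst V) (fst W).
        P * Q = 1\<^sub>m (fst W) \<and> Q * P = 1\<^sub>m (fst V) \<and>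
        (\<forall>g\<in>carrier G. P * snd V g = snd W g * P))"

definition rep_sum :: "('g, 'k::field) rep \<Rightarrow> ('g, 'k) rep \<Rightarrow> ('g, 'k) rep" (infixl "\<oplus>\<^sub>r" 65) where
  "V \<oplus>\<^sub>r W = (fst V + fst W, \<lambda>g. four_block_mat (snd V g) (0\<^sub>m (fst V) (fst W))
                                              (0\<^sub>m (fst W) (fst V)) (snd W g))"

text \<open>The tensor product is given by the Kronecker product of matrices: the basis vector
  \<open>e_i \<otimes> e_j\<close> has index \<open>i * dim W + j\<close>.\<close>

definition rep_tensor :: "('g, 'k::field) rep \<Rightarrow> ('g, 'k) rep \<Rightarrow> ('g, 'k) rep" (infixl "\<otimes>\<^sub>r" 70) where
  "V \<otimes>\<^sub>r W = (fst V * fst W, \<lambda>g. mat (fst V * fst W) (fst V * fst W)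
     (\<lambda>(i, j). snd V g $$ (i div fst W, j div fst W) * snd W g $$ (i mod fst W, j mod fst W)))"

definition rep_zero :: "('g, 'k::field) rep" where
  "rep_zero = (0, \<lambda>_. 1\<^sub>m 0)"

definition rep_triv :: "('g, 'k::field) rep" where
  "rep_triv = (1, \<lambda>_. 1\<^sub>m 1)"

text \<open>The representation ring is the Grothendieck ring of the representations with direct sum and
  tensor product. A pair \<open>(V, W)\<close> stands for the formal difference \<open>[V] - [W]\<close>.\<close>

definition vrep_rel ::
  "('g, 'b) monoid_scheme \<Rightarrow>
     ((('g, 'k::field) rep \<times> ('g, 'k) rep) \<times> (('g, 'k) rep \<times> ('g, 'k) rep)) set" where
  "vrep_rel G = {((V, W), (V', W')).
     V \<in> reps G \<and> W \<in> reps G \<and> V' \<in> reps G \<and> W' \<in> reps G \<and>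
     (\<exists>U\<in>reps G. rep_iso G (V \<oplus>\<^sub>r W' \<oplus>\<^sub>r U) (V' \<oplus>\<^sub>r W \<oplus>\<^sub>r U))}"

definition vrep ::
  "('g, 'b) monoid_scheme \<Rightarrow> ('g, 'k::field) rep \<Rightarrow> ('g, 'k) rep \<Rightarrow>
     (('g, 'k) rep \<times> ('g, 'k) rep) set" where
  "vrep G V W = vrep_rel G `` {(V, W)}"

definition rep_ring ::
  "('g, 'b) monoid_scheme \<Rightarrow> (('g, 'k::field) rep \<times> ('g, 'k) rep) set ring" where
  "rep_ring G =
     \<lparr>carrier = (reps G \<times> reps G) // vrep_rel G,
      mult = (\<lambda>X Y. \<Union>(V, W)\<in>X. \<Union>(V', W')\<in>Y.
                vrep G (V \<otimes>\<^sub>r V' \<oplus>\<^sub>r W \<otimes>\<^sub>r W') (V \<otimes>\<^sub>r W' \<oplus>\<^sub>r W \<otimes>\<^sub>r V')),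
      one = vrep G rep_triv rep_zero,
      zero = vrep G rep_zero rep_zero,
      add = (\<lambda>X Y. \<Union>(V, W)\<in>X. \<Union>(V', W')\<in>Y. vrep G (V \<oplus>\<^sub>r V') (W \<oplus>\<^sub>r W'))\<rparr>"


section \<open>Equivariant matrix factorizations\<close>

text \<open>The finitely generated free modules are \<open>A\<^sup>0 = R\<^sup>r\<close> and \<open>A\<^sup>1 = R\<^sup>s\<close> with \<open>r = even_rank\<close> and
  \<open>s = odd_rank\<close>; the odd endomorphism \<open>\<delta>\<close> has the components \<open>d_even : A\<^sup>0 \<rightarrow> A\<^sup>1\<close> and
  \<open>d_odd : A\<^sup>1 \<rightarrow> A\<^sup>0\<close>, given by their matrices.\<close>

record 'r mat_fact =
  even_rank :: nat
  odd_rank :: nat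
  d_even :: "'r mat"
  d_odd :: "'r mat"

definition matrix_factorization :: "'r::comm_ring_1 \<Rightarrow> ('r, 'z) mat_fact_scheme \<Rightarrow> bool" where
  "matrix_factorization w A \<longleftrightarrow>
     d_even A \<in> carrier_mat (odd_rank A) (even_rank A) \<and>
     d_odd A \<in> carrier_mat (even_rank A) (odd_rank A) \<and>
     d_odd A * d_even A = w \<cdot>\<^sub>m 1\<^sub>m (even_rank A) \<and>
     d_even A * d_odd A = w \<cdot>\<^sub>m 1\<^sub>m (odd_rank A)"

text \<open>For a homomorphism of free modules given by a matrix, the base change \<open>t\<^sup>*\<close> along
  \<open>f \<mapsto> f \<circ> t\<close> applies the substitution to every entry.\<close>

definition pullback_mat ::
  "('n::finite \<Rightarrow> 'k::comm_ring_1) \<Rightarrow> ('n, 'k) mfps mat \<Rightarrow> ('n, 'k) mfps mat" where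
  "pullback_mat t M = map_mat (subst_diag t) M"

text \<open>\<open>iterate_action t \<alpha> r j\<close> is the composite
  \<open>(t\<^sup>j\<^sup>-\<^sup>1)\<^sup>* \<alpha> \<circ> ... \<circ> t\<^sup>* \<alpha> \<circ> \<alpha>\<close>
  on a free module of rank \<open>r\<close>.\<close>

primrec iterate_action ::
  "('n::finite \<Rightarrow> 'k::comm_ring_1) \<Rightarrow> ('n, 'k) mfps mat \<Rightarrow> nat \<Rightarrow> nat \<Rightarrow> ('n, 'k) mfps mat" where
  "iterate_action t \<alpha> r 0 = 1\<^sub>m r"
| "iterate_action t \<alpha> r (Suc j) = pullback_mat (\<lambda>i. t i ^ j) \<alpha> * iterate_action t \<alpha> r j"

text \<open>The isomorphism \<open>\<alpha> : A \<rightarrow> t\<^sup>* A\<close> is even, with components \<open>act_even\<close> and \<open>act_odd\<close>.\<close>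

record 'r eq_mat_fact = "'r mat_fact" +
  act_even :: "'r mat"
  act_odd :: "'r mat"

definition equivariant_mf ::
  "('n::finite \<Rightarrow> 'k::field) \<Rightarrow> nat \<Rightarrow> ('n, 'k) mfps \<Rightarrow> ('n, 'k) mfps eq_mat_fact \<Rightarrow> bool" where
  "equivariant_mf t p w A \<longleftrightarrow>
     matrix_factorization w A \<and>
     act_even A \<in> carrier_mat (even_rank A) (even_rank A) \<and> invertible_mat (act_even A) \<and>
     act_odd A \<in> carrier_mat (odd_rank A) (odd_rank A) \<and> invertible_mat (act_odd A) \<and>
     pullback_mat t (d_even A) * act_even A = act_odd A * d_even A \<and>
     pullback_mat t (d_odd A) * act_odd A = act_even A * d_odd A \<and>
     iterate_action t (act_even A) (even_rank A) p = 1\<^sub>m (even_rank A) \<and>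
     iterate_action t (act_odd A) (odd_rank A) p = 1\<^sub>m (odd_rank A)"

text \<open>\<open>A / \<mm>A\<close> is the representation of \<open>\<int>/p\<close> (with carrier \<open>{0..<p}\<close>) in which the generator \<open>t\<close>,
  corresponding to \<open>1\<close>, acts by \<open>\<alpha>\<close> modulo \<open>\<mm>\<close>.\<close>

definition fiber_rep :: "nat \<Rightarrow> ('n, 'k::field) mfps mat \<Rightarrow> (int, 'k) rep" where
  "fiber_rep r \<alpha> = (r, \<lambda>j. map_mat const_term \<alpha> ^\<^sub>m nat j)"

definition fiber_class ::
  "nat \<Rightarrow> ('n, 'k::field) mfps eq_mat_fact \<Rightarrow> ((int, 'k) rep \<times> (int, 'k) rep) set" where
  "fiber_class p A = vrep (integer_mod_group p)
     (fiber_rep (even_rank A) (act_even A)) (fiber_rep (odd_rank A) (act_odd A))"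

end

theory Submission
  imports Defs
    "Jordan_Normal_Form.Determinant"
    "HOL-Library.Function_Algebras"
    "HOL-Computational_Algebra.Polynomial"
    "HOL-Combinatorics.List_Permutation"
begin

text \<open>
  Fix a primitive \<open>p\<close>th root of unity \<open>\<zeta>\<close> and write \<open>t\<^sub>i = \<zeta>\<^sup>c\<close> with \<open>c = c\<^sub>i\<close>. The class of the
  fibre is a polynomial \<open>F\<close> with integer coefficients modulo \<open>x\<^sup>p - 1\<close>, where \<open>x\<close> stands for the
  character \<open>\<zeta>\<close>. Its value at \<open>x = 1\<close> is the difference of the ranks of \<open>A\<^sup>0\<close> and \<open>A\<^sup>1\<close>, and this is
  zero, as the traces of \<open>\<delta>\<^sup>2\<close> on \<open>A\<^sup>0\<close> and on \<open>A\<^sup>1\<close> coincide and \<open>w \<noteq> 0\<close>.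

  The main point is a Lefschetz formula for the two-periodic complex \<open>End(A)\<close>:
  \<open>F(x) F(x\<^sup>-\<^sup>1) = H(x) \<Prod>\<^sub>i (1 - x\<^sup>c)\<close> modulo the cyclotomic polynomial, where \<open>H\<close> is the class of the
  cohomology of \<open>End(A)\<close> (\<open>supertrace_norm_divisible\<close>). The cohomology has finite dimension because
  differentiating \<open>\<delta>\<^sup>2 = w\<close> shows that every partial derivative of \<open>w\<close> acts on the complex by a
  null-homotopic map, and because some power of each variable lies in the Jacobian ideal. The
  formula itself is proved by dividing the complex by \<open>y\<^sub>i = x\<^sub>i\<^sup>N\<close> for one variable after the other,
  with \<open>N\<close> large and congruent to \<open>1\<close> modulo \<open>p\<close>. Since \<open>y\<^sub>i\<close> is null-homotopic, the long exact
  sequence of \<open>0 \<rightarrow> M \<rightarrow> M \<rightarrow> M/y\<^sub>iM \<rightarrow> 0\<close> breaks up into short ones, so the Euler characteristic is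
  multiplied by \<open>1 - x\<^sup>c\<close> at each step (\<open>cohomology_modulo_null_homotopic\<close>, \<open>euler_poly_insert\<close>).
  After the last step the complex has finite dimension, and its Euler characteristic is obtained by
  counting monomials (\<open>euler_poly_top\<close>). The same induction, read backwards, gives the finiteness of
  the cohomology.

  Arithmetic of \<open>\<int>[\<zeta>]\<close> finishes the proof (\<open>divisible_by_prime_power\<close>). Every \<open>1 - x\<^sup>c\<close> is
  divisible by \<open>1 - x\<close>, so \<open>F(x) F(x\<^sup>-\<^sup>1)\<close> vanishes to order \<open>n\<close> at the prime \<open>1 - x\<close>. This prime is
  fixed by \<open>x \<mapsto> x\<^sup>-\<^sup>1\<close>, hence \<open>F\<close> itself vanishes to order at least \<open>n/2\<close>, that is
  \<open>\<lceil>n/2\<rceil>\<close>. One factor \<open>1 - x\<close> is kept, so as to pass from \<open>\<int>[\<zeta>]\<close> back to the group ring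
  \<open>\<int>[x]/(x\<^sup>p - 1)\<close>, and the remaining \<open>\<lceil>n/2\<rceil> - 1 \<ge> m(p - 1)\<close> factors yield \<open>p\<^sup>m\<close>, as
  \<open>(1 - x)\<^sup>p\<^sup>-\<^sup>1\<close> is divisible by \<open>p\<close>.

  Two translations are needed around this core. By averaging over the group, an equivariant free
  module becomes one on which the action is a constant diagonal matrix
  (\<open>equivariant_module_linearizable\<close>); then equivariance just says that the entries of \<open>\<delta>\<close> are
  homogeneous for the weights \<open>c\<^sub>i\<close> modulo \<open>p\<close>. And as the characters determine the
  representations up to isomorphism, equality in the representation ring is equality of virtual
  characters (\<open>vrep_rel_iff\<close>).
\<close>

section \<open>Integer polynomials modulo the cyclotomic polynomial\<close>

abbreviation (input) Xp :: "int poly" where "Xp \<equiv> [:0, 1:]"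

text \<open>For a prime \<open>p\<close> this is the cyclotomic polynomial. Working modulo it means working in \<open>\<int>[\<zeta>]\<close>.\<close>

definition cyc :: "nat \<Rightarrow> int poly" where
  "cyc p = (\<Sum>i<p. Xp ^ i)"

lemma cyc_geom: "(Xp - 1) * cyc p = Xp ^ p - 1"
  by (simp add: cyc_def power_diff_1_eq)

lemma poly_cyc_1 [simp]: "poly (cyc p) 1 = int p"
  by (simp add: cyc_def poly_sum)

lemma root_one_dvd:
  fixes f :: "int poly"
  assumes "poly f 1 = 0" shows "(Xp - 1) dvd f"
proof -
  have "Xp - 1 = [:- 1, 1:]" by (simp add: one_pCons)
  then show ?thesis using assms poly_eq_0_iff_dvd[of f 1] by simp
qed

lemma X_minus_1_nz [simp]: "Xp - 1 \<noteq> (0 :: int poly)"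
  by (simp add: one_pCons)

lemma X_minus_1_dvd: "(Xp - 1) dvd (Xp ^ c - 1)"
  by (metis dvd_triv_left power_diff_1_eq)

lemma cyc_dvd_X_power_mult: "cyc p dvd Xp ^ (p * k) - 1"
proof -
  have "cyc p dvd Xp ^ p - 1" by (metis cyc_geom dvd_triv_right)
  also have "Xp ^ p - 1 dvd (Xp ^ p) ^ k - 1" by (metis dvd_triv_left power_diff_1_eq)
  finally show ?thesis by (simp add: power_mult)
qed

text \<open>If \<open>(x - 1) A = cyc p \<cdot> B\<close>, then evaluation at \<open>1\<close> gives \<open>p \<cdot> B(1) = 0\<close>, so that \<open>x - 1\<close> can be
  divided out of \<open>B\<close>.\<close>

lemma cyc_cancel:
  assumes "p > 0" "cyc p dvd (Xp - 1) * A" shows "cyc p dvd A"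
proof -
  obtain B where B: "(Xp - 1) * A = cyc p * B" using assms(2) by (elim dvdE)
  have "poly ((Xp - 1) * A) 1 = int p * poly B 1" unfolding B by simp
  then have "poly B 1 = 0" using assms(1) by simp
  then obtain B' where B': "B = (Xp - 1) * B'" using root_one_dvd by (metis dvdE)
  have "(Xp - 1) * A = (Xp - 1) * (cyc p * B')" using B unfolding B' by (simp only: mult_ac)
  then have "A = cyc p * B'" using mult_left_cancel[OF X_minus_1_nz] by blast
  then show ?thesis by simp
qed

lemma cyc_cancel_power:
  assumes "p > 0" "cyc p dvd (Xp - 1) ^ k * A" shows "cyc p dvd A"
  using assms(2) by (induction k) (auto simp: mult.assoc dest: cyc_cancel[OF assms(1)])

text \<open>The prime \<open>p\<close> is totally ramified in \<open>\<int>[\<zeta>]\<close>, with \<open>\<zeta> - 1\<close> above it. Expanding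
  \<open>x\<^sup>p = ((x - 1) + 1)\<^sup>p\<close> and using that \<open>p\<close> divides the inner binomial coefficients gives
  \<open>x\<^sup>p - 1 = (x - 1)\<^sup>p + p C\<close>; here \<open>C(1) = 0\<close>, so a factor \<open>x - 1\<close> cancels.\<close>

lemma frobenius_X_minus_1:
  assumes "prime p"
  shows "\<exists>B. (Xp - 1) ^ (p - 1) = cyc p + of_nat p * B"
proof -
  let ?u = "Xp - 1 :: int poly"
  have p: "p > 0" using assms prime_gt_0_nat by blast
  have "Xp ^ p = (?u + 1) ^ p" by simp
  also have "\<dots> = (\<Sum>k\<le>p. of_nat (p choose k) * ?u ^ k)"
    by (simp only: binomial_ring power_one mult_1_right)
  also have "{..p} = insert 0 (insert p {0<..<p})" using p by auto
  also have "(\<Sum>k\<in>insert 0 (insert p {0<..<p}). of_nat (p choose k) * ?u ^ k)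
      = 1 + ?u ^ p + (\<Sum>k\<in>{0<..<p}. of_nat (p choose k) * ?u ^ k)"
    using p by simp
  also have "(\<Sum>k\<in>{0<..<p}. of_nat (p choose k) * ?u ^ k)
      = of_nat p * (\<Sum>k\<in>{0<..<p}. of_nat ((p choose k) div p) * ?u ^ k)"
    unfolding sum_distrib_left
  proof (rule sum.cong[OF refl])
    fix k assume "k \<in> {0<..<p}"
    then have "p dvd (p choose k)" using assms by (intro dvd_choose_prime) auto
    then have "of_nat (p choose k) = (of_nat p * of_nat ((p choose k) div p) :: int poly)"
      by (metis dvd_mult_div_cancel of_nat_mult)
    then show "of_nat (p choose k) * ?u ^ k = of_nat p * (of_nat ((p choose k) div p) * ?u ^ k)"
      by (simp only: mult.assoc)
  qed
  finally obtain C where C: "Xp ^ p = 1 + ?u ^ p + of_nat p * C" by blast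
  have "poly (Xp ^ p) 1 = poly (1 + ?u ^ p + of_nat p * C) 1" using C by simp
  then have "poly C 1 = 0" using p by (simp add: power_0_left)
  then obtain C' where C': "C = ?u * C'" using root_one_dvd by (metis dvdE)
  have "?u * ?u ^ (p - 1) = ?u ^ p" using power_minus_mult[OF p, of ?u] by (simp only: mult.commute)
  also have "\<dots> = Xp ^ p - 1 - of_nat p * C" unfolding C by simp
  also have "\<dots> = ?u * (cyc p + of_nat p * (- C'))"
    unfolding C' by (simp only: cyc_geom[symmetric]) (simp add: algebra_simps)
  finally have "?u ^ (p - 1) = cyc p + of_nat p * (- C')"
    using mult_left_cancel[OF X_minus_1_nz] by blast
  then show ?thesis by blast
qed

lemma frobenius_X_minus_1_power:
  assumes "prime p"
  shows "\<exists>B. cyc p dvd (Xp - 1) ^ (m * (p - 1)) - of_nat (p ^ m) * B"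
proof (induction m)
  case 0
  show ?case by (rule exI[of _ 1]) simp
next
  case (Suc m)
  let ?u = "Xp - 1 :: int poly"
  obtain B where B: "cyc p dvd ?u ^ (m * (p - 1)) - of_nat (p ^ m) * B" using Suc by blast
  obtain C where C: "?u ^ (p - 1) = cyc p + of_nat p * C" using frobenius_X_minus_1[OF assms] by blast
  have "?u ^ (Suc m * (p - 1)) - of_nat (p ^ Suc m) * (B * C)
      = (?u ^ (m * (p - 1)) - of_nat (p ^ m) * B) * ?u ^ (p - 1) + of_nat (p ^ m) * B * cyc p"
    unfolding mult_Suc power_add C by (simp add: algebra_simps)
  moreover have "cyc p dvd \<dots>" using B by (intro dvd_add dvd_mult2 dvd_triv_right)
  ultimately show ?case by metis
qed

lemma pcompose_power: "pcompose (f ^ n) g = pcompose f g ^ n" for f g :: "int poly"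
  by (induction n) (simp_all add: pcompose_mult pcompose_1)

text \<open>The substitution \<open>x \<mapsto> x\<^sup>p\<^sup>-\<^sup>1\<close>, which is \<open>x \<mapsto> x\<^sup>-\<^sup>1\<close> modulo \<open>x\<^sup>p - 1\<close>, permutes the powers of \<open>x\<close>
  and therefore maps the cyclotomic ideal to itself.\<close>

lemma cyc_dvd_conj: "p > 0 \<Longrightarrow> cyc p dvd pcompose (cyc p) (Xp ^ (p - 1))"
proof -
  assume p: "p > 0"
  have 1: "pcompose (cyc p) (Xp ^ (p - 1)) = (\<Sum>i<p. Xp ^ ((p - 1) * i))"
    by (simp add: cyc_def pcompose_sum pcompose_power pcompose_pCons power_mult)
  have split: "{..<p} = insert 0 {1..<p}" using p by auto
  have "(\<Sum>i=1..<p. Xp ^ (p - i)) = (\<Sum>i=1..<p. (Xp :: int poly) ^ i)"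
    by (rule sum.reindex_bij_witness[of _ "\<lambda>i. p - i" "\<lambda>i. p - i"]) auto
  then have "(\<Sum>i<p. Xp ^ ((p - 1) * i)) - cyc p
      = (\<Sum>i=1..<p. Xp ^ ((p - 1) * i) - Xp ^ (p - i))"
    unfolding cyc_def split by (simp add: sum_subtractf)
  moreover have "cyc p dvd Xp ^ ((p - 1) * i) - Xp ^ (p - i)" if "i \<in> {1..<p}" for i
  proof -
    have "(p - 1) * i = (p - i) + p * (i - 1)"
      using that by (cases p; cases i) (auto simp: algebra_simps)
    then have "Xp ^ ((p - 1) * i) - Xp ^ (p - i) = Xp ^ (p - i) * (Xp ^ (p * (i - 1)) - 1)"
      by (simp add: power_add algebra_simps)
    then show ?thesis using cyc_dvd_X_power_mult by simp
  qed
  ultimately have "cyc p dvd (\<Sum>i<p. Xp ^ ((p - 1) * i)) - cyc p"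
    by (auto intro!: dvd_sum)
  then show ?thesis unfolding 1 by (simp add: dvd_diff_left_iff)
qed

text \<open>The ring identity behind the induction step below: with \<open>u = x - 1\<close> and \<open>v = x\<^sup>p\<^sup>-\<^sup>1 - 1\<close>, which is \<open>-u/x\<close>
  modulo \<open>cy\<close>, a factor \<open>u\<close> of \<open>f\<close> and of its conjugate \<open>f'\<close> produce together a factor \<open>u\<^sup>2\<close>
  of \<open>f f'\<close>.\<close>

lemma conjugate_product_expansion:
  fixes u :: "'a::comm_ring_1"
  assumes f: "f = u * g + cc * cy" and f': "f' = v * g' + cc * (cy * kk)" and v: "x * v = u * cy - u"
  shows "u ^ 2 * (g * g' - (- x * h) * u ^ k) = - (x * (f * f' - h * u ^ Suc (Suc k)))
           + cy * (u * u * g * g' + x * cc * f' + x * u * g * cc * kk)"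
proof -
  have "x * (f * f') = u * g * (x * v) * g' + x * u * g * cc * cy * kk + x * cc * cy * f'"
    unfolding f f' by (simp add: algebra_simps)
  also have "\<dots> = - (u * u * g * g') + cy * (u * u * g * g' + x * cc * f' + x * u * g * cc * kk)"
    unfolding v by (simp add: algebra_simps)
  finally show ?thesis by (simp add: algebra_simps power2_eq_square)
qed

text \<open>The prime \<open>x - 1\<close> of \<open>\<int>[\<zeta>]\<close> has residue field \<open>\<int>/p\<close>, and conjugation acts trivially on it. So
  if \<open>F\<close> times its conjugate vanishes at this prime, then \<open>p\<close> divides \<open>F(1)\<^sup>2\<close>, and \<open>F\<close> vanishes
  there, too. Removing a factor \<open>x - 1\<close> from \<open>F\<close> and from its conjugate lowers the order of the
  product by two, and the induction continues; for \<open>n = 1\<close> half a step is gained.\<close>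

lemma half_order_of_vanishing:
  fixes F H :: "int poly"
  assumes "prime p" "cyc p dvd F * pcompose F (Xp ^ (p - 1)) - H * (Xp - 1) ^ n"
  shows "\<exists>G. cyc p dvd F - (Xp - 1) ^ ((n + 1) div 2) * G"
  using assms(2)
proof (induction n arbitrary: F H rule: less_induct)
  case (less n)
  let ?u = "Xp - 1 :: int poly" and ?conj = "\<lambda>F :: int poly. pcompose F (Xp ^ (p - 1))"
  have p: "p > 0" using assms prime_gt_0_nat by blast
  show ?case
  proof (cases "n = 0")
    case True
    then show ?thesis by (intro exI[of _ F]) simp
  next
    case n: False
    obtain E where E: "F * ?conj F - H * ?u ^ n = cyc p * E" using less.prems by (elim dvdE)
    have "poly (F * ?conj F - H * ?u ^ n) 1 = poly F 1 * poly F 1"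
      using n by (simp add: poly_pcompose)
    then have "poly F 1 * poly F 1 = int p * poly E 1" unfolding E by simp
    then have "int p dvd poly F 1"
      using assms(1) by (metis dvd_triv_left prime_dvd_mult_iff prime_int_nat_transfer nat_int
          prime_nat_int_transfer)
    then obtain c where c: "poly F 1 = int p * c" by (elim dvdE)
    have "poly (F - [:c:] * cyc p) 1 = 0" by (simp add: c)
    then obtain G where "F - [:c:] * cyc p = ?u * G" using root_one_dvd by (metis dvdE)
    then have F: "F = ?u * G + [:c:] * cyc p" by (simp add: algebra_simps)
    show ?thesis
    proof (cases "n = 1")
      case True
      then show ?thesis using F by (intro exI[of _ G]) (simp add: dvd_smult)
    next
      case False
      then obtain k where k: "n = Suc (Suc k)" using n by (metis One_nat_def not0_implies_Suc)
      have conjF: "?conj F = (Xp ^ (p - 1) - 1) * ?conj G + [:c:] * ?conj (cyc p)"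
        unfolding F by (simp add: pcompose_add pcompose_mult pcompose_diff pcompose_pCons pcompose_1 pcompose_smult)
      have X: "Xp * (Xp ^ (p - 1) - 1) = ?u * cyc p - ?u"
      proof -
        have "Xp * Xp ^ (p - 1) = Xp ^ p" using power_minus_mult[OF p, of Xp] by (simp only: mult.commute)
        then show ?thesis unfolding cyc_geom right_diff_distrib by simp
      qed
      obtain K where K: "?conj (cyc p) = cyc p * K" using cyc_dvd_conj[OF p] by (elim dvdE)
      have "?u ^ 2 * (G * ?conj G - (- Xp * H) * ?u ^ k)
          = - (Xp * (F * ?conj F - H * ?u ^ n)) + cyc p * (?u * ?u * G * ?conj G
             + Xp * [:c:] * ?conj F + Xp * ?u * G * [:c:] * K)"
        unfolding k by (rule conjugate_product_expansion[OF F conjF[unfolded K] X])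
      moreover have "cyc p dvd \<dots>"
        by (intro dvd_add iffD2[OF dvd_minus_iff] dvd_mult less.prems dvd_triv_left)
      ultimately have "cyc p dvd ?u ^ 2 * (G * ?conj G - (- Xp * H) * ?u ^ k)" by metis
      then have "cyc p dvd G * ?conj G - (- Xp * H) * ?u ^ k" by (rule cyc_cancel_power[OF p])
      then obtain G' where G': "cyc p dvd G - ?u ^ ((k + 1) div 2) * G'"
        using less.IH[of k] k by fastforce
      have "F - ?u ^ ((n + 1) div 2) * G' = ?u * (G - ?u ^ ((k + 1) div 2) * G') + [:c:] * cyc p"
        unfolding F k by (simp add: algebra_simps)
      moreover have "cyc p dvd \<dots>" using G' by (intro dvd_add dvd_mult dvd_triv_right)
      ultimately show ?thesis by metis
    qed
  qed
qed

text \<open>Being zero at \<open>1\<close>, the polynomial \<open>F\<close> has a factor \<open>x - 1\<close>. The cofactor \<open>F1\<close> still vanishes to order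
  \<open>m (p - 1)\<close> at the prime \<open>x - 1\<close> of \<open>\<int>[\<zeta>]\<close>, hence is divisible by \<open>p\<^sup>m\<close> modulo \<open>cyc p\<close>.
  Multiplying by \<open>x - 1\<close> turns this into a congruence modulo \<open>x\<^sup>p - 1\<close>.\<close>

theorem divisible_by_prime_power:
  fixes F H :: "int poly" and c :: "'i \<Rightarrow> nat"
  assumes "prime p" "poly F 1 = 0"
    and "cyc p dvd F * pcompose F (Xp ^ (p - 1)) - H * (\<Prod>i\<in>I. 1 - Xp ^ c i)"
    and "m * (p - 1) + 1 \<le> (card I + 1) div 2"
  shows "\<exists>G. Xp ^ p - 1 dvd F - of_nat (p ^ m) * G"
proof -
  let ?u = "Xp - 1 :: int poly"
  have p: "p > 0" using assms prime_gt_0_nat by blast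
  have "(\<Prod>i\<in>I. ?u) dvd (\<Prod>i\<in>I. 1 - Xp ^ c i)"
    by (rule prod_dvd_prod) (metis X_minus_1_dvd dvd_minus_iff minus_diff_eq)
  then obtain K where K: "(\<Prod>i\<in>I. 1 - Xp ^ c i) = ?u ^ card I * K" by (auto elim: dvdE)
  have "cyc p dvd F * pcompose F (Xp ^ (p - 1)) - (H * K) * ?u ^ card I"
    using assms(3) unfolding K by (simp only: mult_ac)
  then obtain G where G: "cyc p dvd F - ?u ^ ((card I + 1) div 2) * G"
    using half_order_of_vanishing[OF assms(1)] by blast
  obtain F1 where F1: "F = ?u * F1" using root_one_dvd[OF assms(2)] by (elim dvdE)
  obtain h where h: "(card I + 1) div 2 = Suc (m * (p - 1) + h)"
    using assms(4) by (metis Suc_eq_plus1 le_Suc_ex add_Suc)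
  have "cyc p dvd ?u * (F1 - ?u ^ (m * (p - 1)) * (?u ^ h * G))"
    using G unfolding h F1 power_Suc power_add right_diff_distrib by (simp only: mult_ac)
  then have 1: "cyc p dvd F1 - ?u ^ (m * (p - 1)) * (?u ^ h * G)" by (rule cyc_cancel[OF p])
  obtain B where B: "cyc p dvd ?u ^ (m * (p - 1)) - of_nat (p ^ m) * B"
    using frobenius_X_minus_1_power[OF assms(1)] by blast
  have "cyc p dvd (F1 - ?u ^ (m * (p - 1)) * (?u ^ h * G))
      + (?u ^ (m * (p - 1)) - of_nat (p ^ m) * B) * (?u ^ h * G)"
    using 1 B by (intro dvd_add dvd_mult2)
  then have "cyc p dvd F1 - of_nat (p ^ m) * (B * (?u ^ h * G))" by (simp add: algebra_simps)
  then have "?u * cyc p dvd ?u * (F1 - of_nat (p ^ m) * (B * (?u ^ h * G)))" by (rule mult_dvd_mono[OF dvd_refl])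
  then have "Xp ^ p - 1 dvd F - of_nat (p ^ m) * (?u * (B * (?u ^ h * G)))"
    unfolding cyc_geom F1 right_diff_distrib by (simp only: mult_ac)
  then show ?thesis by blast
qed

section \<open>Periodic functions and geometric sums\<close>

text \<open>A \<open>p\<close>-periodic function represents an element of \<open>\<int>[x]/(x\<^sup>p - 1)\<close>, by its values on one period.
  Shifting the function means multiplying by a power of \<open>x\<close>.\<close>

lemma X_power_periodic_shift:
  fixes e f :: "nat \<Rightarrow> int"
  assumes "\<And>j. f (j + p) = f j" "\<And>j. f (j + k) = e j"
  shows "Xp ^ p - 1 dvd Xp ^ k * (\<Sum>j<p. of_int (e j) * Xp ^ j) - (\<Sum>j<p. of_int (f j) * Xp ^ j)"
  using assms
proof (induction k arbitrary: f)
  case 0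
  then have "f = e" by auto
  then show ?case by simp
next
  case (Suc k)
  let ?P = "\<lambda>f. \<Sum>j<p. of_int (f j) * (Xp :: int poly) ^ j"
  define g where "g = (\<lambda>j. f (Suc j))"
  have "Xp ^ p - 1 dvd Xp ^ k * ?P e - ?P g"
    using Suc.prems(1)[of "Suc _"] Suc.prems(2) by (intro Suc.IH) (simp_all add: g_def)
  then have 1: "Xp ^ p - 1 dvd Xp * (Xp ^ k * ?P e - ?P g)" by (rule dvd_mult)
  have "Xp * ?P g = (\<Sum>j<p. of_int (f (Suc j)) * Xp ^ Suc j)"
    unfolding sum_distrib_left by (simp only: g_def power_Suc mult_ac)
  also have "\<dots> = (\<Sum>j<Suc p. of_int (f j) * Xp ^ j) - of_int (f 0)"
    by (subst sum.lessThan_Suc_shift) simp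
  also have "\<dots> = ?P f + of_int (f 0) * (Xp ^ p - 1)"
    using Suc.prems(1)[of 0] by (simp add: algebra_simps)
  finally have eq: "Xp ^ Suc k * ?P e - ?P f = Xp * (Xp ^ k * ?P e - ?P g) + of_int (f 0) * (Xp ^ p - 1)"
    by (simp add: right_diff_distrib mult.assoc)
  show ?case unfolding eq by (intro dvd_add 1 dvd_triv_right)
qed

lemma X_power_mod: "Xp ^ p - 1 dvd Xp ^ n - Xp ^ (n mod p)"
proof -
  have "Xp ^ n - Xp ^ (n mod p) = Xp ^ (n mod p) * ((Xp ^ p) ^ (n div p) - 1)"
    by (simp add: power_mult[symmetric] right_diff_distrib power_add[symmetric])
  moreover have "Xp ^ p - 1 dvd (Xp ^ p) ^ (n div p) - 1" by (metis dvd_triv_left power_diff_1_eq)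
  ultimately show ?thesis by simp
qed

lemma count_by_residue:
  fixes p :: nat
  assumes "finite S" "p > 0"
  shows "Xp ^ p - 1 dvd (\<Sum>x\<in>S. Xp ^ n x) - (\<Sum>j<p. of_int (int (card {x \<in> S. n x mod p = j})) * Xp ^ j)"
proof -
  have "(\<Sum>j<p. of_int (int (card {x \<in> S. n x mod p = j})) * Xp ^ j)
      = (\<Sum>j<p. \<Sum>x\<in>{x \<in> S. n x mod p = j}. Xp ^ (n x mod p))"
    by (intro sum.cong refl) simp
  also have "\<dots> = (\<Sum>x\<in>S. Xp ^ (n x mod p))"
    by (rule sum.group) (use assms in auto)
  finally show ?thesis
    using dvd_sum[of S "Xp ^ p - 1" "\<lambda>x. Xp ^ n x - Xp ^ (n x mod p)"] X_power_mod by (simp only: sum_subtractf)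
qed

lemma sum_lessThan_add: "(\<Sum>x<r + s. f x) = (\<Sum>x<r. f x) + (\<Sum>y<s. f (r + y))" for f :: "nat \<Rightarrow> 'a::comm_monoid_add"
  by (induction s) (simp_all add: add.assoc)

lemma dvd_prod_diff:
  fixes f g :: "'i \<Rightarrow> 'a::comm_ring_1"
  assumes "finite A" "\<And>i. i \<in> A \<Longrightarrow> k dvd f i - g i" shows "k dvd prod f A - prod g A"
  using assms
proof (induction A rule: finite_induct)
  case (insert i A)
  have eq: "prod f (insert i A) - prod g (insert i A) = f i * (prod f A - prod g A) + (f i - g i) * prod g A"
    using insert(1,2) by (simp add: algebra_simps)
  show ?case unfolding eq using insert by (intro dvd_add dvd_mult dvd_mult2) auto
qed simp

lemma cyc_dvd_period: "cyc p dvd Xp ^ p - 1"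
  by (metis cyc_geom dvd_triv_right)

text \<open>Multiplication by \<open>c\<close> permutes the residues modulo \<open>p\<close>, so the sum is congruent to \<open>cyc p\<close>.\<close>

lemma cyc_dvd_sum_multiples:
  assumes "prime p" "\<not> p dvd c"
  shows "cyc p dvd (\<Sum>l<p. Xp ^ (c * l))"
proof -
  have p: "p > 0" using assms prime_gt_0_nat by blast
  have inj: "inj_on (\<lambda>l. (c * l) mod p) {..<p}"
  proof (rule inj_onI)
    have *: "l = l'" if "l \<le> l'" "l' < p" "(c * l) mod p = (c * l') mod p" for l l'
    proof -
      have "p dvd c * l' - c * l" using that mod_eq_dvd_iff_nat[of "c * l" "c * l'" p] by simp
      then have "p dvd c * (l' - l)" by (simp add: diff_mult_distrib2)
      then have "p dvd l' - l" using assms prime_dvd_mult_iff by blast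
      then show ?thesis using that by (auto dest: dvd_imp_le)
    qed
    fix l l' assume "l \<in> {..<p}" "l' \<in> {..<p}" "(c * l) mod p = (c * l') mod p"
    then show "l = l'" using *[of l l'] *[of l' l] by (cases "l \<le> l'") auto
  qed
  have "(\<lambda>l. (c * l) mod p) ` {..<p} = {..<p}"
    using p by (intro card_subset_eq) (auto simp: card_image[OF inj])
  then have "cyc p = (\<Sum>l<p. Xp ^ ((c * l) mod p))"
    unfolding cyc_def using sum.reindex[OF inj, of "\<lambda>l. Xp ^ l"] by simp
  then have "(\<Sum>l<p. Xp ^ (c * l)) - cyc p = (\<Sum>l<p. Xp ^ (c * l) - Xp ^ ((c * l) mod p))"
    by (simp only: sum_subtractf)
  moreover have "cyc p dvd \<dots>"
    by (intro dvd_sum dvd_trans[OF cyc_dvd_period X_power_mod])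
  ultimately have "cyc p dvd (\<Sum>l<p. Xp ^ (c * l)) - cyc p" by simp
  then show ?thesis by (simp add: dvd_diff_left_iff)
qed

lemma cyc_dvd_long_sum:
  assumes "prime p" "\<not> p dvd c"
  shows "cyc p dvd (\<Sum>l<1 + p * L. Xp ^ (c * l)) - 1"
proof (induction L)
  case (Suc L)
  have "(\<Sum>l<1 + p * Suc L. Xp ^ (c * l)) = (\<Sum>l<1 + p * L. Xp ^ (c * l)) + (\<Sum>l<p. Xp ^ (c * (1 + p * L + l)))"
  proof -
    have "1 + p * Suc L = (1 + p * L) + p" by simp
    then show ?thesis by (simp only: sum_lessThan_add)
  qed
  also have "(\<Sum>l<p. (Xp :: int poly) ^ (c * (1 + p * L + l))) = Xp ^ (c * (1 + p * L)) * (\<Sum>l<p. Xp ^ (c * l))"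
    by (simp only: sum_distrib_left power_add[symmetric] distrib_left)
  finally have eq: "(\<Sum>l<1 + p * Suc L. Xp ^ (c * l)) - 1
      = ((\<Sum>l<1 + p * L. Xp ^ (c * l)) - 1) + Xp ^ (c * (1 + p * L)) * (\<Sum>l<p. Xp ^ (c * l))" by simp
  show ?case unfolding eq using Suc cyc_dvd_sum_multiples[OF assms] by (intro dvd_add dvd_mult) auto
qed simp


section \<open>Dimensions of quotients of subspaces\<close>

text \<open>A separate locale keeps the facts below apart from those on real vector spaces.\<close>

locale quotient_space = vector_space scale
  for scale :: "'a::field \<Rightarrow> 'b::ab_group_add \<Rightarrow> 'b" (infixr "*s" 75)
begin

abbreviation "lin \<equiv> Vector_Spaces.linear scale scale"

text \<open>The dimension of \<open>Z/B\<close>. The quotient is realized as the image of \<open>Z\<close> under a linear map with kernel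
  \<open>B\<close>, so that all spaces stay inside the ambient one. The ambient space may have infinite
  dimension.\<close>

definition quot_dim :: "'b set \<Rightarrow> 'b set \<Rightarrow> nat \<Rightarrow> bool" where
  "quot_dim Z B d \<longleftrightarrow> (\<exists>g C. lin g \<and> (\<forall>z\<in>Z. g z = 0 \<longleftrightarrow> z \<in> B) \<and>
     finite C \<and> local.independent C \<and> span C = g ` Z \<and> card C = d)"

lemma lin_add: "lin f \<Longrightarrow> f (x + y) = f x + f y"
  and lin_scale: "lin f \<Longrightarrow> f (c *s x) = c *s f x"
  unfolding Vector_Spaces.linear_iff by auto

lemma lin_hom: "lin f \<Longrightarrow> module_hom scale scale f"
  by (simp add: Vector_Spaces.linear_def)

lemmas lin_diff = module_hom.diff[OF lin_hom]
  and lin_zero = module_hom.zero[OF lin_hom]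
  and lin_image_subspace = module_hom.subspace_image[OF lin_hom]
  and lin_image_span = module_hom.span_image[OF lin_hom]

lemma span_Int_independent:
  assumes "local.independent (C \<union> D)" "C \<inter> D = {}" "v \<in> span C" "v \<in> span D"
  shows "v = 0"
proof -
  have "representation (C \<union> D) v = representation C v" "representation (C \<union> D) v = representation D v"
    using assms by (auto intro: representation_extend)
  then have "representation (C \<union> D) v b = 0" for b
    using representation_ne_zero[of C v b] representation_ne_zero[of D v b] assms(2) by auto
  moreover have "v \<in> span (C \<union> D)" using assms(3) span_mono[of C "C \<union> D"] by auto
  ultimately show ?thesis
    using sum_nonzero_representation_eq[OF assms(1), of v] by simp
qed

text \<open>Extend a basis of \<open>Y\<close> to the whole space, and send the basis vectors in \<open>Y\<close> to zero and the others
  to themselves.\<close>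

lemma exists_linear_with_kernel:
  assumes "subspace Y"
  shows "\<exists>g. lin g \<and> (\<forall>z. g z = 0 \<longleftrightarrow> z \<in> Y)"
proof -
  interpret P: vector_space_pair scale scale by unfold_locales
  obtain C where C: "C \<subseteq> Y" "local.independent C" "Y \<subseteq> span C"
    using maximal_independent_subset by blast
  obtain C' where C': "C \<subseteq> C'" "local.independent C'" "UNIV \<subseteq> span C'"
    using maximal_independent_subset_extend[OF subset_UNIV C(2)] by metis
  define g where "g = P.construct C' (\<lambda>c. if c \<in> C then 0 else c)"
  have g: "lin g" unfolding g_def by (rule P.linear_construct[OF C'(2)])
  have gb: "g c = (if c \<in> C then 0 else c)" if "c \<in> C'" for c
    unfolding g_def by (rule P.construct_basis[OF C'(2) that])
  have "z - g z \<in> Y" for z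
  proof -
    have "z \<in> span C'" using C'(3) by auto
    then show ?thesis
    proof (induction rule: span_induct)
      case (step x)
      then show ?case using gb[of x] C(1) assms by (auto simp: subspace_0)
    next
      case base
      show ?case unfolding subspace_def
      proof (intro conjI ballI allI)
        show "0 \<in> {z. z - g z \<in> Y}" using lin_zero[OF g] subspace_0[OF assms] by simp
      next
        fix x y assume "x \<in> {z. z - g z \<in> Y}" "y \<in> {z. z - g z \<in> Y}"
        then have "(x - g x) + (y - g y) \<in> Y" using subspace_add[OF assms] by simp
        then show "x + y \<in> {z. z - g z \<in> Y}" by (simp add: lin_add[OF g] algebra_simps)
      next
        fix c x assume "x \<in> {z. z - g z \<in> Y}"
        then have "c *s (x - g x) \<in> Y" using subspace_scale[OF assms] by simp
        then show "c *s x \<in> {z. z - g z \<in> Y}"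
          by (simp add: lin_scale[OF g] local.scale_right_diff_distrib)
      qed
    qed
  qed
  moreover have "g z = 0" if "z \<in> Y" for z
  proof -
    have "z \<in> span C" using that C by auto
    then show ?thesis
    proof (induction rule: span_induct)
      case (step x)
      then show ?case using gb[of x] C'(1) by auto
    next
      case base
      show ?case unfolding subspace_def
        by (auto simp: lin_zero[OF g] lin_add[OF g] lin_scale[OF g])
    qed
  qed
  ultimately show ?thesis using g by (metis diff_zero)
qed

text \<open>If \<open>g1\<close> realizes \<open>Z/B\<close> and \<open>g2\<close> realizes \<open>Z/Y\<close>, then \<open>g2\<close> factors through \<open>g1\<close> by a linear map
  \<open>k\<close>, whose kernel \<open>g1 Y\<close> realizes \<open>Y/B\<close>. This is the rank-nullity theorem for \<open>k\<close>. It gives both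
  the uniqueness and the additivity of \<open>quot_dim\<close>.\<close>

lemma rank_nullity_pair:
  assumes g1: "lin g1" and g2: "lin g2" and Z: "subspace Z"
    and ker: "\<And>z. z \<in> Z \<Longrightarrow> g1 z = 0 \<Longrightarrow> g2 z = 0"
    and C: "finite C" "local.independent C" "span C = g1 ` Z"
  shows "\<exists>C1 C2. finite C1 \<and> local.independent C1 \<and> span C1 = g1 ` {z \<in> Z. g2 z = 0} \<and>
           finite C2 \<and> local.independent C2 \<and> span C2 = g2 ` Z \<and> card C1 + card C2 = card C"
proof -
  interpret P: vector_space_pair scale scale by unfold_locales
  let ?Y = "{z \<in> Z. g2 z = 0}"
  have Y: "subspace ?Y"
    unfolding subspace_def
    by (auto simp: lin_zero[OF g2] lin_add[OF g2] lin_scale[OF g2] subspace_0[OF Z] subspace_add[OF Z]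
        subspace_scale[OF Z])
  obtain C1 where C1: "C1 \<subseteq> g1 ` ?Y" "local.independent C1" "g1 ` ?Y \<subseteq> span C1"
    using maximal_independent_subset by blast
  have "C1 \<subseteq> g1 ` Z" using C1(1) by auto
  then obtain C' where C': "C1 \<subseteq> C'" "C' \<subseteq> g1 ` Z" "local.independent C'" "g1 ` Z \<subseteq> span C'"
    using maximal_independent_subset_extend[OF _ C1(2)] by metis
  have spC': "span C' = g1 ` Z"
    using C'(2,4) lin_image_subspace[OF g1 Z] span_minimal by blast
  have spC1: "span C1 = g1 ` ?Y"
    using C1(1,3) lin_image_subspace[OF g1 Y] span_minimal by blast
  have finC': "finite C'"
    using independent_span_bound[OF C(1) C'(3)] C(3) C'(2) by auto
  have cardC': "card C' = card C"
    using dim_span_eq_card_independent[OF C(2)] dim_span_eq_card_independent[OF C'(3)] spC' C(3) by simp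
  define D where "D = C' - C1"
  have D: "finite D" "C' = C1 \<union> D" "C1 \<inter> D = {}" "local.independent D"
    using finC' C'(1,3) independent_mono[of C' D] by (auto simp: D_def)
  have "\<forall>c\<in>C'. \<exists>z\<in>Z. g1 z = c" using C'(2) by auto
  then obtain pz where pz: "\<And>c. c \<in> C' \<Longrightarrow> pz c \<in> Z \<and> g1 (pz c) = c" by metis
  define k where "k = P.construct C' (\<lambda>c. g2 (pz c))"
  have k: "lin k" unfolding k_def by (rule P.linear_construct[OF C'(3)])
  have kb: "k c = g2 (pz c)" if "c \<in> C'" for c
    unfolding k_def by (rule P.construct_basis[OF C'(3) that])
  have ex: "\<exists>z\<in>Z. g1 z = v \<and> k v = g2 z" if "v \<in> span C'" for v
    using that
  proof (induction rule: span_induct)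
    case (step x)
    then show ?case using pz kb by auto
  next
    case base
    show ?case unfolding subspace_def
    proof (intro conjI ballI allI)
      show "0 \<in> {v. \<exists>z\<in>Z. g1 z = v \<and> k v = g2 z}"
        using subspace_0[OF Z] lin_zero[OF g1] lin_zero[OF g2] lin_zero[OF k] by auto
    next
      fix x y assume "x \<in> {v. \<exists>z\<in>Z. g1 z = v \<and> k v = g2 z}" "y \<in> {v. \<exists>z\<in>Z. g1 z = v \<and> k v = g2 z}"
      then obtain z z' where z: "z \<in> Z" "z' \<in> Z" "g1 z = x" "k x = g2 z" "g1 z' = y" "k y = g2 z'" by blast
      then have "z + z' \<in> Z" "g1 (z + z') = x + y" "k (x + y) = g2 (z + z')"
        by (simp_all add: lin_add[OF k] lin_add[OF g1] lin_add[OF g2] subspace_add[OF Z])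
      then show "x + y \<in> {v. \<exists>z\<in>Z. g1 z = v \<and> k v = g2 z}" by blast
    next
      fix c x assume "x \<in> {v. \<exists>z\<in>Z. g1 z = v \<and> k v = g2 z}"
      then obtain z where z: "z \<in> Z" "g1 z = x" "k x = g2 z" by blast
      then have "c *s z \<in> Z" "g1 (c *s z) = c *s x" "k (c *s x) = g2 (c *s z)"
        by (simp_all add: lin_scale[OF k] lin_scale[OF g1] lin_scale[OF g2] subspace_scale[OF Z])
      then show "c *s x \<in> {v. \<exists>z\<in>Z. g1 z = v \<and> k v = g2 z}" by blast
    qed
  qed
  have kg: "k (g1 z) = g2 z" if z: "z \<in> Z" for z
  proof -
    have "g1 z \<in> span C'" using spC' z by auto
    then obtain z' where z': "z' \<in> Z" "g1 z' = g1 z" "k (g1 z) = g2 z'" using ex by blast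
    have "g2 (z - z') = 0"
      using ker[of "z - z'"] z z' by (simp add: lin_diff[OF g1] subspace_diff[OF Z])
    then show ?thesis using z' by (simp add: lin_diff[OF g2])
  qed
  have kD: "v = 0" if v: "v \<in> span D" "k v = 0" for v
  proof -
    have "v \<in> span C'" using v D(2) span_mono[of D C'] by auto
    then obtain z where z: "z \<in> Z" "v = g1 z" using spC' by auto
    then have "z \<in> ?Y" using v kg by auto
    then have "v \<in> span C1" using spC1 z by auto
    then show ?thesis using span_Int_independent[of C1 D v] D v C'(3) by auto
  qed
  have "inj_on k (span D)"
  proof (rule inj_onI)
    fix x y assume "x \<in> span D" "y \<in> span D" "k x = k y"
    then have "x - y = 0" using kD[of "x - y"] by (simp add: lin_diff[OF k] span_diff)
    then show "x = y" by simp
  qed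
  then have indep: "local.independent (k ` D)" and inj: "inj_on k D"
    using module_hom.independent_injective_image[OF lin_hom[OF k] D(4)]
    using inj_on_subset[OF _ span_superset] by blast+
  have "k c = 0" if c: "c \<in> C1" for c
  proof -
    obtain z where "z \<in> ?Y" "c = g1 z" using c C1(1) by blast
    then show ?thesis using kg by auto
  qed
  then have "k ` C' \<subseteq> insert 0 (k ` D)" using D(2) by auto
  then have "span (k ` C') \<subseteq> span (k ` D)" using span_mono[of "k ` C'" "insert 0 (k ` D)"] by simp
  moreover have "span (k ` D) \<subseteq> span (k ` C')" using D(2) by (intro span_mono) auto
  ultimately have "span (k ` D) = k ` (g1 ` Z)" using lin_image_span[OF k, of C'] spC' by auto
  also have "\<dots> = g2 ` Z" using kg by (auto simp: image_image)
  finally have sp: "span (k ` D) = g2 ` Z" .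
  have "card C1 + card (k ` D) = card C"
    using card_image[OF inj] cardC' D(2,3) card_Un_disjoint[of C1 D] D(1) finC' C'(1)
    by (auto dest: finite_subset)
  then show ?thesis
    using sp indep D(1) spC1 C1(2) finite_subset[OF C'(1) finC']
    by (intro exI[of _ C1] exI[of _ "k ` D"]) auto
qed

lemma quot_dim_unique:
  assumes "quot_dim Z B d" "quot_dim Z B d'" "subspace Z"
  shows "d = d'"
proof -
  obtain g C where g: "lin g" "\<And>z. z \<in> Z \<Longrightarrow> g z = 0 \<longleftrightarrow> z \<in> B" "finite C" "local.independent C"
    "span C = g ` Z" "card C = d" using assms(1) unfolding quot_dim_def by blast
  obtain g' C' where g': "lin g'" "\<And>z. z \<in> Z \<Longrightarrow> g' z = 0 \<longleftrightarrow> z \<in> B" "finite C'" "local.independent C'"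
    "span C' = g' ` Z" "card C' = d'" using assms(2) unfolding quot_dim_def by blast
  obtain C1 C2 where C: "finite C1" "local.independent C1" "span C1 = g ` {z \<in> Z. g' z = 0}"
      "finite C2" "local.independent C2" "span C2 = g' ` Z" "card C1 + card C2 = card C"
    using rank_nullity_pair[OF g(1) g'(1) assms(3) _ g(3,4,5)] g(2) g'(2) by blast
  have "span C1 \<subseteq> {0}" using C(3) g(2) g'(2) by auto
  then have "C1 \<subseteq> {0}" using span_superset[of C1] by blast
  then have "C1 = {}" using C(2) dependent_zero[of C1] by auto
  moreover have "card C2 = card C'"
    using dim_span_eq_card_independent[OF C(5)] dim_span_eq_card_independent[OF g'(4)] C(6) g'(5) by simp
  ultimately show ?thesis using C(7) g(6) g'(6) by simp
qed

lemma quot_dim_split: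
  assumes "quot_dim Z B d" "B \<subseteq> Y" "Y \<subseteq> Z" "subspace Y" "subspace Z"
  shows "\<exists>a b. quot_dim Y B a \<and> quot_dim Z Y b \<and> d = a + b"
proof -
  obtain g C where g: "lin g" "\<And>z. z \<in> Z \<Longrightarrow> g z = 0 \<longleftrightarrow> z \<in> B" "finite C" "local.independent C"
    "span C = g ` Z" "card C = d" using assms(1) unfolding quot_dim_def by blast
  obtain h where h: "lin h" "\<And>z. h z = 0 \<longleftrightarrow> z \<in> Y" using exists_linear_with_kernel[OF assms(4)] by blast
  obtain C1 C2 where C: "finite C1" "local.independent C1" "span C1 = g ` {z \<in> Z. h z = 0}"
      "finite C2" "local.independent C2" "span C2 = h ` Z" "card C1 + card C2 = card C"
    using rank_nullity_pair[OF g(1) h(1) assms(5) _ g(3,4,5)] g(2) h(2) assms(2) by blast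
  have "{z \<in> Z. h z = 0} = Y" using h(2) assms(3) by auto
  then have "quot_dim Y B (card C1)"
    unfolding quot_dim_def using g(1,2) C(1-3) assms(3) by (intro exI[of _ g] exI[of _ C1]) auto
  moreover have "quot_dim Z Y (card C2)"
    unfolding quot_dim_def using h C(4-6) by (intro exI[of _ h] exI[of _ C2]) auto
  ultimately show ?thesis using C(7) g(6) by auto
qed

text \<open>The map \<open>f\<close> induces an isomorphism from \<open>Z/B\<close> to \<open>Z'/B'\<close>; this direction transports finiteness from
  the target to the source.\<close>

lemma quot_dim_pullback:
  assumes "quot_dim Z' B' d" "lin f" "subspace Z'" "B' \<subseteq> Z'"
    and "\<And>z. z \<in> Z \<Longrightarrow> f z \<in> Z'" "\<And>z. z \<in> Z \<Longrightarrow> f z \<in> B' \<longleftrightarrow> z \<in> B"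
    and surj: "\<And>z'. z' \<in> Z' \<Longrightarrow> \<exists>z\<in>Z. z' - f z \<in> B'"
  shows "quot_dim Z B d"
proof -
  obtain g C where g: "lin g" "\<And>z. z \<in> Z' \<Longrightarrow> g z = 0 \<longleftrightarrow> z \<in> B'" "finite C" "local.independent C"
    "span C = g ` Z'" "card C = d" using assms(1) unfolding quot_dim_def by blast
  have "lin (g \<circ> f)" using assms(2) g(1) by (auto simp: Vector_Spaces.linear_iff)
  moreover have "(g \<circ> f) z = 0 \<longleftrightarrow> z \<in> B" if "z \<in> Z" for z using assms(5,6) g(2) that by simp
  moreover have "(g \<circ> f) ` Z = g ` Z'"
  proof (intro equalityI subsetI)
    fix x assume "x \<in> g ` Z'"
    then obtain z' where z': "z' \<in> Z'" "x = g z'" by blast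
    then obtain z where z: "z \<in> Z" "z' - f z \<in> B'" using surj by blast
    then have "g (z' - f z) = 0" using g(2) assms(4) by blast
    then show "x \<in> (g \<circ> f) ` Z" using z z' by (simp add: lin_diff[OF g(1)])
  qed (use assms(5) in auto)
  ultimately show ?thesis
    unfolding quot_dim_def using g(3-6) by (intro exI[of _ "g \<circ> f"] exI[of _ C]) simp
qed

end

section \<open>Cohomology of two-periodic complexes modulo a subspace\<close>

context quotient_space
begin

text \<open>The counterpart of \<open>quot_dim_pullback\<close> from the source to the target.\<close>

lemma quot_dim_pushforward:
  assumes "quot_dim Z B d" "lin f" "subspace Z" "subspace B'"
    and "\<And>z. z \<in> Z \<Longrightarrow> f z \<in> Z'" "\<And>z. z \<in> Z \<Longrightarrow> f z \<in> B' \<longleftrightarrow> z \<in> B"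
    and surj: "\<And>z'. z' \<in> Z' \<Longrightarrow> \<exists>z\<in>Z. z' - f z \<in> B'"
  shows "quot_dim Z' B' d"
proof -
  obtain g C where g: "lin g" "\<And>z. z \<in> Z \<Longrightarrow> g z = 0 \<longleftrightarrow> z \<in> B" "finite C" "local.independent C"
    "span C = g ` Z" "card C = d" using assms(1) unfolding quot_dim_def by blast
  obtain g' where g': "lin g'" "\<And>z. g' z = 0 \<longleftrightarrow> z \<in> B'"
    using exists_linear_with_kernel[OF assms(4)] by blast
  have lin: "lin (g' \<circ> f)" using assms(2) g'(1) by (auto simp: Vector_Spaces.linear_iff)
  obtain C1 C2 where C: "finite C1" "local.independent C1" "span C1 = g ` {z \<in> Z. (g' \<circ> f) z = 0}"
      "finite C2" "local.independent C2" "span C2 = (g' \<circ> f) ` Z" "card C1 + card C2 = card C"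
    using rank_nullity_pair[OF g(1) lin assms(3) _ g(3,4,5)] g(2) g'(2) assms(6) by auto
  have "span C1 \<subseteq> {0}" using C(3) g(2) g'(2) assms(6) by auto
  then have "C1 \<subseteq> {0}" using span_superset[of C1] by blast
  then have "C1 = {}" using C(2) dependent_zero[of C1] by auto
  moreover have "(g' \<circ> f) ` Z = g' ` Z'"
  proof (intro equalityI subsetI)
    fix x assume "x \<in> g' ` Z'"
    then obtain z' where z': "z' \<in> Z'" "x = g' z'" by blast
    then obtain z where z: "z \<in> Z" "z' - f z \<in> B'" using surj by blast
    then have "g' (z' - f z) = 0" using g'(2) by blast
    then show "x \<in> (g' \<circ> f) ` Z" using z z' by (simp add: lin_diff[OF g'(1)])
  qed (use assms(5) in auto)
  ultimately show ?thesis
    unfolding quot_dim_def using C g' g(6) by (intro exI[of _ g'] exI[of _ C2]) auto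
qed

text \<open>The cocycles of degree \<open>A\<close> of the quotient complex by \<open>Q\<close>, as a subspace of \<open>A\<close>. In the coboundaries
  below, \<open>A'\<close> is the degree from which \<open>d\<close> maps to \<open>A\<close>.\<close>

definition cocycles :: "('b \<Rightarrow> 'b) \<Rightarrow> 'b set \<Rightarrow> 'b set \<Rightarrow> 'b set" where
  "cocycles d Q A = {m \<in> A. d m \<in> Q}"

definition coboundaries :: "('b \<Rightarrow> 'b) \<Rightarrow> 'b set \<Rightarrow> 'b set \<Rightarrow> 'b set \<Rightarrow> 'b set" where
  "coboundaries d Q A A' = {m \<in> A. \<exists>u\<in>A'. m - d u \<in> Q}"

lemma subspace_cocycles:
  assumes "lin d" "subspace Q" "subspace A" shows "subspace (cocycles d Q A)"
  unfolding subspace_def cocycles_def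
  using assms by (auto simp: lin_zero lin_add lin_scale subspace_0 subspace_add subspace_scale)

lemma subspace_coboundaries:
  assumes d: "lin d" and "subspace Q" "subspace A" "subspace A'" shows "subspace (coboundaries d Q A A')"
  unfolding subspace_def
proof (intro conjI ballI allI)
  show "0 \<in> coboundaries d Q A A'"
    using assms by (auto simp: coboundaries_def lin_zero subspace_0 intro!: bexI[of _ 0])
next
  fix x y assume "x \<in> coboundaries d Q A A'" "y \<in> coboundaries d Q A A'"
  then obtain u v where u: "x \<in> A" "u \<in> A'" "x - d u \<in> Q" "y \<in> A" "v \<in> A'" "y - d v \<in> Q"
    by (auto simp: coboundaries_def)
  have "x + y - d (u + v) = (x - d u) + (y - d v)" by (simp add: lin_add[OF d])
  moreover have "(x - d u) + (y - d v) \<in> Q" using u assms subspace_add by blast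
  ultimately have "x + y - d (u + v) \<in> Q" by metis
  then show "x + y \<in> coboundaries d Q A A'"
    using u assms by (auto simp: coboundaries_def subspace_add intro!: bexI[of _ "u + v"])
next
  fix c x assume "x \<in> coboundaries d Q A A'"
  then obtain u where u: "x \<in> A" "u \<in> A'" "x - d u \<in> Q" by (auto simp: coboundaries_def)
  have "c *s x - d (c *s u) = c *s (x - d u)" by (simp add: lin_scale[OF d] local.scale_right_diff_distrib)
  then have "c *s x - d (c *s u) \<in> Q" using u assms by (simp add: subspace_scale)
  then show "c *s x \<in> coboundaries d Q A A'"
    using u assms by (auto simp: coboundaries_def subspace_scale intro!: bexI[of _ "c *s u"])
qed

text \<open>Let \<open>y\<close> be an endomorphism of the complex \<open>M/Q\<close> that is injective with left inverse \<open>s\<close> and acts by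
  zero on cohomology (\<open>null\<close>), and let \<open>Q' = Q + y M\<close>. The long exact sequence of
  \<open>0 \<rightarrow> M/Q \<rightarrow> M/Q \<rightarrow> M/Q' \<rightarrow> 0\<close> falls apart into short exact sequences
  \<open>0 \<rightarrow> H(M/Q) \<rightarrow> H(M/Q') \<rightarrow> H(M/Q) \<rightarrow> 0\<close>, the second arrow being the connecting map
  \<open>m \<mapsto> y\<^sup>-\<^sup>1 (d m) = s (d m)\<close>, which changes the degree by the one of \<open>d\<close> and of \<open>y\<close>. The kernel
  of the connecting map on cocycles is called \<open>Y\<close> in the proof. Finiteness is part of the
  conclusion.\<close>

lemma cohomology_modulo_null_homotopic:
  assumes lin: "lin d" "lin y" "lin s"
    and sub: "subspace Q" "subspace A" "subspace A'" "subspace C" "subspace C'"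
    and dd: "\<And>v. d (d v) = 0" and dy: "\<And>v. d (y v) = y (d v)" and sy: "\<And>v. s (y v) = v"
    and dA: "\<And>v. v \<in> A \<Longrightarrow> d v \<in> A'" "\<And>v. v \<in> A' \<Longrightarrow> d v \<in> A"
    and dC: "\<And>v. v \<in> C \<Longrightarrow> d v \<in> C'" "\<And>v. v \<in> C' \<Longrightarrow> d v \<in> C"
    and yC: "\<And>v. v \<in> C \<Longrightarrow> y v \<in> A'" "\<And>v. v \<in> C' \<Longrightarrow> y v \<in> A"
    and sA: "\<And>v. v \<in> A' \<Longrightarrow> s v \<in> C" "\<And>v. v \<in> A \<Longrightarrow> s v \<in> C'"
    and Q: "\<And>v. v \<in> Q \<Longrightarrow> d v \<in> Q" "\<And>v. v \<in> Q \<Longrightarrow> y v \<in> Q" "\<And>v. v \<in> Q \<Longrightarrow> s v \<in> Q"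
    and null: "\<And>z. z \<in> C \<Longrightarrow> d z \<in> Q \<Longrightarrow> \<exists>u\<in>A. y z - d u \<in> Q"
      "\<And>z. z \<in> C' \<Longrightarrow> d z \<in> Q \<Longrightarrow> \<exists>u\<in>A'. y z - d u \<in> Q"
    and Q': "\<And>v. v \<in> Q' \<longleftrightarrow> v - y (s v) \<in> Q"
    and D: "quot_dim (cocycles d Q' A) (coboundaries d Q' A A') D"
  shows "\<exists>a b. quot_dim (cocycles d Q A) (coboundaries d Q A A') a \<and>
           quot_dim (cocycles d Q C) (coboundaries d Q C C') b \<and> D = a + b"
proof -
  note ladd = lin_add[OF lin(1)] lin_add[OF lin(2)] lin_add[OF lin(3)]
  note ldiff = lin_diff[OF lin(1)] lin_diff[OF lin(2)] lin_diff[OF lin(3)]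
  note lscale = lin_scale[OF lin(1)] lin_scale[OF lin(2)] lin_scale[OF lin(3)]
  note lzero = lin_zero[OF lin(1)] lin_zero[OF lin(2)] lin_zero[OF lin(3)]
  note Qadd = subspace_add[OF sub(1)] and Qdiff = subspace_diff[OF sub(1)]
  have subQ': "subspace Q'"
    unfolding subspace_def
    using sub(1) by (auto simp: Q' lzero ladd lscale subspace_0 add_diff_add subspace_add
        subspace_scale local.scale_right_diff_distrib[symmetric])
  have QQ': "v \<in> Q'" if "v \<in> Q" for v using that Q Qdiff by (simp add: Q')
  have yQ': "y v \<in> Q'" for v using subspace_0[OF sub(1)] by (simp add: Q' sy)
  have dQ': "d v - y (d (s v)) \<in> Q" if "v \<in> Q'" for v
    using Q(1)[of "v - y (s v)"] that by (simp add: Q' ldiff dy)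
  have inj: "v \<in> Q" if "y v \<in> Q" for v using Q(3)[OF that] by (simp add: sy)
  define Y where "Y = {m \<in> cocycles d Q' A. s (d m) \<in> coboundaries d Q C C'}"
  have subZ': "subspace (cocycles d Q' A)" by (rule subspace_cocycles[OF lin(1) subQ' sub(2)])
  have subB: "subspace (coboundaries d Q C C')" by (rule subspace_coboundaries[OF lin(1) sub(1,4,5)])
  have subB': "subspace (coboundaries d Q' A A')" by (rule subspace_coboundaries[OF lin(1) subQ' sub(2,3)])
  have linsd: "lin (\<lambda>v. s (d v))" using lin by (auto simp: Vector_Spaces.linear_iff)
  have subY: "subspace Y"
    unfolding subspace_def Y_def using subZ' subB
    by (auto simp: lin_zero[OF linsd] lin_add[OF linsd] lin_scale[OF linsd] subspace_0 subspace_add subspace_scale)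
  have ZY: "m \<in> Y" if m: "m \<in> cocycles d Q A" for m
  proof -
    have "m \<in> A" "d m \<in> Q" using m by (auto simp: cocycles_def)
    then have "s (d m) \<in> C" "s (d m) - d 0 \<in> Q" using dA sA Q by (auto simp: lzero)
    then have "s (d m) \<in> coboundaries d Q C C'"
      unfolding coboundaries_def using subspace_0[OF sub(5)] by blast
    then show ?thesis using \<open>m \<in> A\<close> QQ'[OF \<open>d m \<in> Q\<close>] by (simp add: Y_def cocycles_def)
  qed
  have BY: "m \<in> Y" if m: "m \<in> coboundaries d Q' A A'" for m
  proof -
    obtain u where u: "m \<in> A" "u \<in> A'" "m - d u \<in> Q'" using m by (auto simp: coboundaries_def)
    define v where "v = m - d u"
    have v: "v \<in> A" "d v = d m" using u sub(2) dA by (auto simp: v_def subspace_diff ldiff dd)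
    have q: "d m - y (d (s v)) \<in> Q" using dQ'[of v] u(3) v(2) by (simp add: v_def)
    then have "s (d m) - d (s v) \<in> Q" using Q(3)[OF q] by (simp add: ldiff sy)
    moreover have "s (d m) \<in> C" "s v \<in> C'" using u v sA dA by auto
    ultimately have "s (d m) \<in> coboundaries d Q C C'" unfolding coboundaries_def by blast
    moreover have "d m \<in> Q'"
    proof -
      have "(d m - y (d (s v))) + y (d (s v)) \<in> Q'" using QQ'[OF q] yQ' subspace_add[OF subQ'] by blast
      then show ?thesis by simp
    qed
    ultimately show ?thesis using u(1) by (simp add: Y_def cocycles_def)
  qed
  obtain a b where ab: "quot_dim Y (coboundaries d Q' A A') a" "quot_dim (cocycles d Q' A) Y b" "D = a + b"
    using quot_dim_split[OF D _ _ subY subZ'] BY by (auto simp: Y_def)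
  have "quot_dim (cocycles d Q A) (coboundaries d Q A A') a"
  proof (rule quot_dim_pullback[OF ab(1), where f = "\<lambda>x. x"])
    show "lin (\<lambda>x. x)" using vector_space_axioms by (auto simp: Vector_Spaces.linear_iff)
    show "subspace Y" by (rule subY)
    show "coboundaries d Q' A A' \<subseteq> Y" using BY by blast
    show "z \<in> Y" if "z \<in> cocycles d Q A" for z using ZY that .
    show "z \<in> coboundaries d Q' A A' \<longleftrightarrow> z \<in> coboundaries d Q A A'" if z: "z \<in> cocycles d Q A" for z
    proof
      assume "z \<in> coboundaries d Q A A'"
      then show "z \<in> coboundaries d Q' A A'" using QQ' by (auto simp: coboundaries_def)
    next
      assume "z \<in> coboundaries d Q' A A'"
      then obtain u where u: "z \<in> A" "u \<in> A'" "z - d u \<in> Q'" by (auto simp: coboundaries_def)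
      define v where "v = z - d u"
      have v: "v \<in> A" "d v \<in> Q" using u sub(2) dA z by (auto simp: v_def subspace_diff ldiff dd cocycles_def)
      have "d v - (d v - y (d (s v))) \<in> Q" using Qdiff[OF v(2) dQ'] u(3) by (simp only: v_def)
      then have "d (s v) \<in> Q" using inj by simp
      then obtain u' where u': "u' \<in> A'" "y (s v) - d u' \<in> Q" using null(2)[of "s v"] sA v by blast
      have "(v - y (s v)) + (y (s v) - d u') \<in> Q" using u(3) u'(2) Qadd by (simp only: v_def Q')
      then have "z - d (u + u') \<in> Q" by (simp add: v_def ladd algebra_simps)
      then show "z \<in> coboundaries d Q A A'"
        unfolding coboundaries_def using u u' subspace_add[OF sub(3)] by blast
    qed
    show "\<exists>z\<in>cocycles d Q A. m - z \<in> coboundaries d Q' A A'" if m: "m \<in> Y" for m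
    proof -
      obtain u where u: "u \<in> C'" "s (d m) - d u \<in> Q" using m by (auto simp: Y_def coboundaries_def)
      have mA: "m \<in> A" "d m - y (s (d m)) \<in> Q" using m by (auto simp: Y_def cocycles_def Q')
      have "(d m - y (s (d m))) + y (s (d m) - d u) \<in> Q" using mA(2) Q(2)[OF u(2)] Qadd by blast
      then have "d (m - y u) \<in> Q" by (simp add: ldiff dy)
      moreover have "m - y u \<in> A" using mA(1) yC(2)[OF u(1)] subspace_diff[OF sub(2)] by blast
      moreover have "m - (m - y u) \<in> coboundaries d Q' A A'"
        using yC(2)[OF u(1)] yQ' subspace_0[OF sub(3)] by (auto simp: coboundaries_def lzero intro!: bexI[of _ 0])
      ultimately show ?thesis unfolding cocycles_def by blast
    qed
  qed
  moreover have "quot_dim (cocycles d Q C) (coboundaries d Q C C') b"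
  proof (rule quot_dim_pushforward[OF ab(2) linsd subZ' subB])
    show "s (d m) \<in> cocycles d Q C" if "m \<in> cocycles d Q' A" for m
    proof -
      have m: "m \<in> A" "d m - y (s (d m)) \<in> Q" using that by (auto simp: cocycles_def Q')
      have "d (y (s (d m)) ) \<in> Q"
        using Q(1)[OF m(2)] subspace_neg[OF sub(1)] by (fastforce simp: ldiff dd)
      then show ?thesis using m(1) dA sA inj by (simp add: cocycles_def dy)
    qed
    show "s (d m) \<in> coboundaries d Q C C' \<longleftrightarrow> m \<in> Y" if "m \<in> cocycles d Q' A" for m
      using that by (simp add: Y_def)
    show "\<exists>u\<in>cocycles d Q' A. z - s (d u) \<in> coboundaries d Q C C'" if "z \<in> cocycles d Q C" for z
    proof -
      have z: "z \<in> C" "d z \<in> Q" using that by (auto simp: cocycles_def)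
      then obtain u where u: "u \<in> A" "y z - d u \<in> Q" using null(1) by blast
      have "y z - (y z - d u) \<in> Q'" using yQ' QQ'[OF u(2)] subspace_diff[OF subQ'] by blast
      then have "u \<in> cocycles d Q' A" using u by (simp add: cocycles_def)
      moreover have "z - s (d u) \<in> Q" using Q(3)[OF u(2)] by (simp add: ldiff sy)
      moreover have "z - s (d u) \<in> C" using z u sA dA subspace_diff[OF sub(4)] by blast
      ultimately have "z - s (d u) \<in> coboundaries d Q C C'"
        using subspace_0[OF sub(5)] by (auto simp: coboundaries_def lzero intro!: bexI[of _ 0])
      then show ?thesis using \<open>u \<in> cocycles d Q' A\<close> by blast
    qed
  qed
  ultimately show ?thesis using ab(3) by blast
qed

text \<open>Filter \<open>A\<close> by \<open>A \<inter> Q\<close>, the coboundaries and the cocycles. The outer quotient of \<open>A\<close> is isomorphic by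
  \<open>d\<close> to the inner quotient of \<open>A'\<close>, so these contributions cancel in the difference.\<close>

lemma euler_characteristic:
  assumes lin: "lin d" and sub: "subspace Q" "subspace A" "subspace A'"
    and dd: "\<And>v. d (d v) = 0"
    and dA: "\<And>v. v \<in> A \<Longrightarrow> d v \<in> A'" "\<And>v. v \<in> A' \<Longrightarrow> d v \<in> A"
    and Q: "\<And>v. v \<in> Q \<Longrightarrow> d v \<in> Q"
    and m: "quot_dim A (A \<inter> Q) m" "quot_dim A' (A' \<inter> Q) m'"
  shows "\<exists>h h'. quot_dim (cocycles d Q A) (coboundaries d Q A A') h \<and>
           quot_dim (cocycles d Q A') (coboundaries d Q A' A) h' \<and> int h - int h' = int m - int m'"
proof -
  have half: "\<exists>\<beta> h \<zeta>. quot_dim (coboundaries d Q A A') (A \<inter> Q) \<beta> \<and>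
      quot_dim (cocycles d Q A) (coboundaries d Q A A') h \<and> quot_dim A (cocycles d Q A) \<zeta> \<and> m = \<beta> + h + \<zeta>"
    if sub: "subspace Q" "subspace A" "subspace A'"
    and dA: "\<And>v. v \<in> A \<Longrightarrow> d v \<in> A'" "\<And>v. v \<in> A' \<Longrightarrow> d v \<in> A"
    and m: "quot_dim A (A \<inter> Q) m" for A A' m
  proof -
    have Z: "subspace (cocycles d Q A)" by (rule subspace_cocycles[OF lin that(1,2)])
    have B: "subspace (coboundaries d Q A A')" by (rule subspace_coboundaries[OF lin that(1-3)])
    have "A \<inter> Q \<subseteq> cocycles d Q A" "cocycles d Q A \<subseteq> A" using Q by (auto simp: cocycles_def)
    then obtain z \<zeta> where z: "quot_dim (cocycles d Q A) (A \<inter> Q) z" "quot_dim A (cocycles d Q A) \<zeta>" "m = z + \<zeta>"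
      using quot_dim_split[OF m _ _ Z sub(2)] by blast
    have "A \<inter> Q \<subseteq> coboundaries d Q A A'"
      using subspace_0[OF sub(3)] by (auto simp: coboundaries_def lin_zero[OF lin] intro!: bexI[of _ 0])
    moreover have "coboundaries d Q A A' \<subseteq> cocycles d Q A"
    proof
      fix x assume "x \<in> coboundaries d Q A A'"
      then obtain u where u: "x \<in> A" "x - d u \<in> Q" by (auto simp: coboundaries_def)
      have "d x \<in> Q" using Q[OF u(2)] by (simp add: lin_diff[OF lin] dd)
      then show "x \<in> cocycles d Q A" using u(1) by (simp add: cocycles_def)
    qed
    ultimately obtain \<beta> h where "quot_dim (coboundaries d Q A A') (A \<inter> Q) \<beta>"
        "quot_dim (cocycles d Q A) (coboundaries d Q A A') h" "z = \<beta> + h"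
      using quot_dim_split[OF z(1) _ _ B Z] by blast
    then show ?thesis using z by blast
  qed
  have eq: "\<zeta> = \<beta>" if sub: "subspace Q" "subspace A" "subspace A'"
    and dA: "\<And>v. v \<in> A \<Longrightarrow> d v \<in> A'" "\<And>v. v \<in> A' \<Longrightarrow> d v \<in> A"
    and \<zeta>: "quot_dim A (cocycles d Q A) \<zeta>" and \<beta>: "quot_dim (coboundaries d Q A' A) (A' \<inter> Q) \<beta>" for A A' \<zeta> \<beta>
  proof -
    have "quot_dim A (cocycles d Q A) \<beta>"
    proof (rule quot_dim_pullback[OF \<beta> lin])
      show "subspace (coboundaries d Q A' A)" by (rule subspace_coboundaries[OF lin sub(1,3,2)])
      show "A' \<inter> Q \<subseteq> coboundaries d Q A' A"
        using subspace_0[OF sub(2)] by (auto simp: coboundaries_def lin_zero[OF lin] intro!: bexI[of _ 0])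
      show "d z \<in> coboundaries d Q A' A" if "z \<in> A" for z
        using that dA subspace_0[OF sub(1)] by (auto simp: coboundaries_def intro!: bexI[of _ z])
      show "d z \<in> A' \<inter> Q \<longleftrightarrow> z \<in> cocycles d Q A" if "z \<in> A" for z
        using that dA by (auto simp: cocycles_def)
      show "\<exists>z\<in>A. z' - d z \<in> A' \<inter> Q" if "z' \<in> coboundaries d Q A' A" for z'
        using that dA subspace_diff[OF sub(3)] by (auto simp: coboundaries_def)
    qed
    then show ?thesis using quot_dim_unique[OF \<zeta>] sub(2) by blast
  qed
  obtain \<beta> h \<zeta> where 1: "quot_dim (coboundaries d Q A A') (A \<inter> Q) \<beta>"
      "quot_dim (cocycles d Q A) (coboundaries d Q A A') h" "quot_dim A (cocycles d Q A) \<zeta>" "m = \<beta> + h + \<zeta>"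
    using half[OF sub dA m(1)] by blast
  obtain \<beta>' h' \<zeta>' where 2: "quot_dim (coboundaries d Q A' A) (A' \<inter> Q) \<beta>'"
      "quot_dim (cocycles d Q A') (coboundaries d Q A' A) h'" "quot_dim A' (cocycles d Q A') \<zeta>'" "m' = \<beta>' + h' + \<zeta>'"
    using half[OF sub(1,3,2) dA(2,1) m(2)] by blast
  have "\<zeta> = \<beta>'" "\<zeta>' = \<beta>" using eq[OF sub dA 1(3) 2(1)] eq[OF sub(1,3,2) dA(2,1) 2(3) 1(1)] by auto
  then show ?thesis using 1 2 by (intro exI[of _ h] exI[of _ h']) auto
qed

end

section \<open>Multivariate power series\<close>

abbreviation lookup :: "('a \<Rightarrow>\<^sub>0 'b::zero) \<Rightarrow> 'a \<Rightarrow> 'b" where "lookup \<equiv> Poly_Mapping.lookup"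

lemma mcoeff_0 [simp]: "mcoeff 0 a = 0" by (simp add: zero_mfps.rep_eq)
lemma mcoeff_add [simp]: "mcoeff (f + g) a = mcoeff f a + mcoeff g a" by (simp add: plus_mfps.rep_eq)
lemma mcoeff_diff [simp]: "mcoeff (f - g) a = mcoeff f a - mcoeff g a" by (simp add: minus_mfps.rep_eq)
lemma mcoeff_uminus [simp]: "mcoeff (- f) a = - mcoeff f a" by (simp add: uminus_mfps.rep_eq)
lemma mcoeff_1: "mcoeff 1 a = (if a = 0 then 1 else 0)" by (simp add: one_mfps.rep_eq)
lemma mcoeff_times: "mcoeff (f * g) c = (\<Sum>(a, b)\<in>splits c. mcoeff f a * mcoeff g b)"
  by (simp add: times_mfps.rep_eq)
lemma mcoeff_sum [simp]: "mcoeff (sum f A) a = (\<Sum>x\<in>A. mcoeff (f x) a)"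
  by (induction A rule: infinite_finite_induct) simp_all

lemma splits_0 [simp]: "splits (0 :: 'n \<Rightarrow>\<^sub>0 nat) = {(0, 0)}"
proof -
  have *: "a = 0 \<and> b = 0" if "a + b = 0" for a b :: "'n \<Rightarrow>\<^sub>0 nat"
  proof -
    have "lookup a i + lookup b i = 0" for i using that by (metis lookup_add lookup_zero)
    then show ?thesis by (auto intro!: poly_mapping_eqI)
  qed
  show ?thesis by (auto simp: splits_def dest: *)
qed

lemma mcoeff_mconst: "mcoeff (mconst c) a = (if a = 0 then c else 0)"
  by (simp add: mconst.rep_eq)

lemma mcoeff_mconst_mult [simp]:
  fixes f :: "('n, 'k::comm_ring_1) mfps"
  shows "mcoeff (mconst c * f) a = c * mcoeff f a"
proof -
  have "(\<Sum>(x, y)\<in>splits a. mcoeff (mconst c :: ('n, 'k) mfps) x * mcoeff f y)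
      = (\<Sum>(x, y)\<in>{(0 :: 'n \<Rightarrow>\<^sub>0 nat, a)}. mcoeff (mconst c) x * mcoeff f y)"
    by (rule sum.mono_neutral_right[OF finite_splits])
      (auto simp: splits_def mcoeff_mconst split: if_splits)
  then show ?thesis by (simp add: mcoeff_times mcoeff_mconst)
qed

lemma mconst_0 [simp]: "mconst 0 = 0" and mconst_1 [simp]: "mconst 1 = 1"
  and mconst_add: "mconst (c + d) = mconst c + mconst d"
  and mconst_mult: "mconst (c * d) = mconst c * mconst d"
  by (rule mfps_eqI; simp add: mcoeff_mconst mcoeff_1)+

lemma const_term_mult [simp]: "const_term (f * g) = const_term f * const_term g"
  and const_term_add [simp]: "const_term (f + g) = const_term f + const_term g"
  and const_term_1 [simp]: "const_term 1 = 1"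
  and const_term_0 [simp]: "const_term 0 = 0"
  and const_term_mconst [simp]: "const_term (mconst c) = c"
  by (simp_all add: const_term_def mcoeff_times mcoeff_1 mcoeff_mconst)

lemma const_term_diff [simp]: "const_term (f - g) = const_term f - const_term g"
  by (simp add: const_term_def)

lemma const_term_sum [simp]: "const_term (sum f A) = (\<Sum>x\<in>A. const_term (f x))"
  by (simp add: const_term_def)

lemma const_term_hom: "comm_ring_hom const_term"
  by unfold_locales simp_all

definition monomial_value :: "('n::finite \<Rightarrow> 'k::comm_ring_1) \<Rightarrow> ('n \<Rightarrow>\<^sub>0 nat) \<Rightarrow> 'k" where
  "monomial_value t a = (\<Prod>i\<in>UNIV. t i ^ lookup a i)"

lemma monomial_value_add: "monomial_value t (a + b) = monomial_value t a * monomial_value t b"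
  by (simp add: monomial_value_def lookup_add power_add prod.distrib)

lemma monomial_value_0 [simp]: "monomial_value t 0 = 1"
  by (simp add: monomial_value_def)

lemma mcoeff_subst_diag: "mcoeff (subst_diag t f) a = monomial_value t a * mcoeff f a"
  by (simp add: subst_diag.rep_eq monomial_value_def)

lemma subst_diag_mult: "subst_diag t (f * g) = subst_diag t f * subst_diag t g"
proof (rule mfps_eqI)
  fix c
  have "monomial_value t c * (mcoeff f a * mcoeff g b)
      = (monomial_value t a * mcoeff f a) * (monomial_value t b * mcoeff g b)"
    if "(a, b) \<in> splits c" for a b
    using that by (auto simp: splits_def monomial_value_add algebra_simps)
  then show "mcoeff (subst_diag t (f * g)) c = mcoeff (subst_diag t f * subst_diag t g) c"
    by (auto simp: mcoeff_subst_diag mcoeff_times sum_distrib_left intro!: sum.cong)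
qed

lemma subst_diag_add: "subst_diag t (f + g) = subst_diag t f + subst_diag t g"
  by (rule mfps_eqI) (simp add: mcoeff_subst_diag algebra_simps)

lemma subst_diag_mconst [simp]: "subst_diag t (mconst c) = mconst c"
  by (rule mfps_eqI) (simp add: mcoeff_subst_diag mcoeff_mconst)

lemma subst_diag_0 [simp]: "subst_diag t 0 = 0"
  by (rule mfps_eqI) (simp add: mcoeff_subst_diag)

lemma subst_diag_1 [simp]: "subst_diag t 1 = 1"
  using subst_diag_mconst[of t 1] by simp

lemma subst_diag_sum: "subst_diag t (sum f A) = (\<Sum>x\<in>A. subst_diag t (f x))"
  by (induction A rule: infinite_finite_induct) (simp_all add: subst_diag_add)

lemma subst_diag_compose: "subst_diag s (subst_diag t f) = subst_diag (\<lambda>i. s i * t i) f"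
  by (rule mfps_eqI) (simp add: mcoeff_subst_diag monomial_value_def power_mult_distrib prod.distrib algebra_simps)

lemma const_term_subst_diag [simp]: "const_term (subst_diag t f) = const_term f"
  by (simp add: const_term_def mcoeff_subst_diag)

subsection \<open>The Leibniz rule\<close>

lemma mcoeff_pderiv:
  "mcoeff (pderiv_mfps i f) a = of_nat (lookup a i + 1) * mcoeff f (a + Poly_Mapping.single i 1)"
  by (simp add: pderiv_mfps.rep_eq)

text \<open>One of the two sums in the Leibniz rule: the pairs with exponent zero at \<open>i\<close> contribute nothing, and
  the others arise from the decompositions of \<open>c\<close> by raising this exponent by one.\<close>

lemma sum_splits_weighted:
  fixes f g :: "('n \<Rightarrow>\<^sub>0 nat) \<Rightarrow> 'k::comm_ring_1"
  shows "(\<Sum>(a, b)\<in>splits (c + Poly_Mapping.single i 1). of_nat (lookup a i) * (f a * g b))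
    = (\<Sum>(a, b)\<in>splits c. of_nat (lookup a i + 1) * f (a + Poly_Mapping.single i 1) * g b)"
proof -
  let ?e = "Poly_Mapping.single i 1 :: 'n \<Rightarrow>\<^sub>0 nat"
  let ?h = "\<lambda>(a, b). (a + ?e, b :: 'n \<Rightarrow>\<^sub>0 nat)"
  have inj: "inj_on ?h (splits c)" by (auto intro!: inj_onI)
  have sub: "?h ` splits c \<subseteq> splits (c + ?e)" by (auto simp: splits_def algebra_simps)
  have rest: "lookup a i = 0" if ab: "(a, b) \<in> splits (c + ?e) - ?h ` splits c" for a b
  proof (rule ccontr)
    assume a: "lookup a i \<noteq> 0"
    have e: "(a - ?e) + ?e = a"
      using a by (intro poly_mapping_eqI) (auto simp: lookup_add lookup_minus lookup_single when_def)
    then have "(a - ?e) + b + ?e = c + ?e" using ab by (auto simp: splits_def algebra_simps)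
    then have "(a - ?e, b) \<in> splits c" by (simp add: splits_def)
    then have "?h (a - ?e, b) \<in> ?h ` splits c" by (rule imageI)
    then show False using ab e by simp
  qed
  have "(\<Sum>(a, b)\<in>splits (c + ?e). of_nat (lookup a i) * (f a * g b))
      = (\<Sum>(a, b)\<in>?h ` splits c. of_nat (lookup a i) * (f a * g b))"
    using sub rest by (intro sum.mono_neutral_right[OF finite_splits]) fastforce+
  also have "\<dots> = (\<Sum>(a, b)\<in>splits c. of_nat (lookup a i + 1) * f (a + ?e) * g b)"
    unfolding sum.reindex[OF inj] by (simp add: case_prod_unfold lookup_add lookup_single mult.assoc)
  finally show ?thesis .
qed

lemma pderiv_mult:
  fixes f g :: "('a, 'b::comm_ring_1) mfps"
  shows "pderiv_mfps i (f * g) = pderiv_mfps i f * g + f * pderiv_mfps i g"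
proof (rule mfps_eqI)
  fix c
  let ?e = "Poly_Mapping.single i 1 :: 'a \<Rightarrow>\<^sub>0 nat"
  have swap: "(\<Sum>(a, b)\<in>splits d. F a b) = (\<Sum>(a, b)\<in>splits d. F b a)"
    for F :: "_ \<Rightarrow> _ \<Rightarrow> 'b" and d :: "'a \<Rightarrow>\<^sub>0 nat"
    by (rule sum.reindex_bij_witness[of _ prod.swap prod.swap])
      (auto simp: splits_def add.commute)
  have "mcoeff (pderiv_mfps i (f * g)) c
      = (\<Sum>(a, b)\<in>splits (c + ?e). of_nat (lookup c i + 1) * (mcoeff f a * mcoeff g b))"
    by (simp add: mcoeff_pderiv mcoeff_times sum_distrib_left case_prod_unfold)
  also have "\<dots> = (\<Sum>(a, b)\<in>splits (c + ?e). of_nat (lookup a i) * (mcoeff f a * mcoeff g b)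
      + of_nat (lookup b i) * (mcoeff g b * mcoeff f a))"
  proof (intro sum.cong refl, clarify)
    fix a b assume "(a, b) \<in> splits (c + ?e)"
    then have "lookup (a + b) i = lookup (c + ?e) i" by (simp add: splits_def)
    then have "lookup c i + 1 = lookup a i + lookup b i" by (simp add: lookup_add lookup_single)
    then show "of_nat (lookup c i + 1) * (mcoeff f a * mcoeff g b)
      = of_nat (lookup a i) * (mcoeff f a * mcoeff g b) + of_nat (lookup b i) * (mcoeff g b * mcoeff f a)"
      by (simp only: of_nat_add) (simp add: algebra_simps)
  qed
  also have "\<dots> = (\<Sum>(a, b)\<in>splits (c + ?e). of_nat (lookup a i) * (mcoeff f a * mcoeff g b))
      + (\<Sum>(a, b)\<in>splits (c + ?e). of_nat (lookup a i) * (mcoeff g a * mcoeff f b))"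
    by (subst (3) swap) (simp add: case_prod_unfold sum.distrib)
  also have "\<dots> = mcoeff (pderiv_mfps i f * g + pderiv_mfps i g * f) c"
    unfolding sum_splits_weighted mcoeff_add mcoeff_times by (simp only: mcoeff_pderiv)
  finally show "mcoeff (pderiv_mfps i (f * g)) c = mcoeff (pderiv_mfps i f * g + f * pderiv_mfps i g) c"
    by (simp only: mult.commute[of "pderiv_mfps i g"])
qed

lemma pderiv_add: "pderiv_mfps i (f + g) = pderiv_mfps i f + pderiv_mfps i g"
  by (rule mfps_eqI) (simp add: mcoeff_pderiv algebra_simps)

lemma pderiv_0 [simp]: "pderiv_mfps i 0 = 0"
  by (rule mfps_eqI) (simp add: mcoeff_pderiv)

lemma pderiv_sum: "pderiv_mfps i (sum f A) = (\<Sum>x\<in>A. pderiv_mfps i (f x))"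
  by (induction A rule: infinite_finite_induct) (simp_all add: pderiv_add)

subsection \<open>Units\<close>

definition total_degree :: "('n::finite \<Rightarrow>\<^sub>0 nat) \<Rightarrow> nat" where
  "total_degree a = (\<Sum>i\<in>UNIV. lookup a i)"

lemma total_degree_add: "total_degree (a + b) = total_degree a + total_degree b"
  by (simp add: total_degree_def lookup_add sum.distrib)

lemma total_degree_eq_0: "total_degree a = 0 \<longleftrightarrow> a = 0"
  by (auto simp: total_degree_def intro: poly_mapping_eqI)

lemma mcoeff_power_low_degree:
  fixes v :: "('n::finite, 'k::comm_ring_1) mfps"
  assumes "const_term v = 0" "total_degree a < k" shows "mcoeff (v ^ k) a = 0"
  using assms(2)
proof (induction k arbitrary: a)
  case (Suc k)
  have "mcoeff v x * mcoeff (v ^ k) y = 0" if "(x, y) \<in> splits a" for x y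
  proof (cases "x = 0")
    case True
    then show ?thesis using assms(1) by (simp add: const_term_def)
  next
    case False
    then have "total_degree y < k"
      using that Suc.prems total_degree_add[of x y] total_degree_eq_0[of x] by (simp add: splits_def)
    then show ?thesis using Suc.IH by simp
  qed
  then show ?case by (auto simp: mcoeff_times intro!: sum.neutral)
qed simp

text \<open>After normalization \<open>f = 1 - v\<close> with \<open>v\<close> in the maximal ideal. The inverse is the geometric series of
  \<open>v\<close>, in which only the powers up to the total degree of a monomial contribute to its coefficient.\<close>

lemma unit_if_const_term_nonzero:
  fixes f :: "('n::finite, 'k::field) mfps"
  assumes "const_term f \<noteq> 0" shows "\<exists>g. f * g = 1"
proof -
  define v where "v = 1 - mconst (inverse (const_term f)) * f"
  have v: "const_term v = 0" using assms by (simp add: v_def)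
  define g where "g = Abs_mfps (\<lambda>a. \<Sum>k\<le>total_degree a. mcoeff (v ^ k) a)"
  have g: "mcoeff g a = mcoeff (\<Sum>k\<le>K. v ^ k) a" if "total_degree a \<le> K" for a K
  proof -
    have "mcoeff (\<Sum>k\<le>K. v ^ k) a = (\<Sum>k\<le>total_degree a. mcoeff (v ^ k) a)"
      unfolding mcoeff_sum using that
      by (intro sum.mono_neutral_right) (auto intro: mcoeff_power_low_degree[OF v])
    then show ?thesis by (simp add: g_def Abs_mfps_inverse)
  qed
  have "(1 - v) * g = 1"
  proof (rule mfps_eqI)
    fix c :: "'n \<Rightarrow>\<^sub>0 nat"
    let ?K = "total_degree c"
    have "mcoeff ((1 - v) * g) c = mcoeff ((1 - v) * (\<Sum>k\<le>?K. v ^ k)) c"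
      unfolding mcoeff_times
    proof (intro sum.cong refl, clarify)
      fix a b assume "(a, b) \<in> splits c"
      then have "total_degree b \<le> ?K" using total_degree_add[of a b] by (auto simp: splits_def)
      then show "mcoeff (1 - v) a * mcoeff g b = mcoeff (1 - v) a * mcoeff (\<Sum>k\<le>?K. v ^ k) b"
        by (simp only: g)
    qed
    also have "(1 - v) * (\<Sum>k\<le>?K. v ^ k) = 1 - v ^ Suc ?K"
      by (metis lessThan_Suc_atMost one_diff_power_eq)
    also have "mcoeff (1 - v ^ Suc ?K) c = mcoeff 1 c"
      using mcoeff_power_low_degree[OF v, of c "Suc ?K"] by simp
    finally show "mcoeff ((1 - v) * g) c = mcoeff 1 c" .
  qed
  then have "f * (mconst (inverse (const_term f)) * g) = 1"
    by (simp add: v_def mult_ac)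
  then show ?thesis by blast
qed

subsection \<open>Powers of a variable and shifts\<close>

lift_definition var_power :: "'n \<Rightarrow> nat \<Rightarrow> ('n, 'k::comm_ring_1) mfps" is
  "\<lambda>i N a. if a = Poly_Mapping.single i N then 1 else 0" .

lift_definition shift :: "'n \<Rightarrow> nat \<Rightarrow> ('n, 'k::comm_ring_1) mfps \<Rightarrow> ('n, 'k) mfps" is
  "\<lambda>i N f a. f (a + Poly_Mapping.single i N)" .

lemma mcoeff_shift: "mcoeff (shift i N f) a = mcoeff f (a + Poly_Mapping.single i N)"
  by (simp add: shift.rep_eq)

lemma mcoeff_var_power_mult:
  fixes f :: "('a, 'k::comm_ring_1) mfps"
  shows "mcoeff (var_power i N * f) a = (if N \<le> lookup a i then mcoeff f (a - Poly_Mapping.single i N) else 0)"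
proof -
  let ?e = "Poly_Mapping.single i N :: 'a \<Rightarrow>\<^sub>0 nat"
  have "(\<Sum>(x, y)\<in>splits a. mcoeff (var_power i N) x * mcoeff f y)
      = (\<Sum>(x, y)\<in>(if N \<le> lookup a i then {(?e, a - ?e)} else {}). mcoeff (var_power i N) x * mcoeff f y)"
  proof (rule sum.mono_neutral_right[OF finite_splits])
    have "N \<le> lookup a i \<Longrightarrow> ?e + (a - ?e) = a"
      by (intro poly_mapping_eqI) (auto simp: lookup_add lookup_minus lookup_single when_def)
    then show "(if N \<le> lookup a i then {(?e, a - ?e)} else {}) \<subseteq> splits a"
      by (auto simp: splits_def)
    show "\<forall>z\<in>splits a - (if N \<le> lookup a i then {(?e, a - ?e)} else {}).
        (case z of (x, y) \<Rightarrow> mcoeff (var_power i N) x * mcoeff f y) = 0"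
    proof
      fix z assume z: "z \<in> splits a - (if N \<le> lookup a i then {(?e, a - ?e)} else {})"
      obtain x y where xy: "z = (x, y)" by (cases z)
      have "x \<noteq> ?e"
      proof
        assume x: "x = ?e"
        then have a: "a = ?e + y" using z xy by (simp add: splits_def)
        then have "N \<le> lookup a i" "y = a - ?e" by (simp_all add: lookup_add)
        then show False using z xy x by simp
      qed
      then show "(case z of (x, y) \<Rightarrow> mcoeff (var_power i N) x * mcoeff f y) = 0"
        by (simp add: xy var_power.rep_eq)
    qed
  qed
  then show ?thesis by (simp add: mcoeff_times var_power.rep_eq)
qed

lemma shift_var_power_mult [simp]: "shift i N (var_power i N * f) = f"
  by (rule mfps_eqI) (simp add: mcoeff_shift mcoeff_var_power_mult lookup_add)

lemma const_term_var_power: "const_term (var_power i k) = (if k = 0 then 1 else 0)"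
proof -
  have "k = 0" if "0 = Poly_Mapping.single i k"
    using arg_cong[OF that, of "\<lambda>a. Poly_Mapping.lookup a i"] by simp
  then show ?thesis by (auto simp: const_term_def var_power.rep_eq)
qed

lemma var_power_add:
  "(var_power i (M + N) :: ('a, 'b::comm_ring_1) mfps) = var_power i M * var_power i N"
proof (rule mfps_eqI)
  fix a :: "'a \<Rightarrow>\<^sub>0 nat"
  have "a = Poly_Mapping.single i (M + N) \<longleftrightarrow> M \<le> lookup a i \<and> a - Poly_Mapping.single i M = Poly_Mapping.single i N"
  proof
    assume M: "M \<le> lookup a i \<and> a - Poly_Mapping.single i M = Poly_Mapping.single i N"
    have "Poly_Mapping.single i M + (a - Poly_Mapping.single i M) = a" using conjunct1[OF M]
      by (intro poly_mapping_eqI) (auto simp: lookup_add lookup_minus lookup_single when_def)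
    then show "a = Poly_Mapping.single i (M + N)" using M by (simp add: single_add)
  next
    assume a: "a = Poly_Mapping.single i (M + N)"
    have "a = Poly_Mapping.single i M + Poly_Mapping.single i N" by (simp only: a single_add)
    then have "a - Poly_Mapping.single i M = Poly_Mapping.single i N" by simp
    moreover have "M \<le> lookup a i" by (simp add: a)
    ultimately show "M \<le> lookup a i \<and> a - Poly_Mapping.single i M = Poly_Mapping.single i N" by blast
  qed
  then show "mcoeff (var_power i (M + N) :: ('a, 'b) mfps) a = mcoeff (var_power i M * var_power i N) a"
    by (auto simp: mcoeff_var_power_mult var_power.rep_eq)
qed

subsection \<open>Nilpotence of the variables modulo an ideal of finite codimension\<close>

lemma mfps_quotient_space: "quotient_space (\<lambda>c (f :: ('n, 'k::field) mfps). mconst c * f)"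
  by unfold_locales (simp_all add: algebra_simps mconst_add mconst_mult)

text \<open>The powers of \<open>x\<^sub>i\<close> are linearly dependent modulo \<open>J\<close>. A nontrivial relation is of the form
  \<open>x\<^sub>i\<^sup>m h \<in> J\<close> with \<open>h\<close> a unit, where \<open>m\<close> is the least exponent that occurs.\<close>

lemma var_power_in_finite_codim_ideal:
  fixes J :: "('n::finite, 'k::field) mfps set"
  assumes J: "0 \<in> J" "\<And>f g. f \<in> J \<Longrightarrow> g \<in> J \<Longrightarrow> f + g \<in> J" "\<And>f g. f \<in> J \<Longrightarrow> g * f \<in> J"
    and fin: "finite_dim_quotient J"
  shows "\<exists>N. var_power i N \<in> J"
proof -
  interpret Q: quotient_space "\<lambda>c (f :: ('n, 'k) mfps). mconst c * f" by (rule mfps_quotient_space)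
  have "Q.subspace J" unfolding Q.subspace_def using J by auto
  then obtain g where g: "Q.lin g" "\<And>z. g z = 0 \<longleftrightarrow> z \<in> J" using Q.exists_linear_with_kernel by blast
  obtain B where B: "finite B" "\<And>f. \<exists>c. f - (\<Sum>b\<in>B. mconst (c b) * b) \<in> J"
    using fin unfolding finite_dim_quotient_def by blast
  have gB: "g f \<in> Q.span (g ` B)" for f
  proof -
    obtain c where "f - (\<Sum>b\<in>B. mconst (c b) * b) \<in> J" using B(2) by blast
    then have "g f = g (\<Sum>b\<in>B. mconst (c b) * b)" using g(2) Q.lin_diff[OF g(1)] by (metis eq_iff_diff_eq_0)
    also have "\<dots> = (\<Sum>b\<in>B. mconst (c b) * g b)"
      by (simp add: module_hom.sum[OF Q.lin_hom[OF g(1)]] Q.lin_scale[OF g(1)])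
    also have "\<dots> \<in> Q.span (g ` B)" by (intro Q.span_sum Q.span_scale Q.span_base) auto
    finally show ?thesis .
  qed
  define n where "n = card (g ` B)"
  have "\<exists>u. (\<exists>l\<le>n. u l \<noteq> 0) \<and> (\<Sum>l\<le>n. mconst (u l) * var_power i l) \<in> J"
  proof (cases "inj_on (\<lambda>l. g (var_power i l)) {..n}")
    case False
    then obtain k l where kl: "k \<le> n" "l \<le> n" "k \<noteq> l" "g (var_power i k) = g (var_power i l)"
      unfolding inj_on_def by auto
    define u :: "nat \<Rightarrow> 'k" where "u = (\<lambda>x. if x = k then 1 else if x = l then - 1 else 0)"
    have m1: "mconst (- 1) = (- 1 :: ('n, 'k) mfps)" by (rule mfps_eqI) (simp add: mcoeff_mconst mcoeff_1)
    have "(\<Sum>x\<le>n. mconst (u x) * var_power i x) = (\<Sum>x\<in>{k, l}. mconst (u x) * var_power i x)"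
      using kl by (intro sum.mono_neutral_right) (auto simp: u_def)
    also have "\<dots> = var_power i k - var_power i l" using kl by (simp add: u_def m1)
    also have "\<dots> \<in> J" using kl g(2) by (metis Q.lin_diff[OF g(1)] eq_iff_diff_eq_0)
    finally show ?thesis using kl(1) by (intro exI[of _ u]) (auto simp: u_def)
  next
    case True
    let ?S = "(\<lambda>l. g (var_power i l)) ` {..n}"
    have "card ?S = Suc n" using card_image[OF True] by simp
    moreover have "card ?S \<le> n" if "\<not> Q.dependent ?S"
      using Q.independent_span_bound[OF _ that, of "g ` B"] B(1) gB by (auto simp: n_def)
    ultimately have "Q.dependent ?S" by fastforce
    then obtain u where u: "\<exists>v\<in>?S. u v \<noteq> 0" "(\<Sum>v\<in>?S. mconst (u v) * v) = 0"
      using Q.dependent_finite[of ?S] by auto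
    have "g (\<Sum>l\<le>n. mconst (u (g (var_power i l))) * var_power i l) = 0"
      using u(2) sum.reindex[OF True, of "\<lambda>v. mconst (u v) * v"]
      by (simp add: module_hom.sum[OF Q.lin_hom[OF g(1)]] Q.lin_scale[OF g(1)])
    then show ?thesis using u(1) g(2) by (intro exI[of _ "\<lambda>l. u (g (var_power i l))"]) auto
  qed
  then obtain u where u: "\<exists>l. l \<le> n \<and> u l \<noteq> 0" "(\<Sum>l\<le>n. mconst (u l) * var_power i l) \<in> J" by blast
  define m where "m = (LEAST l. l \<le> n \<and> u l \<noteq> 0)"
  have m: "m \<le> n" "u m \<noteq> 0" using LeastI_ex[OF u(1)] by (auto simp: m_def)
  have below: "u l = 0" if "l < m" for l using not_less_Least[of l] that m(1) unfolding m_def by fastforce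
  let ?h = "\<Sum>l=m..n. mconst (u l) * var_power i (l - m)"
  have "(\<Sum>l\<le>n. mconst (u l) * var_power i l) = (\<Sum>l=m..n. mconst (u l) * var_power i l)"
    using below by (intro sum.mono_neutral_right) auto
  also have "\<dots> = var_power i m * ?h"
    unfolding sum_distrib_left
  proof (intro sum.cong refl)
    fix l assume "l \<in> {m..n}"
    then have "var_power i l = var_power i m * (var_power i (l - m) :: ('n, 'k) mfps)"
      using var_power_add[of i m "l - m"] by simp
    then show "mconst (u l) * var_power i l = var_power i m * (mconst (u l) * var_power i (l - m))" by simp
  qed
  finally have mem: "var_power i m * ?h \<in> J" using u(2) by simp
  have "const_term ?h = (\<Sum>l=m..n. if l = m then u m else 0)"
    unfolding const_term_sum
    by (intro sum.cong refl) (auto simp: const_term_var_power)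
  also have "\<dots> \<noteq> 0" using m by simp
  finally obtain h' where h': "?h * h' = 1" using unit_if_const_term_nonzero by blast
  have "h' * (var_power i m * ?h) = var_power i m * (?h * h')" by (simp only: mult_ac)
  then have "var_power i m \<in> J" using J(3)[OF mem, of h'] unfolding h' by simp
  then show ?thesis by blast
qed

section \<open>Coordinate subspaces of a free module\<close>

definition vscale :: "'k::field \<Rightarrow> ('b \<Rightarrow> ('n, 'k) mfps) \<Rightarrow> ('b \<Rightarrow> ('n, 'k) mfps)" where
  "vscale c f = (\<lambda>b. mconst c * f b)"

interpretation free: quotient_space "vscale :: 'k::field \<Rightarrow> ('b \<Rightarrow> ('n, 'k) mfps) \<Rightarrow> _"
  by unfold_locales (simp_all add: vscale_def fun_eq_iff algebra_simps mconst_add mconst_mult)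

text \<open>Elements of the free module are functions from the basis to power series. A pair \<open>(b, a)\<close> stands for
  the monomial \<open>x\<^sup>a\<close> at the basis element \<open>b\<close>.\<close>

definition coord :: "('b \<times> ('n \<Rightarrow>\<^sub>0 nat)) set \<Rightarrow> ('b \<Rightarrow> ('n, 'k::field) mfps) set" where
  "coord S = {f. \<forall>b a. mcoeff (f b) a \<noteq> 0 \<longrightarrow> (b, a) \<in> S}"

definition proj :: "('b \<times> ('n \<Rightarrow>\<^sub>0 nat)) set \<Rightarrow> ('b \<Rightarrow> ('n, 'k::field) mfps) \<Rightarrow> ('b \<Rightarrow> ('n, 'k) mfps)" where
  "proj S f = (\<lambda>b. Abs_mfps (\<lambda>a. if (b, a) \<in> S then mcoeff (f b) a else 0))"

lemma mcoeff_proj [simp]: "mcoeff (proj S f b) a = (if (b, a) \<in> S then mcoeff (f b) a else 0)"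
  by (simp add: proj_def Abs_mfps_inverse)

lemma vec_eqI: "(\<And>b a. mcoeff (f b) a = mcoeff (g b) a) \<Longrightarrow> f = g"
  by (auto intro!: mfps_eqI)

lemma coordI: "(\<And>b a. mcoeff (f b) a \<noteq> 0 \<Longrightarrow> (b, a) \<in> S) \<Longrightarrow> f \<in> coord S"
  and coordD: "f \<in> coord S \<Longrightarrow> (b, a) \<notin> S \<Longrightarrow> mcoeff (f b) a = 0"
  by (auto simp: coord_def)

lemma linear_proj: "free.lin (proj S)"
  unfolding Vector_Spaces.linear_iff using free.vector_space_axioms
  by (auto intro!: vec_eqI simp: vscale_def)

lemma subspace_coord: "free.subspace (coord S)"
  unfolding free.subspace_def coord_def vscale_def by (auto, metis add.right_neutral)

lemma proj_in_coord: "proj S f \<in> coord S"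
  by (rule coordI) (auto split: if_splits)

lemma proj_coord: "f \<in> coord S \<Longrightarrow> proj S f = f"
  by (rule vec_eqI) (auto dest: coordD)

lemma proj_coord_stable: "f \<in> coord T \<Longrightarrow> proj S f \<in> coord T"
  by (rule coordI) (auto simp: coord_def split: if_splits)

lemma proj_coord_disjoint: "f \<in> coord T \<Longrightarrow> S \<inter> T = {} \<Longrightarrow> proj S f = 0"
  by (rule vec_eqI) (auto dest: coordD)

lemma mcoeff_sum_fun: "mcoeff (sum F A b) a = (\<Sum>x\<in>A. mcoeff (F x b) a)"
  by (induction A rule: infinite_finite_induct) simp_all

lemma quot_dim_coord:
  fixes S T :: "('b \<times> ('n \<Rightarrow>\<^sub>0 nat)) set"
  assumes "finite (S - T)"
  shows "free.quot_dim (coord S :: ('b \<Rightarrow> ('n, 'k::field) mfps) set) (coord S \<inter> coord T) (card (S - T))"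
proof -
  define unit :: "'b \<times> ('n \<Rightarrow>\<^sub>0 nat) \<Rightarrow> 'b \<Rightarrow> ('n, 'k) mfps"
    where "unit = (\<lambda>x b. Abs_mfps (\<lambda>a. if (b, a) = x then 1 else 0))"
  have unit: "mcoeff (unit x b) a = (if (b, a) = x then 1 else 0)" for x b a
    by (simp add: unit_def Abs_mfps_inverse)
  have inj: "inj_on unit X" for X
  proof (rule inj_onI)
    fix x y assume "unit x = unit y"
    then have "mcoeff (unit x (fst x)) (snd x) = mcoeff (unit y (fst x)) (snd x)" by simp
    then show "x = y" by (simp add: unit split: if_splits)
  qed
  have coeff: "mcoeff ((\<Sum>x\<in>S - T. vscale (w x) (unit x)) b) a = (if (b, a) \<in> S - T then w (b, a) else 0)"
    for w :: "_ \<Rightarrow> 'k" and b a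
    using sum.delta'[OF assms, of "(b, a)" w]
    by (simp add: mcoeff_sum_fun vscale_def unit if_distrib[of "\<lambda>z. _ * z"] cong: if_cong)
  let ?C = "unit ` (S - T)"
  have 1: "\<not> free.dependent ?C"
  proof (rule free.independent_if_scalars_zero)
    show "finite ?C" using assms by simp
    fix u v assume u: "(\<Sum>x\<in>?C. vscale (u x) x) = 0" and v: "v \<in> ?C"
    obtain x where x: "x \<in> S - T" "v = unit x" using v by auto
    have "(\<Sum>x\<in>S - T. vscale (u (unit x)) (unit x)) = 0"
      using u unfolding sum.reindex[OF inj] by (simp add: o_def)
    then have "mcoeff ((\<Sum>x\<in>S - T. vscale (u (unit x)) (unit x)) (fst x)) (snd x) = 0" by simp
    then show "u v = 0" using x by (simp only: coeff) simp
  qed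
  have 2: "free.span ?C = coord (S - T)"
  proof (rule free.span_subspace)
    show "?C \<subseteq> coord (S - T)" by (auto simp: coord_def unit split: if_splits)
    show "coord (S - T) \<subseteq> free.span ?C"
    proof
      fix f :: "'b \<Rightarrow> ('n, 'k) mfps" assume f: "f \<in> coord (S - T)"
      have "f = (\<Sum>x\<in>S - T. vscale (mcoeff (f (fst x)) (snd x)) (unit x))"
        by (rule vec_eqI) (use coordD[OF f] in \<open>auto simp: coeff\<close>)
      also have "\<dots> \<in> free.span ?C"
        by (intro free.span_sum free.span_scale free.span_base) auto
      finally show "f \<in> free.span ?C" .
    qed
  qed (rule subspace_coord)
  have 3: "proj (- T) ` coord S = (coord (S - T) :: ('b \<Rightarrow> ('n, 'k) mfps) set)"
  proof (intro equalityI subsetI)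
    fix f :: "'b \<Rightarrow> ('n, 'k) mfps" assume "f \<in> proj (- T) ` coord S"
    then show "f \<in> coord (S - T)" by (auto simp: coord_def split: if_splits)
  next
    fix f :: "'b \<Rightarrow> ('n, 'k) mfps" assume f: "f \<in> coord (S - T)"
    then have "f \<in> coord S" "f \<in> coord (- T)" by (auto simp: coord_def)
    then show "f \<in> proj (- T) ` coord S" by (metis proj_coord imageI)
  qed
  have 4: "proj (- T) z = 0 \<longleftrightarrow> z \<in> coord T" for z :: "'b \<Rightarrow> ('n, 'k) mfps"
  proof
    assume z: "proj (- T) z = 0"
    show "z \<in> coord T"
    proof (rule coordI)
      fix b a assume "mcoeff (z b) a \<noteq> 0"
      moreover have "mcoeff (proj (- T) z b) a = 0" by (simp add: z del: mcoeff_proj)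
      ultimately show "(b, a) \<in> T" by (auto split: if_splits)
    qed
  qed (auto intro!: proj_coord_disjoint)
  show ?thesis
    unfolding free.quot_dim_def
    using assms 1 2 3 4 linear_proj card_image[OF inj, of "S - T"]
    by (intro exI[of _ "proj (- T)"] exI[of _ ?C]) auto
qed


section \<open>Weighted two-periodic complexes\<close>

definition is_ideal :: "('n, 'k::comm_ring_1) mfps set \<Rightarrow> bool" where
  "is_ideal K \<longleftrightarrow> 0 \<in> K \<and> (\<forall>f\<in>K. \<forall>g\<in>K. f + g \<in> K) \<and> (\<forall>f\<in>K. \<forall>g. g * f \<in> K)"

lemma is_idealD:
  assumes "is_ideal K"
  shows "0 \<in> K" "f \<in> K \<Longrightarrow> g \<in> K \<Longrightarrow> f + g \<in> K" "f \<in> K \<Longrightarrow> g * f \<in> K" "f \<in> K \<Longrightarrow> f * g \<in> K"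
  using assms by (auto simp: is_ideal_def mult.commute)

lemma is_ideal_sum: "is_ideal K \<Longrightarrow> (\<And>x. x \<in> A \<Longrightarrow> F x \<in> K) \<Longrightarrow> sum F A \<in> K"
  by (induction A rule: infinite_finite_induct) (auto simp: is_ideal_def)

lemma mod_add_cancel: "(x + z) mod p = (y + z) mod p \<longleftrightarrow> x mod p = y mod p" for x y z p :: nat
proof -
  have "x + z + p * q = y + z + p * q' \<longleftrightarrow> x + p * q = y + p * q'" for q q' by linarith
  then show ?thesis by (simp only: nat_mod_eq_iff)
qed

definition weight :: "('n::finite \<Rightarrow> nat) \<Rightarrow> ('n \<Rightarrow>\<^sub>0 nat) \<Rightarrow> nat" where
  "weight c a = (\<Sum>i\<in>UNIV. c i * lookup a i)"

lemma weight_add: "weight c (a + b) = weight c a + weight c b"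
  by (simp add: weight_def lookup_add algebra_simps sum.distrib)

lemma weight_single [simp]: "weight c (Poly_Mapping.single i N) = c i * N"
proof -
  have "weight c (Poly_Mapping.single i N) = (\<Sum>l\<in>{i}. c l * lookup (Poly_Mapping.single i N) l)"
    unfolding weight_def by (rule sum.mono_neutral_right) (auto simp: lookup_single)
  then show ?thesis by simp
qed

text \<open>The monomials in the ideal generated by \<open>x\<^sub>i\<^sup>N\<close> for \<open>i \<in> L\<close>.\<close>

definition high :: "nat \<Rightarrow> 'n set \<Rightarrow> ('b \<times> ('n \<Rightarrow>\<^sub>0 nat)) set" where
  "high N L = {(b, a). \<exists>i\<in>L. N \<le> lookup a i}"

definition high_ideal :: "nat \<Rightarrow> 'n set \<Rightarrow> ('n, 'k::comm_ring_1) mfps set" where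
  "high_ideal N L = {r. \<forall>a. mcoeff r a \<noteq> 0 \<longrightarrow> (\<exists>i\<in>L. N \<le> lookup a i)}"

lemma coord_high: "f \<in> coord (high N L) \<longleftrightarrow> (\<forall>b. f b \<in> high_ideal N L)"
  by (auto simp: coord_def high_def high_ideal_def)

lemma high_ideal: "is_ideal (high_ideal N L :: ('n, 'k::comm_ring_1) mfps set)"
  unfolding is_ideal_def
proof (intro conjI ballI allI)
  fix f g :: "('n, 'k) mfps" assume fg: "f \<in> high_ideal N L" "g \<in> high_ideal N L"
  show "f + g \<in> high_ideal N L"
    unfolding high_ideal_def
  proof (rule CollectI, intro allI impI)
    fix a assume "mcoeff (f + g) a \<noteq> 0"
    then have "mcoeff f a \<noteq> 0 \<or> mcoeff g a \<noteq> 0" by auto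
    then show "\<exists>i\<in>L. N \<le> lookup a i" using fg by (auto simp: high_ideal_def)
  qed
next
  fix f g :: "('n, 'k) mfps" assume f: "f \<in> high_ideal N L"
  show "g * f \<in> high_ideal N L"
    unfolding high_ideal_def
  proof (rule CollectI, intro allI impI)
    fix a assume "mcoeff (g * f) a \<noteq> 0"
    then obtain z where z: "z \<in> splits a" "(case z of (x, y) \<Rightarrow> mcoeff g x * mcoeff f y) \<noteq> 0"
      unfolding mcoeff_times by (rule sum.not_neutral_contains_not_neutral)
    obtain x y where xy: "z = (x, y)" by (cases z)
    have "mcoeff f y \<noteq> 0" using z xy by auto
    then obtain i where i: "i \<in> L" "N \<le> lookup y i" using f by (auto simp: high_ideal_def)
    have "x + y = a" using z xy by (simp add: splits_def)
    then have "lookup y i \<le> lookup a i" by (metis lookup_add le_add2)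
    then show "\<exists>i\<in>L. N \<le> lookup a i" using i le_trans by blast
  qed
qed (simp add: high_ideal_def)

text \<open>A two-periodic complex structure \<open>d\<close> on the free module with basis \<open>B\<close>. The parity of a basis element
  \<open>b\<close> is \<open>par b\<close>, the monomial \<open>x\<^sup>a\<close> at \<open>b\<close> has weight \<open>weight c a + wb b\<close> modulo \<open>p\<close>, and \<open>d\<close>
  is homogeneous of weight zero. Linearity over power series enters through \<open>d_mult\<close> and in the
  form that submodules \<open>K M\<close> are preserved. The homotopies \<open>h i\<close> for \<open>x\<^sub>i\<^sup>N\<close> are not assumed to be
  homogeneous.\<close>

locale weighted_complex =
  fixes B :: "'b set" and par :: "'b \<Rightarrow> bool" and wb :: "'b \<Rightarrow> nat" and c :: "'n::finite \<Rightarrow> nat"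
    and p N :: nat
    and d :: "('b \<Rightarrow> ('n, 'k::field) mfps) \<Rightarrow> ('b \<Rightarrow> ('n, 'k) mfps)"
    and h :: "'n \<Rightarrow> ('b \<Rightarrow> ('n, 'k) mfps) \<Rightarrow> ('b \<Rightarrow> ('n, 'k) mfps)"
  assumes finB: "finite B" and p_pos: "p > 0"
    and d_add: "\<And>f g. d (f + g) = d f + d g"
    and d_mult: "\<And>r f. d (\<lambda>b. r * f b) = (\<lambda>b. r * d f b)"
    and d_ideal: "\<And>K f b. is_ideal K \<Longrightarrow> (\<And>b. f b \<in> K) \<Longrightarrow> d f b \<in> K"
    and dd: "\<And>f. d (d f) = 0"
    and d_graded: "\<And>f \<epsilon> j. f \<in> coord {(b, a). b \<in> B \<and> par b = \<epsilon> \<and> (weight c a + wb b) mod p = j mod p}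
      \<Longrightarrow> d f \<in> coord {(b, a). b \<in> B \<and> par b = (\<not> \<epsilon>) \<and> (weight c a + wb b) mod p = j mod p}"
    and h_ideal: "\<And>K f i b. is_ideal K \<Longrightarrow> (\<And>b. f b \<in> K) \<Longrightarrow> h i f b \<in> K"
    and h_supp: "\<And>f i. h i f \<in> coord (B \<times> UNIV)"
    and homotopy: "\<And>f i. f \<in> coord (B \<times> UNIV) \<Longrightarrow> d (h i f) + h i (d f) = (\<lambda>b. var_power i N * f b)"
begin

definition grade :: "bool \<Rightarrow> nat \<Rightarrow> ('b \<times> ('n \<Rightarrow>\<^sub>0 nat)) set" where
  "grade \<epsilon> j = {(b, a). b \<in> B \<and> par b = \<epsilon> \<and> (weight c a + wb b) mod p = j mod p}"

lemma d_grade: "f \<in> coord (grade \<epsilon> j) \<Longrightarrow> d f \<in> coord (grade (\<not> \<epsilon>) j)"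
  using d_graded by (simp add: grade_def)

lemma d_0: "d 0 = 0"
  using d_mult[of 0 0] by (simp add: fun_eq_iff zero_fun_def)

lemma d_sum: "d (sum F A) = (\<Sum>x\<in>A. d (F x))"
  by (induction A rule: infinite_finite_induct) (simp_all only: sum.infinite sum.empty sum.insert d_add d_0 not_False_eq_True)

lemma linear_d: "free.lin d"
  unfolding Vector_Spaces.linear_iff using free.vector_space_axioms d_add d_mult by (auto simp: vscale_def)

text \<open>A differential of weight zero commutes with the projection to a homogeneous component, as one sees by
  decomposing \<open>v\<close> into its components.\<close>

lemma proj_d:
  assumes v: "v \<in> coord (B \<times> UNIV)"
  shows "proj (grade (\<not> \<epsilon>) j) (d v) = d (proj (grade \<epsilon> j) v)"
proof -
  let ?I = "(UNIV :: bool set) \<times> {..<p}"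
  let ?x = "(\<epsilon>, j mod p)"
  have dec: "v = (\<Sum>(e, k)\<in>?I. proj (grade e k) v)"
  proof (rule vec_eqI)
    fix b a
    have "mcoeff ((\<Sum>(e, k)\<in>?I. proj (grade e k) v) b) a
        = (\<Sum>z\<in>?I. if z = (par b, (weight c a + wb b) mod p) then mcoeff (v b) a else 0)"
      unfolding mcoeff_sum_fun using coordD[OF v, of b a]
      by (intro sum.cong refl) (auto simp: grade_def split: prod.split)
    then show "mcoeff (v b) a = mcoeff ((\<Sum>(e, k)\<in>?I. proj (grade e k) v) b) a"
      using p_pos by simp
  qed
  have disj: "proj (grade (\<not> \<epsilon>) j) (d (proj (grade e k) v)) = 0" if "(e, k) \<in> ?I - {?x}" for e k
    by (rule proj_coord_disjoint[OF d_grade[OF proj_in_coord]]) (use that in \<open>auto simp: grade_def\<close>)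
  have "proj (grade (\<not> \<epsilon>) j) (d v) = (\<Sum>(e, k)\<in>?I. proj (grade (\<not> \<epsilon>) j) (d (proj (grade e k) v)))"
    by (subst dec) (simp add: d_sum module_hom.sum[OF free.lin_hom[OF linear_proj]] case_prod_unfold)
  also have "\<dots> = (\<Sum>(e, k)\<in>{?x}. proj (grade (\<not> \<epsilon>) j) (d (proj (grade e k) v)))"
    by (rule sum.mono_neutral_right) (use p_pos disj in auto)
  also have "\<dots> = proj (grade (\<not> \<epsilon>) j) (d (proj (grade \<epsilon> j) v))" by (simp add: grade_def)
  also have "\<dots> = d (proj (grade \<epsilon> j) v)" by (intro proj_coord d_grade proj_in_coord)
  finally show ?thesis .
qed

abbreviation "M \<epsilon> j \<equiv> (coord (grade \<epsilon> j) :: ('b \<Rightarrow> ('n, 'k) mfps) set)"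
abbreviation "Q L \<equiv> (coord (high N L) :: ('b \<Rightarrow> ('n, 'k) mfps) set)"
abbreviation "mult_var i f \<equiv> (\<lambda>b. var_power i N * f b)"
abbreviation "shift_var i f \<equiv> (\<lambda>b. shift i N (f b))"

lemma M_supp: "f \<in> M \<epsilon> j \<Longrightarrow> f \<in> coord (B \<times> UNIV)"
  by (auto simp: coord_def grade_def)

lemma mult_var_graded:
  assumes f: "f \<in> M \<epsilon> j" shows "mult_var i f \<in> M \<epsilon> (j + c i * N)"
proof (rule coordI)
  fix b a assume "mcoeff (mult_var i f b) a \<noteq> 0"
  then have a: "N \<le> lookup a i" "mcoeff (f b) (a - Poly_Mapping.single i N) \<noteq> 0"
    by (auto simp: mcoeff_var_power_mult split: if_splits)
  define a' where "a' = a - Poly_Mapping.single i N"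
  have "a = a' + Poly_Mapping.single i N"
    unfolding a'_def using a(1) by (intro poly_mapping_eqI) (auto simp: lookup_add lookup_minus lookup_single when_def)
  then have "weight c a = weight c a' + c i * N" by (simp add: weight_add)
  moreover have "b \<in> B" "par b = \<epsilon>" "(weight c a' + wb b) mod p = j mod p"
    using a(2) f by (auto simp: coord_def grade_def a'_def)
  ultimately show "(b, a) \<in> grade \<epsilon> (j + c i * N)"
    using mod_add_cancel[of "weight c a' + wb b" "c i * N" p j] by (simp add: grade_def add_ac)
qed

lemma shift_var_graded:
  assumes f: "f \<in> M \<epsilon> (j + c i * N)" shows "shift_var i f \<in> M \<epsilon> j"
proof (rule coordI)
  fix b a assume "mcoeff (shift_var i f b) a \<noteq> 0"
  then have "(b, a + Poly_Mapping.single i N) \<in> grade \<epsilon> (j + c i * N)"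
    using f by (auto simp: mcoeff_shift coord_def)
  then have "b \<in> B" "par b = \<epsilon>" and m: "((weight c a + wb b) + c i * N) mod p = (j + c i * N) mod p"
    by (auto simp: grade_def weight_add algebra_simps)
  moreover have "(weight c a + wb b) mod p = j mod p"
    using m mod_add_cancel by blast
  ultimately show "(b, a) \<in> grade \<epsilon> j" by (simp add: grade_def)
qed

text \<open>The homogeneous component of \<open>h i z\<close> in the right degree is a primitive of \<open>x\<^sub>i\<^sup>N z\<close> modulo \<open>Q L\<close>.\<close>

lemma null_homotopic:
  assumes z: "z \<in> M \<epsilon> j" "d z \<in> Q L"
  shows "\<exists>u\<in>M (\<not> \<epsilon>) (j + c i * N). mult_var i z - d u \<in> Q L"
proof (rule bexI)
  let ?j = "j + c i * N"
  let ?u = "proj (grade (\<not> \<epsilon>) ?j) (h i z)"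
  show "?u \<in> M (\<not> \<epsilon>) ?j" by (rule proj_in_coord)
  have "mult_var i z = proj (grade \<epsilon> ?j) (mult_var i z)"
    using proj_coord[OF mult_var_graded[OF z(1)]] by simp
  also have "\<dots> = proj (grade \<epsilon> ?j) (d (h i z)) + proj (grade \<epsilon> ?j) (h i (d z))"
    unfolding homotopy[OF M_supp[OF z(1)], symmetric] by (rule free.lin_add[OF linear_proj])
  also have "proj (grade \<epsilon> ?j) (d (h i z)) = d ?u"
    using proj_d[OF h_supp, of "\<not> \<epsilon>" ?j i z] by simp
  finally have "mult_var i z - d ?u = proj (grade \<epsilon> ?j) (h i (d z))" by (simp only: add_diff_cancel_left')
  also have "\<dots> \<in> Q L"
    using z(2) h_ideal[OF high_ideal] by (intro proj_coord_stable) (simp add: coord_high)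
  finally show "mult_var i z - d ?u \<in> Q L" .
qed

abbreviation "Z L \<epsilon> j \<equiv> free.cocycles d (Q L) (M \<epsilon> j)"
abbreviation "Bd L \<epsilon> j \<equiv> free.coboundaries d (Q L) (M \<epsilon> j) (M (\<not> \<epsilon>) j)"

text \<open>In passing from \<open>L\<close> to \<open>insert i L\<close> the complex is divided by \<open>x\<^sub>i\<^sup>N\<close>, which has weight \<open>c i * N\<close>, is
  injective with the shift of exponents as left inverse, and is null-homotopic.\<close>

lemma cohomology_step:
  assumes "i \<notin> L" "free.quot_dim (Z (insert i L) \<epsilon> (j + c i * N)) (Bd (insert i L) \<epsilon> (j + c i * N)) D"
  shows "\<exists>a b. free.quot_dim (Z L \<epsilon> (j + c i * N)) (Bd L \<epsilon> (j + c i * N)) a \<and>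
           free.quot_dim (Z L (\<not> \<epsilon>) j) (Bd L (\<not> \<epsilon>) j) b \<and> D = a + b"
proof -
  let ?j = "j + c i * N"
  have "\<exists>a b. free.quot_dim (Z L \<epsilon> ?j) (Bd L \<epsilon> ?j) a \<and>
      free.quot_dim (Z L (\<not> \<epsilon>) j) (free.coboundaries d (Q L) (M (\<not> \<epsilon>) j) (M \<epsilon> j)) b \<and> D = a + b"
  proof (rule free.cohomology_modulo_null_homotopic[OF linear_d, where y = "mult_var i" and s = "shift_var i"
        and Q' = "Q (insert i L)"])
    show "free.lin (mult_var i)" "free.lin (shift_var i)"
      unfolding Vector_Spaces.linear_iff using free.vector_space_axioms
      by (auto simp: vscale_def mcoeff_shift distrib_left mult.left_commute intro!: vec_eqI)
    show "d (d v) = 0" "d (mult_var i v) = mult_var i (d v)" "shift_var i (mult_var i v) = v" for v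
      by (simp_all add: dd d_mult)
    show "v \<in> M \<epsilon> ?j \<Longrightarrow> d v \<in> M (\<not> \<epsilon>) ?j" "v \<in> M (\<not> \<epsilon>) j \<Longrightarrow> d v \<in> M \<epsilon> j"
      "v \<in> M \<epsilon> j \<Longrightarrow> d v \<in> M (\<not> \<epsilon>) j" "v \<in> M (\<not> \<epsilon>) ?j \<Longrightarrow> d v \<in> M \<epsilon> ?j" for v
      using d_grade[of v \<epsilon>] d_grade[of v "\<not> \<epsilon>"] by simp_all
    show "v \<in> M (\<not> \<epsilon>) j \<Longrightarrow> mult_var i v \<in> M (\<not> \<epsilon>) ?j" "v \<in> M \<epsilon> j \<Longrightarrow> mult_var i v \<in> M \<epsilon> ?j" for v
      by (rule mult_var_graded, assumption)+
    show "v \<in> M (\<not> \<epsilon>) ?j \<Longrightarrow> shift_var i v \<in> M (\<not> \<epsilon>) j" "v \<in> M \<epsilon> ?j \<Longrightarrow> shift_var i v \<in> M \<epsilon> j" for v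
      by (rule shift_var_graded, assumption)+
    show "d v \<in> Q L" "mult_var i v \<in> Q L" if "v \<in> Q L" for v
      using that d_ideal[OF high_ideal] by (simp_all add: coord_high is_idealD(3)[OF high_ideal])
    show "shift_var i v \<in> Q L" if v: "v \<in> Q L" for v
    proof (rule coordI)
      fix b a assume "mcoeff (shift_var i v b) a \<noteq> 0"
      then have "(b, a + Poly_Mapping.single i N) \<in> high N L" using v by (auto simp: mcoeff_shift coord_def)
      then show "(b, a) \<in> high N L" using assms(1) by (auto simp: high_def lookup_add lookup_single when_def split: if_splits)
    qed
    show "\<exists>u\<in>M \<epsilon> ?j. mult_var i z - d u \<in> Q L" if "z \<in> M (\<not> \<epsilon>) j" "d z \<in> Q L" for z
      using null_homotopic[OF that, of i] by simp
    show "\<exists>u\<in>M (\<not> \<epsilon>) ?j. mult_var i z - d u \<in> Q L" if "z \<in> M \<epsilon> j" "d z \<in> Q L" for z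
      using null_homotopic[OF that] .
    show "v \<in> Q (insert i L) \<longleftrightarrow> v - mult_var i (shift_var i v) \<in> Q L" for v
    proof -
      have "mcoeff ((v - mult_var i (shift_var i v)) b) a = (if N \<le> lookup a i then 0 else mcoeff (v b) a)" for b a
      proof -
        have "N \<le> lookup a i \<Longrightarrow> a - Poly_Mapping.single i N + Poly_Mapping.single i N = a"
          by (intro poly_mapping_eqI) (auto simp: lookup_add lookup_minus lookup_single when_def)
        then show ?thesis by (simp add: mcoeff_var_power_mult mcoeff_shift)
      qed
      then show ?thesis by (auto simp: coord_def high_def split: if_splits)
    qed
    show "free.quot_dim (Z (insert i L) \<epsilon> ?j) (Bd (insert i L) \<epsilon> ?j) D" by (rule assms(2))
  qed (rule subspace_coord)+
  then show ?thesis by simp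
qed

end

subsection \<open>Euler characteristics\<close>

text \<open>The exponents of the monomials in the variables from \<open>L\<close> that are not divisible by any \<open>x\<^sub>i\<^sup>N\<close>.\<close>

definition box :: "nat \<Rightarrow> 'n set \<Rightarrow> ('n::finite \<Rightarrow>\<^sub>0 nat) set" where
  "box N L = {a. \<forall>i. (i \<in> L \<longrightarrow> lookup a i < N) \<and> (i \<notin> L \<longrightarrow> lookup a i = 0)}"

lemma box_insert_bij:
  assumes "i \<notin> L"
  shows "bij_betw (\<lambda>(a, l). a + Poly_Mapping.single i l) (box N L \<times> {..<N}) (box N (insert i L))"
proof (rule bij_betw_byWitness[where f' = "\<lambda>a. (a - Poly_Mapping.single i (lookup a i), lookup a i)"])
  show "\<forall>x\<in>box N L \<times> {..<N}. (\<lambda>a. (a - Poly_Mapping.single i (lookup a i), lookup a i))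
      ((\<lambda>(a, l). a + Poly_Mapping.single i l) x) = x"
    using assms by (auto simp: box_def lookup_add)
  show "\<forall>a\<in>box N (insert i L). (\<lambda>(a, l). a + Poly_Mapping.single i l)
      (a - Poly_Mapping.single i (lookup a i), lookup a i) = a"
    by (auto intro!: poly_mapping_eqI simp: lookup_add lookup_minus lookup_single when_def)
  show "(\<lambda>(a, l). a + Poly_Mapping.single i l) ` (box N L \<times> {..<N}) \<subseteq> box N (insert i L)"
    using assms by (auto simp: box_def lookup_add lookup_single when_def)
  show "(\<lambda>a. (a - Poly_Mapping.single i (lookup a i), lookup a i)) ` box N (insert i L) \<subseteq> box N L \<times> {..<N}"
    using assms by (auto simp: box_def lookup_minus lookup_single when_def split: if_splits)
qed

lemma box_empty: "box N {} = {0}"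
  by (auto simp: box_def intro: poly_mapping_eqI)

lemma finite_box: "finite L \<Longrightarrow> finite (box N L)"
proof (induction L rule: finite_induct)
  case (insert i L)
  then have "finite (box N L \<times> {..<N})" by simp
  then show ?case using bij_betw_finite[OF box_insert_bij[OF insert(2)]] by blast
qed (simp add: box_empty)

lemma sum_box: "finite L \<Longrightarrow> (\<Sum>a\<in>box N L. (Xp :: int poly) ^ weight c a) = (\<Prod>i\<in>L. \<Sum>l<N. Xp ^ (c i * l))"
proof (induction L rule: finite_induct)
  case (insert i L)
  have "(\<Sum>a\<in>box N (insert i L). Xp ^ weight c a)
      = (\<Sum>(a, l)\<in>box N L \<times> {..<N}. Xp ^ (weight c a + c i * l))"
    using sum.reindex_bij_betw[OF box_insert_bij[OF insert(2), of N], of "\<lambda>a. Xp ^ weight c a"]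
    by (simp add: case_prod_unfold weight_add)
  also have "\<dots> = (\<Sum>a\<in>box N L. Xp ^ weight c a) * (\<Sum>l<N. Xp ^ (c i * l))"
    by (simp only: sum_product sum.cartesian_product power_add)
  finally show ?case using insert by (simp add: mult.commute)
qed (simp add: box_empty weight_def)

context weighted_complex
begin

lemma grade_minus_high: "grade \<epsilon> j - high N UNIV
    = {x \<in> {b \<in> B. par b = \<epsilon>} \<times> box N UNIV. (weight c (snd x) + wb (fst x)) mod p = j mod p}"
  by (auto simp: grade_def high_def box_def not_le) (metis not_le)+

lemma finite_grade_minus_high: "finite (grade \<epsilon> j - high N UNIV)"
  unfolding grade_minus_high using finB finite_box[of UNIV N]
  by (intro finite_subset[OF Collect_subset] finite_cartesian_product) auto

lemma top_euler:
  "\<exists>h h'. free.quot_dim (Z UNIV True j) (Bd UNIV True j) h \<and> free.quot_dim (Z UNIV False j) (Bd UNIV False j) h' \<and>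
     int h - int h' = int (card (grade True j - high N UNIV)) - int (card (grade False j - high N UNIV))"
  using free.euler_characteristic[OF linear_d subspace_coord subspace_coord subspace_coord dd _ _ _
      quot_dim_coord[OF finite_grade_minus_high[of True j]] quot_dim_coord[OF finite_grade_minus_high[of False j]]]
    d_grade[of _ True j] d_grade[of _ False j] d_ideal[OF high_ideal] by (simp add: coord_high)

text \<open>Dividing by \<open>x\<^sub>i\<^sup>N\<close> for all \<open>i\<close> leaves a complex of finite dimension, and \<open>cohomology_step\<close> shows that
  finiteness is inherited when one of these divisions is undone.\<close>

lemma finite_cohomology: "\<exists>D. free.quot_dim (Z (- K) \<epsilon> j) (Bd (- K) \<epsilon> j) D"
proof (induction K arbitrary: \<epsilon> j rule: finite_induct[OF finite])
  case 1
  show ?case using top_euler[of j] by (cases \<epsilon>) (auto simp: Compl_eq_Diff_UNIV)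
next
  case (2 i K)
  have eq: "insert i (- insert i K) = - K" using 2(2) by auto
  obtain D where D: "free.quot_dim (Z (- K) (\<not> \<epsilon>) (j + c i * N)) (Bd (- K) (\<not> \<epsilon>) (j + c i * N)) D"
    using 2(3) by blast
  have "i \<notin> - insert i K" by simp
  then obtain b where "free.quot_dim (Z (- insert i K) (\<not> \<not> \<epsilon>) j) (Bd (- insert i K) (\<not> \<not> \<epsilon>) j) b"
    using cohomology_step[of i "- insert i K" "\<not> \<epsilon>" j D] D unfolding eq by blast
  then show ?case unfolding not_not by blast
qed

definition hdim :: "'n set \<Rightarrow> bool \<Rightarrow> nat \<Rightarrow> nat" where
  "hdim L \<epsilon> j = (SOME D. free.quot_dim (Z L \<epsilon> j) (Bd L \<epsilon> j) D)"

lemma hdim: "free.quot_dim (Z L \<epsilon> j) (Bd L \<epsilon> j) (hdim L \<epsilon> j)"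
  using someI_ex[OF finite_cohomology[of "- L" \<epsilon> j]] unfolding hdim_def double_compl .

lemma hdim_eqI: "free.quot_dim (Z L \<epsilon> j) (Bd L \<epsilon> j) D \<Longrightarrow> hdim L \<epsilon> j = D"
  by (rule free.quot_dim_unique[OF hdim _ free.subspace_cocycles[OF linear_d subspace_coord subspace_coord]])

lemma hdim_insert:
  assumes "i \<notin> L"
  shows "hdim (insert i L) \<epsilon> (j + c i * N) = hdim L \<epsilon> (j + c i * N) + hdim L (\<not> \<epsilon>) j"
proof -
  obtain a b where "free.quot_dim (Z L \<epsilon> (j + c i * N)) (Bd L \<epsilon> (j + c i * N)) a"
      "free.quot_dim (Z L (\<not> \<epsilon>) j) (Bd L (\<not> \<epsilon>) j) b" "hdim (insert i L) \<epsilon> (j + c i * N) = a + b"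
    using cohomology_step[OF assms hdim] by blast
  then show ?thesis using hdim_eqI[of L] by (simp only:)
qed

lemma hdim_periodic: "hdim L \<epsilon> (j + p) = hdim L \<epsilon> j"
  by (simp add: hdim_def grade_def)

definition euler :: "'n set \<Rightarrow> nat \<Rightarrow> int" where
  "euler L j = int (hdim L True j) - int (hdim L False j)"

text \<open>The Euler characteristic in the representation ring \<open>\<int>[x]/(x\<^sup>p - 1)\<close> of the cohomology of the complex
  divided by \<open>x\<^sub>i\<^sup>N\<close> for \<open>i \<in> L\<close>.\<close>

definition euler_poly :: "'n set \<Rightarrow> int poly" where
  "euler_poly L = (\<Sum>j<p. of_int (euler L j) * Xp ^ j)"

text \<open>The second summand in \<open>cohomology_step\<close> has the opposite parity and is shifted by the weight of
  \<open>x\<^sub>i\<^sup>N\<close>; so it contributes \<open>- x\<^sup>k\<close> times the Euler characteristic, with \<open>k = c i * N\<close>.\<close>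

lemma euler_poly_insert:
  assumes "i \<notin> L"
  shows "Xp ^ p - 1 dvd euler_poly (insert i L) - euler_poly L * (1 - Xp ^ (c i * N))"
proof -
  have "Xp ^ p - 1 dvd Xp ^ (c i * N) * (\<Sum>j<p. of_int (euler L j) * Xp ^ j)
      - (\<Sum>j<p. of_int (euler L j - euler (insert i L) j) * Xp ^ j)"
  proof (rule X_power_periodic_shift)
    show "euler L (j + p) - euler (insert i L) (j + p) = euler L j - euler (insert i L) j" for j
      by (simp add: euler_def hdim_periodic)
    show "euler L (j + c i * N) - euler (insert i L) (j + c i * N) = euler L j" for j
      by (simp add: euler_def hdim_insert[OF assms])
  qed
  also have "Xp ^ (c i * N) * (\<Sum>j<p. of_int (euler L j) * Xp ^ j)
      - (\<Sum>j<p. of_int (euler L j - euler (insert i L) j) * Xp ^ j)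
      = euler_poly (insert i L) - euler_poly L * (1 - Xp ^ (c i * N))"
    unfolding euler_poly_def[symmetric] of_int_diff left_diff_distrib sum_subtractf
    by (simp add: algebra_simps)
  finally show ?thesis .
qed

lemma euler_poly_prod: "finite L \<Longrightarrow> Xp ^ p - 1 dvd euler_poly L - euler_poly {} * (\<Prod>i\<in>L. 1 - Xp ^ (c i * N))"
proof (induction L rule: finite_induct)
  case (insert i L)
  let ?u = "1 - Xp ^ (c i * N) :: int poly"
  have "Xp ^ p - 1 dvd (euler_poly (insert i L) - euler_poly L * ?u)
      + (euler_poly L - euler_poly {} * (\<Prod>i\<in>L. 1 - Xp ^ (c i * N))) * ?u"
    using insert by (intro dvd_add euler_poly_insert dvd_mult2) auto
  moreover have "(euler_poly (insert i L) - euler_poly L * ?u)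
      + (euler_poly L - euler_poly {} * (\<Prod>i\<in>L. 1 - Xp ^ (c i * N))) * ?u
      = euler_poly (insert i L) - euler_poly {} * (\<Prod>i\<in>insert i L. 1 - Xp ^ (c i * N))"
    using insert(1,2) by (simp add: algebra_simps)
  ultimately show ?case by simp
qed simp

text \<open>The Euler characteristic of a complex of finite dimension can be read off from the complex itself, here
  from its basis of monomials.\<close>

lemma euler_poly_top:
  "Xp ^ p - 1 dvd (\<Sum>b\<in>B. (if par b then 1 else - 1) * Xp ^ wb b) * (\<Prod>i\<in>UNIV. \<Sum>l<N. Xp ^ (c i * l)) - euler_poly UNIV"
proof -
  let ?S = "\<lambda>\<epsilon>. {b \<in> B. par b = \<epsilon>} \<times> box N (UNIV :: 'n set)"
  let ?n = "\<lambda>x. weight c (snd x) + wb (fst x)"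
  let ?F = "\<lambda>\<epsilon>. \<Sum>x\<in>?S \<epsilon>. (Xp :: int poly) ^ ?n x"
  let ?E = "\<lambda>\<epsilon>. \<Sum>j<p. of_int (int (card {x \<in> ?S \<epsilon>. ?n x mod p = j})) * (Xp :: int poly) ^ j"
  have fin: "finite (?S \<epsilon>)" for \<epsilon> using finB finite_box[of "UNIV :: 'n set" N] by auto
  have 1: "Xp ^ p - 1 dvd (?F True - ?E True) - (?F False - ?E False)"
    by (intro dvd_diff count_by_residue fin p_pos)
  have "euler UNIV j = int (card (grade True j - high N UNIV)) - int (card (grade False j - high N UNIV))" for j
  proof -
    obtain h h' where "free.quot_dim (Z UNIV True j) (Bd UNIV True j) h"
        "free.quot_dim (Z UNIV False j) (Bd UNIV False j) h'"
        and "int h - int h' = int (card (grade True j - high N UNIV)) - int (card (grade False j - high N UNIV))"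
      using top_euler[of j] by blast
    then show ?thesis unfolding euler_def by (simp only: hdim_eqI)
  qed
  then have eul: "euler UNIV j = int (card {x \<in> ?S True. ?n x mod p = j}) - int (card {x \<in> ?S False. ?n x mod p = j})"
    if "j < p" for j using that by (simp only: grade_minus_high mod_less)
  then have E: "euler_poly UNIV = ?E True - ?E False"
    unfolding euler_poly_def sum_subtractf[symmetric]
    by (intro sum.cong refl) (simp only: eul lessThan_iff of_int_diff left_diff_distrib)
  have F: "?F \<epsilon> = (\<Sum>b | b \<in> B \<and> par b = \<epsilon>. Xp ^ wb b) * (\<Prod>i\<in>UNIV. \<Sum>l<N. Xp ^ (c i * l))" for \<epsilon>
    unfolding sum_box[OF finite, symmetric] sum_product sum.cartesian_product
    by (simp add: case_prod_unfold power_add mult.commute)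
  have bs: "(\<Sum>b\<in>B. (if par b then 1 else - 1) * (Xp :: int poly) ^ wb b)
      = (\<Sum>b | b \<in> B \<and> par b = True. Xp ^ wb b) - (\<Sum>b | b \<in> B \<and> par b = False. Xp ^ wb b)"
  proof -
    have "(\<Sum>b\<in>B. (if par b then 1 else - 1) * (Xp :: int poly) ^ wb b)
        = (\<Sum>b\<in>B. if par b then Xp ^ wb b else - (Xp ^ wb b))" by (intro sum.cong refl) simp
    then show ?thesis using finB by (simp add: sum.If_cases sum_negf Int_def)
  qed
  have ring: "(s - t) * q - (e - e') = (s * q - e) - (t * q - e')" for s t q e e' :: "int poly"
    by (simp add: algebra_simps)
  have eq: "(\<Sum>b\<in>B. (if par b then 1 else - 1) * Xp ^ wb b) * (\<Prod>i\<in>UNIV. \<Sum>l<N. Xp ^ (c i * l)) - euler_poly UNIV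
      = (?F True - ?E True) - (?F False - ?E False)"
    unfolding E F bs by (rule ring)
  show ?thesis unfolding eq by (rule 1)
qed

text \<open>The Lefschetz formula: comparison of the Euler characteristics for \<open>L = UNIV\<close> and \<open>L = {}\<close>.\<close>

theorem weighted_euler_divisible:
  "\<exists>H. Xp ^ p - 1 dvd (\<Sum>b\<in>B. (if par b then 1 else - 1) * Xp ^ wb b) * (\<Prod>i\<in>UNIV. \<Sum>l<N. Xp ^ (c i * l))
      - H * (\<Prod>i\<in>UNIV. 1 - Xp ^ (c i * N))"
proof -
  have "Xp ^ p - 1 dvd ((\<Sum>b\<in>B. (if par b then 1 else - 1) * Xp ^ wb b) * (\<Prod>i\<in>UNIV. \<Sum>l<N. Xp ^ (c i * l))
      - euler_poly UNIV) + (euler_poly UNIV - euler_poly {} * (\<Prod>i\<in>UNIV. 1 - Xp ^ (c i * N)))"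
    by (intro dvd_add euler_poly_top euler_poly_prod finite)
  then show ?thesis by (intro exI[of _ "euler_poly {}"]) simp
qed

end

section \<open>The endomorphism complex of a homogeneous matrix factorization\<close>

definition sgn_of :: "bool \<Rightarrow> 'a::comm_ring_1" where "sgn_of b = (if b then 1 else - 1)"

lemma sgn_of_square [simp]: "sgn_of b * (sgn_of b * x) = x"
  by (simp add: sgn_of_def)

text \<open>A matrix factorization of \<open>w\<close> in homogeneous coordinates. The even and the odd part are combined into
  one free module with basis \<open>I\<close>, where \<open>par\<close> marks the even basis elements, and \<open>\<delta>\<close> is the odd
  endomorphism. The weights \<open>e\<close> are those by which the generator acts on the basis.\<close>

locale homogeneous_factorization =
  fixes I :: "'i set" and par :: "'i \<Rightarrow> bool" and e :: "'i \<Rightarrow> nat" and c :: "'n::finite \<Rightarrow> nat"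
    and p :: nat and w :: "('n, 'k::field) mfps" and \<delta> :: "'i \<Rightarrow> 'i \<Rightarrow> ('n, 'k) mfps"
  assumes finI: "finite I" and p: "prime p" and c: "\<And>i. \<not> p dvd c i"
    and odd: "\<And>u v. u \<in> I \<Longrightarrow> v \<in> I \<Longrightarrow> \<delta> u v \<noteq> 0 \<Longrightarrow> par u \<noteq> par v"
    and square: "\<And>u v. u \<in> I \<Longrightarrow> v \<in> I \<Longrightarrow> (\<Sum>x\<in>I. \<delta> u x * \<delta> x v) = (if u = v then w else 0)"
    and homogeneous: "\<And>u v a. u \<in> I \<Longrightarrow> v \<in> I \<Longrightarrow> mcoeff (\<delta> u v) a \<noteq> 0 \<Longrightarrow>
      (weight c a + e v) mod p = e u mod p"
begin

definition odd_matrix :: "('i \<Rightarrow> 'i \<Rightarrow> ('n, 'k) mfps) \<Rightarrow> bool" where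
  "odd_matrix \<eta> \<longleftrightarrow> (\<forall>u\<in>I. \<forall>v\<in>I. \<eta> u v \<noteq> 0 \<longrightarrow> par u \<noteq> par v)"

abbreviation s :: "'i \<Rightarrow> ('n, 'k) mfps" where "s u \<equiv> sgn_of (par u)"

text \<open>Endomorphisms are given by their matrices. The differential \<open>D\<close> of the endomorphism complex is the
  supercommutator with \<open>\<delta>\<close>, namely left multiplication by \<open>\<delta>\<close> minus right multiplication by \<open>\<delta>\<close>
  twisted by the parity of the endomorphism.\<close>

definition lmult :: "('i \<Rightarrow> 'i \<Rightarrow> ('n, 'k) mfps) \<Rightarrow> ('i \<times> 'i \<Rightarrow> ('n, 'k) mfps) \<Rightarrow> 'i \<times> 'i \<Rightarrow> ('n, 'k) mfps" where
  "lmult \<eta> \<Phi> = (\<lambda>(u, v). if u \<in> I \<and> v \<in> I then \<Sum>x\<in>I. \<eta> u x * \<Phi> (x, v) else 0)"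

definition rmult :: "('i \<times> 'i \<Rightarrow> ('n, 'k) mfps) \<Rightarrow> 'i \<times> 'i \<Rightarrow> ('n, 'k) mfps" where
  "rmult \<Phi> = (\<lambda>(u, v). if u \<in> I \<and> v \<in> I then \<Sum>x\<in>I. s u * s x * (\<Phi> (u, x) * \<delta> x v) else 0)"

definition D :: "('i \<times> 'i \<Rightarrow> ('n, 'k) mfps) \<Rightarrow> 'i \<times> 'i \<Rightarrow> ('n, 'k) mfps" where
  "D \<Phi> = lmult \<delta> \<Phi> - rmult \<Phi>"

lemma odd_matrix_s:
  assumes "odd_matrix \<eta>" "u \<in> I" "v \<in> I" shows "s u * \<eta> u v = - (s v * \<eta> u v)"
  using assms by (cases "\<eta> u v = 0") (auto simp: odd_matrix_def sgn_of_def)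

lemma odd_\<delta>: "odd_matrix \<delta>"
  using odd by (auto simp: odd_matrix_def)

lemma lmult_lmult:
  assumes "u \<in> I" "v \<in> I"
  shows "lmult \<eta> (lmult \<theta> \<Phi>) (u, v) = (\<Sum>y\<in>I. (\<Sum>x\<in>I. \<eta> u x * \<theta> x y) * \<Phi> (y, v))"
proof -
  have "lmult \<eta> (lmult \<theta> \<Phi>) (u, v) = (\<Sum>x\<in>I. \<Sum>y\<in>I. \<eta> u x * \<theta> x y * \<Phi> (y, v))"
    using assms by (simp add: lmult_def sum_distrib_left mult.assoc)
  also have "\<dots> = (\<Sum>y\<in>I. \<Sum>x\<in>I. \<eta> u x * \<theta> x y * \<Phi> (y, v))" by (rule sum.swap)
  finally show ?thesis by (simp add: sum_distrib_right)
qed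

text \<open>Left and right multiplications commute; the sign comes from the parity twist in \<open>rmult\<close>, as \<open>\<eta>\<close> is
  odd.\<close>

lemma lmult_rmult_anticommute:
  assumes "odd_matrix \<eta>"
  shows "lmult \<eta> (rmult \<Phi>) z + rmult (lmult \<eta> \<Phi>) z = 0"
proof (cases z)
  case (Pair u v)
  show ?thesis
  proof (cases "u \<in> I \<and> v \<in> I")
    case True
    then have uv: "u \<in> I" "v \<in> I" by auto
    have 1: "lmult \<eta> (rmult \<Phi>) (u, v) = (\<Sum>x\<in>I. \<Sum>y\<in>I. (s x * \<eta> u x) * (s y * (\<Phi> (x, y) * \<delta> y v)))"
      using uv by (simp add: lmult_def rmult_def sum_distrib_left mult_ac)
    have "rmult (lmult \<eta> \<Phi>) (u, v) = (\<Sum>y\<in>I. \<Sum>x\<in>I. (s u * \<eta> u x) * (s y * (\<Phi> (x, y) * \<delta> y v)))"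
      using uv by (simp add: lmult_def rmult_def sum_distrib_left sum_distrib_right mult_ac)
    also have "\<dots> = (\<Sum>x\<in>I. \<Sum>y\<in>I. (s u * \<eta> u x) * (s y * (\<Phi> (x, y) * \<delta> y v)))" by (rule sum.swap)
    also have "\<dots> = - (\<Sum>x\<in>I. \<Sum>y\<in>I. (s x * \<eta> u x) * (s y * (\<Phi> (x, y) * \<delta> y v)))"
      unfolding sum_negf[symmetric]
      by (intro sum.cong refl) (simp only: odd_matrix_s[OF assms uv(1)] mult_minus_left)
    finally show ?thesis using 1 Pair by simp
  qed (auto simp: Pair lmult_def rmult_def)
qed

lemma rmult_rmult:
  assumes "u \<in> I" "v \<in> I" shows "rmult (rmult \<Phi>) (u, v) = - (w * \<Phi> (u, v))"
proof -
  have "rmult (rmult \<Phi>) (u, v) = (\<Sum>x\<in>I. \<Sum>y\<in>I. \<Phi> (u, y) * (s y * (s x * \<delta> y x)) * \<delta> x v)"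
    using assms by (simp add: rmult_def sum_distrib_left sum_distrib_right mult_ac)
  also have "\<dots> = (\<Sum>x\<in>I. \<Sum>y\<in>I. - (\<Phi> (u, y) * (\<delta> y x * \<delta> x v)))"
  proof (intro sum.cong refl)
    fix x y assume "x \<in> I" "y \<in> I"
    then have "s y * (s x * \<delta> y x) = - (s y * (s y * \<delta> y x))"
      using odd_matrix_s[OF odd_\<delta>, of y x] by (metis minus_minus mult_minus_right)
    then show "\<Phi> (u, y) * (s y * (s x * \<delta> y x)) * \<delta> x v = - (\<Phi> (u, y) * (\<delta> y x * \<delta> x v))"
      by (simp add: mult.assoc)
  qed
  also have "\<dots> = (\<Sum>y\<in>I. \<Sum>x\<in>I. - (\<Phi> (u, y) * (\<delta> y x * \<delta> x v)))" by (rule sum.swap)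
  also have "\<dots> = (\<Sum>y\<in>I. - (\<Phi> (u, y) * (if y = v then w else 0)))"
    by (intro sum.cong refl) (simp only: sum_negf sum_distrib_left[symmetric] square assms)
  also have "\<dots> = (\<Sum>y\<in>I. if y = v then - (w * \<Phi> (u, v)) else 0)"
    by (intro sum.cong refl) (simp add: mult.commute)
  finally show ?thesis using assms finI by simp
qed

lemma lmult_diff: "lmult \<eta> (\<Phi> - \<Psi>) z = lmult \<eta> \<Phi> z - lmult \<eta> \<Psi> z"
  and rmult_diff: "rmult (\<Phi> - \<Psi>) z = rmult \<Phi> z - rmult \<Psi> z"
  by (cases z; simp add: lmult_def rmult_def sum_subtractf algebra_simps)+

lemma lmult_supp: "\<not> (u \<in> I \<and> v \<in> I) \<Longrightarrow> lmult \<eta> \<Phi> (u, v) = 0"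
  and rmult_supp: "\<not> (u \<in> I \<and> v \<in> I) \<Longrightarrow> rmult \<Phi> (u, v) = 0"
  by (auto simp: lmult_def rmult_def)

lemma D_apply: "D \<Phi> z = lmult \<delta> \<Phi> z - rmult \<Phi> z"
  by (simp add: D_def)

text \<open>The square of \<open>lmult \<delta>\<close> is \<open>w\<close>, the square of \<open>rmult\<close> is \<open>- w\<close>, and the mixed terms cancel.\<close>

lemma D_D: "D (D \<Phi>) = 0"
proof
  fix z :: "'i \<times> 'i"
  obtain u v where z: "z = (u, v)" by (cases z)
  show "D (D \<Phi>) z = 0 z"
  proof (cases "u \<in> I \<and> v \<in> I")
    case True
    then have uv: "u \<in> I" "v \<in> I" by auto
    have "lmult \<delta> (lmult \<delta> \<Phi>) z = (\<Sum>y\<in>I. if y = u then w * \<Phi> (u, v) else 0)"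
      unfolding z lmult_lmult[OF uv] by (intro sum.cong refl) (simp add: square uv)
    also have "\<dots> = w * \<Phi> (u, v)" using uv finI by simp
    finally have 1: "lmult \<delta> (lmult \<delta> \<Phi>) z = w * \<Phi> z" using z by simp
    have "D (D \<Phi>) z = lmult \<delta> (lmult \<delta> \<Phi>) z + rmult (rmult \<Phi>) z
        - (lmult \<delta> (rmult \<Phi>) z + rmult (lmult \<delta> \<Phi>) z)"
    proof -
      have "lmult \<delta> (D \<Phi>) z = lmult \<delta> (lmult \<delta> \<Phi>) z - lmult \<delta> (rmult \<Phi>) z"
        "rmult (D \<Phi>) z = rmult (lmult \<delta> \<Phi>) z - rmult (rmult \<Phi>) z"
        by (simp_all only: D_def lmult_diff rmult_diff)
      then show ?thesis unfolding D_apply[of "D \<Phi>" z] by simp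
    qed
    also have "\<dots> = w * \<Phi> z + - (w * \<Phi> z) - 0"
      by (simp only: 1 rmult_rmult[OF uv, of \<Phi>, folded z] lmult_rmult_anticommute[OF odd_\<delta>])
    finally show ?thesis by simp
  qed (simp add: z D_apply lmult_supp rmult_supp)
qed

lemma D_lmult_homotopy:
  assumes "odd_matrix \<eta>"
    and "\<And>u v. u \<in> I \<Longrightarrow> v \<in> I \<Longrightarrow> (\<Sum>x\<in>I. \<delta> u x * \<eta> x v + \<eta> u x * \<delta> x v) = (if u = v then y else 0)"
    and "\<And>u v. \<not> (u \<in> I \<and> v \<in> I) \<Longrightarrow> \<Phi> (u, v) = 0"
  shows "D (lmult \<eta> \<Phi>) + lmult \<eta> (D \<Phi>) = (\<lambda>z. y * \<Phi> z)"
proof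
  fix z :: "'i \<times> 'i"
  obtain u v where z: "z = (u, v)" by (cases z)
  show "(D (lmult \<eta> \<Phi>) + lmult \<eta> (D \<Phi>)) z = y * \<Phi> z"
  proof (cases "u \<in> I \<and> v \<in> I")
    case True
    then have uv: "u \<in> I" "v \<in> I" by auto
    have "lmult \<delta> (lmult \<eta> \<Phi>) z + lmult \<eta> (lmult \<delta> \<Phi>) z
        = (\<Sum>x\<in>I. (\<Sum>t\<in>I. \<delta> u t * \<eta> t x + \<eta> u t * \<delta> t x) * \<Phi> (x, v))"
      unfolding z lmult_lmult[OF uv] by (simp add: sum.distrib distrib_right)
    also have "\<dots> = (\<Sum>x\<in>I. if x = u then y * \<Phi> (u, v) else 0)"
      by (intro sum.cong refl) (simp add: assms(2) uv)
    also have "\<dots> = y * \<Phi> z" using uv finI z by simp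
    finally have 1: "lmult \<delta> (lmult \<eta> \<Phi>) z + lmult \<eta> (lmult \<delta> \<Phi>) z = y * \<Phi> z" .
    have "(D (lmult \<eta> \<Phi>) + lmult \<eta> (D \<Phi>)) z = lmult \<delta> (lmult \<eta> \<Phi>) z + lmult \<eta> (lmult \<delta> \<Phi>) z
        - (lmult \<eta> (rmult \<Phi>) z + rmult (lmult \<eta> \<Phi>) z)"
    proof -
      have "lmult \<eta> (D \<Phi>) z = lmult \<eta> (lmult \<delta> \<Phi>) z - lmult \<eta> (rmult \<Phi>) z"
        by (simp only: D_def lmult_diff)
      then show ?thesis unfolding plus_fun_apply D_apply[of "lmult \<eta> \<Phi>" z] by simp
    qed
    also have "\<dots> = y * \<Phi> z - 0" by (simp only: 1 lmult_rmult_anticommute[OF assms(1)])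
    finally show ?thesis by simp
  qed (use assms(3) in \<open>simp add: z D_apply lmult_supp rmult_supp\<close>)
qed

text \<open>Differentiating \<open>\<delta>\<^sup>2 = w\<close> shows that \<open>\<delta>\<close> and its partial derivative with respect to \<open>x\<^sub>i\<close> have the
  partial derivative of \<open>w\<close> as anticommutator. So for \<open>y = \<Sum>\<^sub>i g\<^sub>i \<partial>\<^sub>iw\<close> one takes
  \<open>\<eta> = \<Sum>\<^sub>i g\<^sub>i \<partial>\<^sub>i\<delta>\<close>.\<close>

lemma exists_homotopy:
  assumes "y \<in> jacobian_ideal w"
  shows "\<exists>\<eta>. odd_matrix \<eta> \<and> (\<forall>u\<in>I. \<forall>v\<in>I. (\<Sum>x\<in>I. \<delta> u x * \<eta> x v + \<eta> u x * \<delta> x v) = (if u = v then y else 0))"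
proof -
  obtain g where g: "y = (\<Sum>i\<in>UNIV. g i * pderiv_mfps i w)" using assms by (auto simp: jacobian_ideal_def)
  define \<eta> where "\<eta> = (\<lambda>u v. \<Sum>i\<in>UNIV. g i * pderiv_mfps i (\<delta> u v))"
  have "odd_matrix \<eta>" unfolding odd_matrix_def
  proof (intro ballI impI)
    fix u v assume "u \<in> I" "v \<in> I" "\<eta> u v \<noteq> 0"
    then have "\<delta> u v \<noteq> 0" by (auto simp: \<eta>_def)
    then show "par u \<noteq> par v" using odd \<open>u \<in> I\<close> \<open>v \<in> I\<close> by blast
  qed
  moreover have "(\<Sum>x\<in>I. \<delta> u x * \<eta> x v + \<eta> u x * \<delta> x v) = (if u = v then y else 0)" if "u \<in> I" "v \<in> I" for u v
  proof -
    have "(\<Sum>x\<in>I. \<delta> u x * \<eta> x v + \<eta> u x * \<delta> x v)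
        = (\<Sum>x\<in>I. \<Sum>i\<in>UNIV. g i * pderiv_mfps i (\<delta> u x * \<delta> x v))"
    proof (intro sum.cong refl)
      fix x
      show "\<delta> u x * \<eta> x v + \<eta> u x * \<delta> x v = (\<Sum>i\<in>UNIV. g i * pderiv_mfps i (\<delta> u x * \<delta> x v))"
        unfolding \<eta>_def sum_distrib_left sum_distrib_right sum.distrib[symmetric]
        by (intro sum.cong refl) (simp add: pderiv_mult algebra_simps)
    qed
    also have "\<dots> = (\<Sum>i\<in>UNIV. \<Sum>x\<in>I. g i * pderiv_mfps i (\<delta> u x * \<delta> x v))" by (rule sum.swap)
    also have "\<dots> = (\<Sum>i\<in>UNIV. g i * pderiv_mfps i (if u = v then w else 0))"
      unfolding sum_distrib_left[symmetric] pderiv_sum[symmetric] square[OF that] ..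
    finally show ?thesis by (simp add: g)
  qed
  ultimately show ?thesis by blast
qed

end

lemma mcoeff_times_nonzero:
  assumes "mcoeff (f * g) a \<noteq> 0"
  shows "\<exists>x y. x + y = a \<and> mcoeff f x \<noteq> 0 \<and> mcoeff g y \<noteq> 0"
proof -
  obtain z where z: "z \<in> splits a" "(case z of (x, y) \<Rightarrow> mcoeff f x * mcoeff g y) \<noteq> 0"
    using assms unfolding mcoeff_times by (rule sum.not_neutral_contains_not_neutral)
  obtain x y where xy: "z = (x, y)" by (cases z)
  then have "mcoeff f x * mcoeff g y \<noteq> 0" "x + y = a" using z by (simp_all add: splits_def)
  then show ?thesis by (metis mult_zero_left mult_zero_right)
qed

lemma is_ideal_jacobian: "is_ideal (jacobian_ideal w)"
  unfolding is_ideal_def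
proof (intro conjI ballI allI)
  show "0 \<in> jacobian_ideal w"
    unfolding jacobian_ideal_def by (rule CollectI, rule exI[of _ "\<lambda>_. 0"]) simp
next
  fix f g assume "f \<in> jacobian_ideal w" "g \<in> jacobian_ideal w"
  then obtain a b where "f = (\<Sum>i\<in>UNIV. a i * pderiv_mfps i w)" "g = (\<Sum>i\<in>UNIV. b i * pderiv_mfps i w)"
    by (auto simp: jacobian_ideal_def)
  then have "f + g = (\<Sum>i\<in>UNIV. (a i + b i) * pderiv_mfps i w)" by (simp add: distrib_right sum.distrib)
  then show "f + g \<in> jacobian_ideal w"
    unfolding jacobian_ideal_def by (intro CollectI exI[of _ "\<lambda>i. a i + b i"]) simp
next
  fix f g assume "f \<in> jacobian_ideal w"
  then obtain a where "f = (\<Sum>i\<in>UNIV. a i * pderiv_mfps i w)" by (auto simp: jacobian_ideal_def)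
  then have "g * f = (\<Sum>i\<in>UNIV. (g * a i) * pderiv_mfps i w)" by (simp add: sum_distrib_left mult.assoc)
  then show "g * f \<in> jacobian_ideal w"
    unfolding jacobian_ideal_def by (intro CollectI exI[of _ "\<lambda>i. g * a i"]) simp
qed

text \<open>A common bound for all variables, which leaves the freedom to prescribe \<open>N\<close> modulo \<open>p\<close> later.\<close>

lemma exists_large_var_power:
  fixes w :: "('n::finite, 'k::field) mfps"
  assumes "finite_dim_quotient (jacobian_ideal w)"
  shows "\<exists>L. \<forall>i. \<forall>N\<ge>L. var_power i N \<in> jacobian_ideal w"
proof -
  note J = is_idealD[OF is_ideal_jacobian[of w]]
  have "\<forall>i. \<exists>N. var_power i N \<in> jacobian_ideal w"
    using var_power_in_finite_codim_ideal[OF J(1,2,3) assms] by blast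
  then obtain n where n: "\<And>i. var_power i (n i) \<in> jacobian_ideal w" by metis
  have "var_power i N \<in> jacobian_ideal w" if "N \<ge> (\<Sum>i\<in>UNIV. n i)" for i N
  proof -
    have "n i \<le> (\<Sum>i\<in>UNIV. n i)" by (rule member_le_sum) auto
    then have "var_power i N = var_power i (N - n i) * (var_power i (n i) :: ('n, 'k) mfps)"
      using that var_power_add[of i "N - n i" "n i"] by simp
    then show ?thesis using J(3)[OF n] by simp
  qed
  then show ?thesis by blast
qed

context homogeneous_factorization
begin

lemma p_pos: "p > 0" using p prime_gt_0_nat by blast

abbreviation "wt \<equiv> \<lambda>(u, v). (p - 1) * e u + e v"

text \<open>The entries of \<open>\<delta>\<close> have weight \<open>e u - e v\<close>, and the matrix unit at \<open>(u, v)\<close> has weight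
  \<open>e v - e u\<close>. In natural numbers \<open>- e u\<close> is replaced by \<open>(p - 1) * e u\<close>. This and the next lemma
  say that left and right multiplication by \<open>\<delta>\<close> preserve weights.\<close>

lemma weight_left:
  assumes "(a1 + e x) mod p = e u mod p" "(a2 + ((p - 1) * e x + e v)) mod p = j mod p"
  shows "(a1 + a2 + ((p - 1) * e u + e v)) mod p = j mod p"
proof -
  have pe: "p * z = z + (p - 1) * z" for z using p_pos by (cases p) auto
  let ?R = "a2 + (p - 1) * e x + (p - 1) * e u + e v"
  have "(a1 + a2 + ((p - 1) * e u + e v)) mod p = (a1 + a2 + ((p - 1) * e u + e v) + p * e x) mod p" by simp
  also have "a1 + a2 + ((p - 1) * e u + e v) + p * e x = (a1 + e x) + ?R" unfolding pe by simp
  also have "\<dots> mod p = (e u + ?R) mod p" using assms(1) by (rule mod_add_cong) simp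
  also have "e u + ?R = a2 + ((p - 1) * e x + e v) + p * e u" unfolding pe by simp
  also have "\<dots> mod p = j mod p" using assms(2) by simp
  finally show ?thesis .
qed

lemma weight_right:
  assumes "(a1 + e v) mod p = e x mod p" "(a2 + ((p - 1) * e u + e x)) mod p = j mod p"
  shows "(a2 + a1 + ((p - 1) * e u + e v)) mod p = j mod p"
proof -
  have "(a2 + a1 + ((p - 1) * e u + e v)) mod p = ((a1 + e v) + (a2 + (p - 1) * e u)) mod p" by (simp add: ac_simps)
  also have "\<dots> = (e x + (a2 + (p - 1) * e u)) mod p" using assms(1) by (rule mod_add_cong) simp
  also have "\<dots> = j mod p" using assms(2) by (simp add: ac_simps)
  finally show ?thesis .
qed

lemma mcoeff_s: "mcoeff (s u * s x * g) a \<noteq> 0 \<Longrightarrow> mcoeff g a \<noteq> 0"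
  by (auto simp: sgn_of_def split: if_splits)

lemma D_graded:
  assumes f: "f \<in> coord {(b, a). b \<in> I \<times> I \<and> (case b of (u, v) \<Rightarrow> par u = par v) = \<epsilon> \<and> (weight c a + wt b) mod p = j mod p}"
  shows "D f \<in> coord {(b, a). b \<in> I \<times> I \<and> (case b of (u, v) \<Rightarrow> par u = par v) = (\<not> \<epsilon>) \<and> (weight c a + wt b) mod p = j mod p}"
proof (rule coordI)
  fix b a assume nz: "mcoeff (D f b) a \<noteq> 0"
  obtain u v where b: "b = (u, v)" by (cases b)
  have "u \<in> I \<and> v \<in> I"
    by (rule ccontr) (use nz in \<open>simp add: b D_apply lmult_supp rmult_supp\<close>)
  then have uv: "u \<in> I" "v \<in> I" by auto
  have f': "x \<in> I \<and> y \<in> I \<and> (par x = par y) = \<epsilon> \<and> (weight c a' + ((p - 1) * e x + e y)) mod p = j mod p"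
    if "mcoeff (f (x, y)) a' \<noteq> 0" for x y a'
    using coordD[OF f, of "(x, y)" a'] that by auto
  have "(par u = par v) = (\<not> \<epsilon>) \<and> (weight c a + ((p - 1) * e u + e v)) mod p = j mod p"
  proof (cases "mcoeff (lmult \<delta> f (u, v)) a = 0")
    case False
    then have "(\<Sum>x\<in>I. mcoeff (\<delta> u x * f (x, v)) a) \<noteq> 0" using uv by (simp add: lmult_def)
    then obtain x where x: "x \<in> I" "mcoeff (\<delta> u x * f (x, v)) a \<noteq> 0" by (rule sum.not_neutral_contains_not_neutral)
    then obtain a1 a2 where a: "a1 + a2 = a" "mcoeff (\<delta> u x) a1 \<noteq> 0" "mcoeff (f (x, v)) a2 \<noteq> 0"
      using mcoeff_times_nonzero by blast
    have "\<delta> u x \<noteq> 0" using a(2) by auto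
    then have "par u \<noteq> par x" using odd uv x by blast
    moreover have "(weight c a1 + e x) mod p = e u mod p" using homogeneous[OF uv(1) x(1) a(2)] .
    ultimately show ?thesis using f'[OF a(3)] weight_left by (auto simp: a(1)[symmetric] weight_add)
  next
    case True
    then have "mcoeff (rmult f (u, v)) a \<noteq> 0" using nz by (auto simp: b D_apply)
    then have "(\<Sum>x\<in>I. mcoeff (s u * s x * (f (u, x) * \<delta> x v)) a) \<noteq> 0" using uv by (simp add: rmult_def)
    then obtain x where x: "x \<in> I" "mcoeff (s u * s x * (f (u, x) * \<delta> x v)) a \<noteq> 0"
      by (rule sum.not_neutral_contains_not_neutral)
    then obtain a2 a1 where a: "a2 + a1 = a" "mcoeff (f (u, x)) a2 \<noteq> 0" "mcoeff (\<delta> x v) a1 \<noteq> 0"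
      using mcoeff_times_nonzero mcoeff_s by blast
    have "\<delta> x v \<noteq> 0" using a(3) by auto
    then have "par x \<noteq> par v" using odd uv x by blast
    moreover have "(weight c a1 + e v) mod p = e x mod p" using homogeneous[OF x(1) uv(2) a(3)] .
    ultimately show ?thesis using f'[OF a(2)] weight_right by (auto simp: a(1)[symmetric] weight_add)
  qed
  then show "(b, a) \<in> {(b, a). b \<in> I \<times> I \<and> (case b of (u, v) \<Rightarrow> par u = par v) = (\<not> \<epsilon>) \<and> (weight c a + wt b) mod p = j mod p}"
    using uv by (simp add: b)
qed

lemma lmult_ideal:
  assumes "is_ideal K" "\<And>b. f b \<in> K" shows "lmult \<eta> f b \<in> K"
  using assms by (cases b) (auto simp: lmult_def intro!: is_ideal_sum is_idealD(1,3))

lemma rmult_ideal: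
  assumes "is_ideal K" "\<And>b. f b \<in> K" shows "rmult f b \<in> K"
  using assms by (cases b) (auto simp: rmult_def intro!: is_ideal_sum is_idealD(1) is_idealD(3)[OF _ is_idealD(4)])

lemma D_ideal:
  assumes "is_ideal K" "\<And>b. f b \<in> K" shows "D f b \<in> K"
proof -
  have "lmult \<delta> f b + (- 1) * rmult f b \<in> K"
    using lmult_ideal[OF assms] rmult_ideal[OF assms] by (intro is_idealD(2,3)[OF assms(1)])
  then show ?thesis by (simp add: D_apply)
qed

text \<open>The supertrace of the generator on the fibre, with \<open>x\<close> in place of the root of unity.\<close>

definition F :: "int poly" where "F = (\<Sum>u\<in>I. sgn_of (par u) * Xp ^ e u)"

text \<open>The fibre of the endomorphism complex is \<open>V \<otimes> V\<^sup>*\<close>, and the class of \<open>V\<^sup>*\<close> is the conjugate of the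
  one of \<open>V\<close>.\<close>

lemma F_conjugate_product:
  "F * pcompose F (Xp ^ (p - 1)) = (\<Sum>b\<in>I \<times> I. (if (case b of (u, v) \<Rightarrow> par u = par v) then 1 else - 1) * Xp ^ wt b)"
proof -
  have sgn: "pcompose (sgn_of b) q = sgn_of b" for b and q :: "int poly"
    by (simp add: sgn_of_def pcompose_1 pcompose_uminus)
  have "pcompose F (Xp ^ (p - 1)) = (\<Sum>u\<in>I. sgn_of (par u) * Xp ^ ((p - 1) * e u))"
    by (simp add: F_def pcompose_sum pcompose_mult pcompose_power sgn pcompose_pCons power_mult)
  then have "F * pcompose F (Xp ^ (p - 1)) = (\<Sum>u\<in>I. sgn_of (par u) * Xp ^ ((p - 1) * e u)) * F"
    by (simp only: mult.commute)
  also have "\<dots> = (\<Sum>b\<in>I \<times> I. (sgn_of (par (fst b)) * Xp ^ ((p - 1) * e (fst b))) * (sgn_of (par (snd b)) * Xp ^ e (snd b)))"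
    unfolding F_def sum_product sum.cartesian_product by (simp only: case_prod_unfold)
  also have "\<dots> = (\<Sum>b\<in>I \<times> I. (if (case b of (u, v) \<Rightarrow> par u = par v) then 1 else - 1) * Xp ^ wt b)"
    by (intro sum.cong refl) (auto simp: sgn_of_def power_add)
  finally show ?thesis .
qed

text \<open>The Lefschetz formula for the endomorphism complex. For \<open>N\<close> congruent to \<open>1\<close> modulo \<open>p\<close> the character of
  \<open>x\<^sub>i\<^sup>N\<close> is that of \<open>x\<^sub>i\<close>, and the geometric sum \<open>1 + x\<^sup>c + \<dots> + x\<^sup>c\<^sup>(\<^sup>N\<^sup>-\<^sup>1\<^sup>)\<close> is \<open>1\<close> modulo the
  cyclotomic polynomial; so \<open>N\<close> disappears from the formula.\<close>

theorem supertrace_norm_divisible: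
  assumes "finite_dim_quotient (jacobian_ideal w)"
  shows "\<exists>H. cyc p dvd F * pcompose F (Xp ^ (p - 1)) - H * (\<Prod>i\<in>UNIV. 1 - Xp ^ c i)"
proof -
  obtain L where L: "\<And>i N. N \<ge> L \<Longrightarrow> var_power i N \<in> jacobian_ideal w"
    using exists_large_var_power[OF assms] by blast
  \<comment> \<open>large enough for the homotopies, and congruent to \<open>1\<close> modulo \<open>p\<close>\<close>
  define N where "N = 1 + p * L"
  have "N \<ge> L" using p_pos by (cases p) (auto simp: N_def)
  define P where "P = (\<lambda>i \<eta>. odd_matrix \<eta> \<and> (\<forall>u\<in>I. \<forall>v\<in>I.
    (\<Sum>x\<in>I. \<delta> u x * \<eta> x v + \<eta> u x * \<delta> x v) = (if u = v then var_power i N else 0)))"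
  have "\<exists>\<eta>. P i \<eta>" for i
    unfolding P_def by (rule exists_homotopy[OF L[OF \<open>N \<ge> L\<close>]])
  then obtain \<eta> where P: "\<And>i. P i (\<eta> i)" by metis
  have \<eta>: "odd_matrix (\<eta> i)" "u \<in> I \<Longrightarrow> v \<in> I \<Longrightarrow>
      (\<Sum>x\<in>I. \<delta> u x * \<eta> i x v + \<eta> i u x * \<delta> x v) = (if u = v then var_power i N else 0)" for i u v
    using P[of i] by (auto simp: P_def)
  interpret W: weighted_complex "I \<times> I" "\<lambda>(u, v). par u = par v" wt c p N D "\<lambda>i. lmult (\<eta> i)"
  proof
    show "finite (I \<times> I)" using finI by simp
    show "0 < p" by (rule p_pos)
    show "D (f + g) = D f + D g" for f g
      by (rule ext) (auto simp: D_apply lmult_def rmult_def sum.distrib algebra_simps)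
    show "D (\<lambda>b. r * f b) = (\<lambda>b. r * D f b)" for r f
      by (rule ext) (auto simp: D_apply lmult_def rmult_def sum_distrib_left right_diff_distrib mult.left_commute intro!: arg_cong2[where f = "(-)"] sum.cong)
    show "D (D f) = 0" for f by (rule D_D)
    show "D f b \<in> K" if "is_ideal K" "\<And>b. f b \<in> K" for K f b using D_ideal that .
    show "lmult (\<eta> i) f b \<in> K" if "is_ideal K" "\<And>b. f b \<in> K" for K f i b using lmult_ideal that .
    show "lmult (\<eta> i) f \<in> coord ((I \<times> I) \<times> UNIV)" for f i
      by (rule coordI) (auto simp: lmult_def split: if_splits)
    show "D (lmult (\<eta> i) f) + lmult (\<eta> i) (D f) = (\<lambda>b. var_power i N * f b)" if f: "f \<in> coord ((I \<times> I) \<times> UNIV)" for f i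
    proof (rule D_lmult_homotopy[OF \<eta>])
      show "f (u, v) = 0" if "\<not> (u \<in> I \<and> v \<in> I)" for u v
        using coordD[OF f, of "(u, v)"] that by (intro mfps_eqI) simp
    qed
  qed (rule D_graded)
  have "\<exists>H. Xp ^ p - 1 dvd F * pcompose F (Xp ^ (p - 1)) * (\<Prod>i\<in>UNIV. \<Sum>l<N. Xp ^ (c i * l))
      - H * (\<Prod>i\<in>UNIV. 1 - Xp ^ (c i * N))"
    unfolding F_conjugate_product by (rule W.weighted_euler_divisible)
  then obtain H where H: "Xp ^ p - 1 dvd F * pcompose F (Xp ^ (p - 1)) * (\<Prod>i\<in>UNIV. \<Sum>l<N. Xp ^ (c i * l))
      - H * (\<Prod>i\<in>UNIV. 1 - Xp ^ (c i * N))" ..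
  let ?FF = "F * pcompose F (Xp ^ (p - 1))" and ?S = "\<Prod>i\<in>UNIV. \<Sum>l<N. Xp ^ (c i * l) :: int poly"
  have 1: "cyc p dvd ?S - (\<Prod>i\<in>(UNIV :: 'n set). 1)"
    using cyc_dvd_long_sum[OF p c, of _ L] by (intro dvd_prod_diff) (auto simp: N_def simp del: sum.lessThan_Suc)
  have 2: "cyc p dvd (\<Prod>i\<in>UNIV. 1 - Xp ^ (c i * N)) - (\<Prod>i\<in>UNIV. 1 - Xp ^ c i)"
  proof (intro dvd_prod_diff)
    fix i :: 'n
    have eq: "1 - Xp ^ (c i * N) - (1 - Xp ^ c i) = - (Xp ^ c i * (Xp ^ (p * (L * c i)) - 1))"
      by (simp add: N_def algebra_simps power_add)
    show "cyc p dvd 1 - Xp ^ (c i * N) - (1 - Xp ^ c i)"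
      unfolding eq dvd_minus_iff by (intro dvd_mult cyc_dvd_X_power_mult)
  qed simp
  have eq: "?FF - H * (\<Prod>i\<in>UNIV. 1 - Xp ^ c i) = (?FF * ?S - H * (\<Prod>i\<in>UNIV. 1 - Xp ^ (c i * N)))
     - ?FF * (?S - (\<Prod>i\<in>(UNIV :: 'n set). 1)) + H * ((\<Prod>i\<in>UNIV. 1 - Xp ^ (c i * N)) - (\<Prod>i\<in>UNIV. 1 - Xp ^ c i))"
    by (simp add: algebra_simps)
  have "cyc p dvd ?FF - H * (\<Prod>i\<in>UNIV. 1 - Xp ^ c i)"
    unfolding eq
    by (rule dvd_add[OF dvd_diff[OF dvd_trans[OF cyc_dvd_period H] dvd_mult[OF 1]] dvd_mult[OF 2]])
  then show ?thesis by blast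
qed

end

section \<open>Diagonalizing the action\<close>

lemma mult_entry:
  assumes "A \<in> carrier_mat n m" "B \<in> carrier_mat m l" "i < n" "j < l"
  shows "(A * B) $$ (i, j) = (\<Sum>k<m. A $$ (i, k) * B $$ (k, j))"
  using assms by (simp add: scalar_prod_def lessThan_atLeast0)

text \<open>As \<open>p\<close> is prime, a root of unity different from \<open>1\<close> has order exactly \<open>p\<close>.\<close>

definition primitive_root :: "'k::field \<Rightarrow> nat \<Rightarrow> bool" where
  "primitive_root \<zeta> p \<longleftrightarrow> prime p \<and> \<zeta> ^ p = 1 \<and> \<zeta> \<noteq> 1"

lemma primitive_root_power_mod: "primitive_root \<zeta> p \<Longrightarrow> \<zeta> ^ (k mod p) = \<zeta> ^ k"
proof -
  assume "primitive_root \<zeta> p"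
  then have "\<zeta> ^ p = 1" by (simp add: primitive_root_def)
  have "\<zeta> ^ k = \<zeta> ^ (p * (k div p) + k mod p)" by simp
  also have "\<dots> = \<zeta> ^ (k mod p)" unfolding power_add power_mult \<open>\<zeta> ^ p = 1\<close> by simp
  finally show ?thesis by simp
qed

lemma primitive_root_eq_1_iff:
  assumes "primitive_root \<zeta> p" shows "\<zeta> ^ k = 1 \<longleftrightarrow> p dvd k"
proof
  assume k: "\<zeta> ^ k = 1"
  show "p dvd k"
  proof (rule ccontr)
    assume "\<not> p dvd k"
    then have "coprime k p" using assms by (metis coprime_commute prime_imp_coprime primitive_root_def)
    moreover have "k \<noteq> 0" using \<open>\<not> p dvd k\<close> by (metis dvd_0_right)
    ultimately obtain x y where "k * x = p * y + 1"
      using bezout_nat[of k p] by (auto simp: coprime_iff_gcd_eq_1)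
    then have "\<zeta> ^ (k * x) = \<zeta> ^ (p * y + 1)" by simp
    then show False using k assms by (simp add: power_mult power_add primitive_root_def)
  qed
next
  assume "p dvd k"
  then show "\<zeta> ^ k = 1" using assms by (auto simp: primitive_root_def power_mult elim!: dvdE)
qed

lemma primitive_root_eq_iff:
  assumes "primitive_root \<zeta> p" shows "\<zeta> ^ k = \<zeta> ^ l \<longleftrightarrow> k mod p = l mod p"
proof -
  have nz: "\<zeta> \<noteq> 0" using assms by (auto simp: primitive_root_def prime_gt_0_nat power_0_left split: if_splits)
  have *: "k mod p = l mod p" if "k \<le> l" "\<zeta> ^ k = \<zeta> ^ l" for k l
  proof -
    have "\<zeta> ^ k * \<zeta> ^ (l - k) = \<zeta> ^ l" using that(1) by (simp add: power_add[symmetric])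
    then have "\<zeta> ^ k * \<zeta> ^ (l - k) = \<zeta> ^ k * 1" using that(2) by simp
    then have "\<zeta> ^ (l - k) = 1" using nz by simp
    then have "p dvd l - k" using primitive_root_eq_1_iff[OF assms] by blast
    then obtain q where "l - k = p * q" by (elim dvdE)
    then have "l = k + p * q" using that(1) by linarith
    then show ?thesis by simp
  qed
  show ?thesis
  proof
    assume "\<zeta> ^ k = \<zeta> ^ l"
    then show "k mod p = l mod p" using *[of k l] *[of l k, symmetric] nat_le_linear[of k l] by argo
  next
    assume "k mod p = l mod p"
    then have "\<zeta> ^ (k mod p) = \<zeta> ^ (l mod p)" by (rule arg_cong)
    then show "\<zeta> ^ k = \<zeta> ^ l" unfolding primitive_root_power_mod[OF assms] .
  qed
qed

lemma sum_primitive_root: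
  assumes "primitive_root \<zeta> p" shows "(\<Sum>j<p. (\<zeta> ^ k) ^ j) = (if p dvd k then of_nat p else 0)"
proof (cases "p dvd k")
  case True
  then have "\<zeta> ^ k = 1" using primitive_root_eq_1_iff[OF assms] by simp
  then show ?thesis using True by simp
next
  case False
  then have "\<zeta> ^ k \<noteq> 1" using primitive_root_eq_1_iff[OF assms] by simp
  moreover have "(\<zeta> ^ k) ^ p = 1"
    using assms by (metis mult.commute power_mult power_one primitive_root_def)
  ultimately show ?thesis using False by (simp add: sum_gp_strict)
qed

lemma sum_cyclic_shift: "h p = h 0 \<Longrightarrow> (\<Sum>j<p. h (Suc j)) = (\<Sum>j<p. h j)" for h :: "nat \<Rightarrow> 'a::ab_group_add"
  using sum.lessThan_Suc_shift[of h p] sum.lessThan_Suc[of h p] by simp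

definition fscale :: "'k::field \<Rightarrow> (nat \<Rightarrow> 'k) \<Rightarrow> nat \<Rightarrow> 'k" where "fscale c f = (\<lambda>i. c * f i)"

interpretation fk: quotient_space "fscale :: 'k::field \<Rightarrow> (nat \<Rightarrow> 'k) \<Rightarrow> _"
  by unfold_locales (simp_all add: fscale_def fun_eq_iff algebra_simps)

lemma sum_fun_apply: "sum F A i = (\<Sum>x\<in>A. F x i)"
  by (induction A rule: infinite_finite_induct) simp_all

definition mat_act :: "'k::field mat \<Rightarrow> nat \<Rightarrow> (nat \<Rightarrow> 'k) \<Rightarrow> nat \<Rightarrow> 'k" where
  "mat_act A r f = (\<lambda>i. if i < r then \<Sum>j<r. A $$ (i, j) * f j else 0)"

lemma mat_act_mult:
  assumes "A \<in> carrier_mat r r" "B \<in> carrier_mat r r"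
  shows "mat_act (A * B) r f = mat_act A r (mat_act B r f)"
proof
  fix i
  have "i < r \<Longrightarrow> (\<Sum>j<r. (A * B) $$ (i, j) * f j) = (\<Sum>j<r. \<Sum>k<r. A $$ (i, k) * (B $$ (k, j) * f j))"
    by (intro sum.cong refl) (simp add: mult_entry[OF assms] sum_distrib_right mult.assoc del: index_mult_mat)
  also have "\<dots> = (\<Sum>k<r. \<Sum>j<r. A $$ (i, k) * (B $$ (k, j) * f j))" by (rule sum.swap)
  finally show "mat_act (A * B) r f i = mat_act A r (mat_act B r f) i"
    by (simp add: mat_act_def sum_distrib_left del: index_mult_mat)
qed

lemma mat_pow_commute: "A \<in> carrier_mat r r \<Longrightarrow> A * A ^\<^sub>m i = A ^\<^sub>m i * A" for A :: "'a::semiring_1 mat"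
proof (induction i)
  case (Suc i)
  have "A * A ^\<^sub>m Suc i = (A * A ^\<^sub>m i) * A"
    using Suc.prems by (simp add: assoc_mult_mat[of A r r "A ^\<^sub>m i" r A r])
  then show ?case using Suc by simp
qed simp

lemma mat_act_one: "(\<And>i. i \<ge> r \<Longrightarrow> f i = 0) \<Longrightarrow> mat_act (1\<^sub>m r) r f = f"
proof
  fix i assume f: "\<And>i. i \<ge> r \<Longrightarrow> f i = 0"
  have "i < r \<Longrightarrow> (\<Sum>j<r. 1\<^sub>m r $$ (i, j) * f j) = (\<Sum>j<r. if j = i then f j else 0)"
    by (intro sum.cong refl) simp
  then show "mat_act (1\<^sub>m r) r f i = f i" using f[of i] by (auto simp: mat_act_def)
qed

lemma mat_act_scale: "mat_act A r (fscale c f) = fscale c (mat_act A r f)"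
  by (auto simp: mat_act_def fscale_def sum_distrib_left mult.left_commute)

lemma mat_act_sum: "mat_act A r (sum F X) = (\<Sum>x\<in>X. mat_act A r (F x))"
proof
  fix i
  have "(\<Sum>j<r. A $$ (i, j) * sum F X j) = (\<Sum>x\<in>X. \<Sum>j<r. A $$ (i, j) * F x j)"
    unfolding sum_fun_apply sum_distrib_left by (rule sum.swap)
  then show "mat_act A r (sum F X) i = (\<Sum>x\<in>X. mat_act A r (F x)) i"
    by (simp add: sum_fun_apply mat_act_def)
qed

lemma mat_act_supp: "i \<ge> r \<Longrightarrow> mat_act A r f i = 0"
  by (simp add: mat_act_def)

text \<open>The projections \<open>\<Sum>\<^sub>i \<zeta>\<^sup>-\<^sup>i\<^sup>j A\<^sup>i\<close> onto the eigenspaces add up to \<open>p\<close> times the identity.\<close>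

lemma finite_order_eigenvectors_span:
  fixes A :: "'k::field_char_0 mat"
  assumes A: "A \<in> carrier_mat r r" "A ^\<^sub>m p = 1\<^sub>m r" and \<zeta>: "primitive_root \<zeta> p"
    and f: "\<And>i. i \<ge> r \<Longrightarrow> f i = 0"
  shows "f \<in> fk.span {g. (\<forall>i\<ge>r. g i = 0) \<and> (\<exists>j<p. mat_act A r g = fscale (\<zeta> ^ j) g)}"
proof -
  have p: "p > 0" using \<zeta> prime_gt_0_nat by (auto simp: primitive_root_def)
  define T where "T = (\<lambda>i. mat_act (A ^\<^sub>m i) r f)"
  have T0: "T 0 = f" using A f by (simp add: T_def mat_act_one)
  have Tp: "T p = f" using A f by (simp add: T_def mat_act_one)
  have TS: "mat_act A r (T i) = T (Suc i)" for i
    using A by (simp add: T_def mat_act_mult[symmetric] pow_carrier_mat mat_pow_commute[OF A(1)])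
  have Ts: "i \<ge> r \<Longrightarrow> T k i = 0" for i k by (simp add: T_def mat_act_supp)
  let ?\<xi> = "inverse \<zeta>"
  have nz: "\<zeta> \<noteq> 0" using \<zeta> p by (auto simp: primitive_root_def power_0_left split: if_splits)
  have \<xi>: "primitive_root ?\<xi> p" using \<zeta> by (simp add: primitive_root_def power_inverse)
  define g where "g = (\<lambda>j. \<Sum>i<p. fscale ((?\<xi> ^ j) ^ i) (T i))"
  have eig: "mat_act A r (g j) = fscale (\<zeta> ^ j) (g j)" for j
  proof -
    have "mat_act A r (g j) = (\<Sum>i<p. fscale ((?\<xi> ^ j) ^ i) (T (Suc i)))"
      by (simp add: g_def mat_act_sum mat_act_scale TS)
    also have "\<dots> = (\<Sum>i<p. fscale (\<zeta> ^ j) (fscale ((?\<xi> ^ j) ^ Suc i) (T (Suc i))))"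
      using nz by (intro sum.cong refl) (simp add: fk.scale_scale mult.assoc[symmetric] power_mult_distrib[symmetric] power_inverse)
    also have "\<dots> = fscale (\<zeta> ^ j) (\<Sum>i<p. fscale ((?\<xi> ^ j) ^ Suc i) (T (Suc i)))"
      by (simp only: fk.scale_sum_right)
    also have "(\<Sum>i<p. fscale ((?\<xi> ^ j) ^ Suc i) (T (Suc i))) = g j"
      unfolding g_def
    proof (rule sum_cyclic_shift)
      have "(?\<xi> ^ j) ^ p = 1" using \<xi> by (metis mult.commute power_mult power_one primitive_root_def)
      then show "fscale ((?\<xi> ^ j) ^ p) (T p) = fscale ((?\<xi> ^ j) ^ 0) (T 0)" using T0 Tp by simp
    qed
    finally show ?thesis .
  qed
  have "(\<Sum>j<p. g j) = (\<Sum>i<p. \<Sum>j<p. fscale ((?\<xi> ^ j) ^ i) (T i))"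
    unfolding g_def by (rule sum.swap)
  also have "\<dots> = (\<Sum>i<p. fscale (\<Sum>j<p. (?\<xi> ^ i) ^ j) (T i))"
    by (simp only: fk.scale_sum_left power_mult[symmetric] mult.commute)
  also have "\<dots> = (\<Sum>i<p. if i = 0 then fscale (of_nat p) f else 0)"
    by (intro sum.cong refl) (auto simp: sum_primitive_root[OF \<xi>] T0 dest: dvd_imp_le)
  also have "\<dots> = fscale (of_nat p) f" using p by simp
  finally have "f = fscale (inverse (of_nat p)) (\<Sum>j<p. g j)" using p by (simp add: fk.scale_scale)
  moreover have "g j \<in> {g. (\<forall>i\<ge>r. g i = 0) \<and> (\<exists>j<p. mat_act A r g = fscale (\<zeta> ^ j) g)}" if "j < p" for j
    using eig that by (auto simp: g_def sum_fun_apply fscale_def Ts)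
  ultimately show ?thesis by (metis (no_types, lifting) fk.span_scale fk.span_sum fk.span_base lessThan_iff)
qed

text \<open>A maximal independent set of eigenvectors is a basis. The matrix \<open>S'\<close> has these eigenvectors as columns,
  and the rows of its inverse \<open>S\<close> are eigenvectors for multiplication by \<open>A\<close> on the right.\<close>

lemma finite_order_diagonalizable:
  fixes A :: "'k::field_char_0 mat"
  assumes A: "A \<in> carrier_mat r r" "A ^\<^sub>m p = 1\<^sub>m r" and \<zeta>: "primitive_root \<zeta> p"
  shows "\<exists>e S S'. (\<forall>u. e u < p) \<and> S \<in> carrier_mat r r \<and> S' \<in> carrier_mat r r \<and> S * S' = 1\<^sub>m r \<and> S' * S = 1\<^sub>m r \<and>
    (\<forall>u<r. \<forall>v<r. (S * A) $$ (u, v) = \<zeta> ^ e u * S $$ (u, v))"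
proof -
  have p: "p > 0" using \<zeta> prime_gt_0_nat by (auto simp: primitive_root_def)
  let ?V = "{f :: nat \<Rightarrow> 'k. \<forall>i\<ge>r. f i = 0}"
  let ?Ev = "{g. (\<forall>i\<ge>r. g i = 0) \<and> (\<exists>j<p. mat_act A r g = fscale (\<zeta> ^ j) g)}"
  obtain C where C: "C \<subseteq> ?Ev" "\<not> fk.dependent C" "?Ev \<subseteq> fk.span C"
    using fk.maximal_independent_subset by blast
  have VC: "?V \<subseteq> fk.span C"
  proof
    fix f :: "nat \<Rightarrow> 'k" assume "f \<in> ?V"
    then have "f \<in> fk.span ?Ev" using finite_order_eigenvectors_span[OF A \<zeta>, of f] by simp
    moreover have "fk.span ?Ev \<subseteq> fk.span C" using fk.span_minimal[OF C(3) fk.subspace_span] .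
    ultimately show "f \<in> fk.span C" by (rule rev_subsetD)
  qed
  define E where "E = (\<lambda>k i :: nat. if i = k then 1 else 0 :: 'k)"
  have injE: "inj_on E {..<r}"
  proof (rule inj_onI)
    fix k l assume "E k = E l"
    then have "E k k = E l k" by simp
    then show "k = l" by (simp add: E_def split: if_splits)
  qed
  have comb: "f = (\<Sum>k<r. fscale (f k) (E k))" if "f \<in> ?V" for f
  proof
    fix i
    have "(\<Sum>k<r. fscale (f k) (E k)) i = (\<Sum>k<r. if k = i then f k else 0)"
      unfolding sum_fun_apply by (intro sum.cong refl) (simp add: fscale_def E_def)
    then show "f i = (\<Sum>k<r. fscale (f k) (E k)) i" using that by auto
  qed
  have indE: "\<not> fk.dependent (E ` {..<r})"
  proof (rule fk.independent_if_scalars_zero)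
    fix u x assume u: "(\<Sum>x\<in>E ` {..<r}. fscale (u x) x) = 0" and x: "x \<in> E ` {..<r}"
    obtain k where k: "k < r" "x = E k" using x by auto
    have "(\<Sum>l<r. fscale (u (E l)) (E l)) k = 0"
      using u unfolding sum.reindex[OF injE] by (simp add: o_def)
    moreover have "(\<Sum>l<r. fscale (u (E l)) (E l)) k = (\<Sum>l<r. if l = k then u (E l) else 0)"
      unfolding sum_fun_apply by (intro sum.cong refl) (simp add: fscale_def E_def)
    ultimately show "u x = 0" using k by simp
  qed simp
  have EV: "E ` {..<r} \<subseteq> ?V" by (auto simp: E_def)
  have VE: "?V \<subseteq> fk.span (E ` {..<r})"
  proof
    fix f assume "f \<in> ?V"
    then have "f = (\<Sum>k<r. fscale (f k) (E k))" by (rule comb)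
    also have "\<dots> \<in> fk.span (E ` {..<r})" by (intro fk.span_sum fk.span_scale fk.span_base) auto
    finally show "f \<in> fk.span (E ` {..<r})" .
  qed
  have CV: "C \<subseteq> ?V" using C(1) by blast
  have "card C = fk.dim ?V" by (rule fk.basis_card_eq_dim[OF CV VC C(2)])
  moreover have "card (E ` {..<r}) = fk.dim ?V" by (rule fk.basis_card_eq_dim[OF EV VE indE])
  ultimately have cardC: "card C = r" using card_image[OF injE] by simp
  have finC: "finite C"
    using fk.independent_span_bound[OF _ C(2), of "E ` {..<r}"] CV VE by auto
  obtain c where c: "bij_betw c {..<r} C"
    using ex_bij_betw_nat_finite[OF finC] cardC by (auto simp: atLeast0LessThan)
  have cC: "c u \<in> C" if "u < r" for u using c that by (auto simp: bij_betw_def)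
  have "\<forall>u. \<exists>j. j < p \<and> (u < r \<longrightarrow> mat_act A r (c u) = fscale (\<zeta> ^ j) (c u))"
    using cC C(1) p by blast
  then obtain e where e: "\<And>u. e u < p" "\<And>u. u < r \<Longrightarrow> mat_act A r (c u) = fscale (\<zeta> ^ e u) (c u)" by metis
  have "\<exists>s. E k = (\<Sum>u<r. fscale (s u) (c u))" if k: "k < r" for k
  proof -
    have "E k \<in> fk.span C" using EV VC k by auto
    then obtain t where "E k = (\<Sum>x\<in>C. fscale (t x) x)" unfolding fk.span_finite[OF finC] by auto
    also have "\<dots> = (\<Sum>u<r. fscale (t (c u)) (c u))"
      using sum.reindex_bij_betw[OF c, of "\<lambda>x. fscale (t x) x"] by simp
    finally show ?thesis by (intro exI[of _ "\<lambda>u. t (c u)"])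
  qed
  then obtain s where s: "\<And>k. k < r \<Longrightarrow> E k = (\<Sum>u<r. fscale (s k u) (c u))" by metis
  define S' where "S' = mat r r (\<lambda>(i, u). c u i)"
  define S where "S = mat r r (\<lambda>(u, k). s k u)"
  have carr: "S \<in> carrier_mat r r" "S' \<in> carrier_mat r r" by (auto simp: S_def S'_def)
  have S'S: "S' * S = 1\<^sub>m r"
  proof (rule eq_matI)
    fix i k assume "i < dim_row (1\<^sub>m r :: 'k mat)" "k < dim_col (1\<^sub>m r :: 'k mat)"
    then have ik: "i < r" "k < r" by auto
    have "(S' * S) $$ (i, k) = (\<Sum>u<r. c u i * s k u)"
      unfolding mult_entry[OF carr(2,1) ik] by (intro sum.cong refl) (use ik in \<open>simp add: S_def S'_def\<close>)
    also have "\<dots> = E k i" using s[OF ik(2)] by (simp add: sum_fun_apply fscale_def mult.commute)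
    finally show "(S' * S) $$ (i, k) = 1\<^sub>m r $$ (i, k)" using ik by (simp add: E_def del: index_mult_mat)
  qed (use carr in auto)
  have SS': "S * S' = 1\<^sub>m r" by (rule mat_mult_left_right_inverse[OF carr(2,1) S'S])
  define D where "D = mat r r (\<lambda>(u, v). if u = v then \<zeta> ^ e u else 0)"
  have D: "D \<in> carrier_mat r r" by (simp add: D_def)
  have "A * S' = S' * D"
  proof (rule eq_matI)
    fix i u assume "i < dim_row (S' * D)" "u < dim_col (S' * D)"
    then have iu: "i < r" "u < r" using carr D by auto
    have "(A * S') $$ (i, u) = (\<Sum>k<r. A $$ (i, k) * c u k)"
      unfolding mult_entry[OF A(1) carr(2) iu] by (intro sum.cong refl) (use iu in \<open>simp add: S'_def\<close>)
    also have "\<dots> = mat_act A r (c u) i" using iu by (simp add: mat_act_def)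
    also have "\<dots> = c u i * \<zeta> ^ e u" using e(2)[OF iu(2)] by (simp add: fscale_def mult.commute)
    also have "\<dots> = (\<Sum>k<r. if k = u then c u i * \<zeta> ^ e u else 0)" using iu by simp
    also have "\<dots> = (S' * D) $$ (i, u)"
      unfolding mult_entry[OF carr(2) D iu] by (intro sum.cong refl) (use iu in \<open>simp add: S'_def D_def\<close>)
    finally show "(A * S') $$ (i, u) = (S' * D) $$ (i, u)" .
  qed (use A carr D in auto)
  then have "S * (A * S') * S = S * (S' * D) * S" by simp
  moreover have "S * (A * S') * S = S * A * (S' * S)"
    using A carr by (simp add: assoc_mult_mat[of _ r r _ r _ r])
  moreover have "S * (S' * D) * S = (S * S') * D * S"
    using D carr by (simp add: assoc_mult_mat[of _ r r _ r _ r])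
  ultimately have SA: "S * A = D * S" using S'S SS' A carr D by simp
  have "(S * A) $$ (u, v) = \<zeta> ^ e u * S $$ (u, v)" if "u < r" "v < r" for u v
  proof -
    have "(S * A) $$ (u, v) = (\<Sum>k<r. D $$ (u, k) * S $$ (k, v))" unfolding SA by (rule mult_entry[OF D carr(1) that])
    also have "\<dots> = (\<Sum>k<r. if k = u then \<zeta> ^ e u * S $$ (u, v) else 0)"
      by (intro sum.cong refl) (use that in \<open>simp add: D_def\<close>)
    finally show ?thesis using that by simp
  qed
  then show ?thesis using e(1) carr SS' S'S by blast
qed

section \<open>Linearizing an equivariant free module\<close>

lemma diagonalized_power_entry:
  fixes M :: "'k::field mat"
  assumes M: "M \<in> carrier_mat d d" and S: "S \<in> carrier_mat d d"
    and eig: "\<forall>u<d. \<forall>v<d. (S * M) $$ (u, v) = x u * S $$ (u, v)" and uv: "u < d" "v < d"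
  shows "(S * M ^\<^sub>m j) $$ (u, v) = x u ^ j * S $$ (u, v)"
  using uv
proof (induction j arbitrary: v)
  case 0
  then show ?case using S M by simp
next
  case (Suc j)
  have c: "M ^\<^sub>m j \<in> carrier_mat d d" using M by (rule pow_carrier_mat)
  have Sa: "S * M ^\<^sub>m j \<in> carrier_mat d d" using S c by (rule mult_carrier_mat)
  have "S * M ^\<^sub>m Suc j = (S * M ^\<^sub>m j) * M"
    unfolding pow_mat.simps by (rule assoc_mult_mat[OF S c M, symmetric])
  then have "(S * M ^\<^sub>m Suc j) $$ (u, v) = (\<Sum>k<d. (S * M ^\<^sub>m j) $$ (u, k) * M $$ (k, v))"
    by (simp only: mult_entry[OF Sa M Suc.prems])
  also have "\<dots> = (\<Sum>k<d. x u ^ j * (S $$ (u, k) * M $$ (k, v)))"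
  proof (intro sum.cong refl)
    fix k assume "k \<in> {..<d}"
    then have "(S * M ^\<^sub>m j) $$ (u, k) = x u ^ j * S $$ (u, k)" using Suc.IH[OF Suc.prems(1)] by blast
    then show "(S * M ^\<^sub>m j) $$ (u, k) * M $$ (k, v) = x u ^ j * (S $$ (u, k) * M $$ (k, v))"
      by (simp only: mult.assoc)
  qed
  also have "\<dots> = x u ^ j * (S * M) $$ (u, v)"
    using mult_entry[OF S M Suc.prems] by (simp only: sum_distrib_left)
  also have "\<dots> = x u ^ Suc j * S $$ (u, v)" using eig Suc.prems by simp
  finally show ?case .
qed

text \<open>The determinant has the nonzero constant term \<open>det S\<close>, so it is a unit; the inverse is then given by
  the adjugate.\<close>

lemma invertible_over_mfps:
  fixes P :: "('n::finite, 'k::field) mfps mat"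
  assumes P: "P \<in> carrier_mat r r" and S: "map_mat const_term P = S" "S * S' = 1\<^sub>m r"
    "S' \<in> carrier_mat r r"
  shows "\<exists>Q\<in>carrier_mat r r. P * Q = 1\<^sub>m r \<and> Q * P = 1\<^sub>m r"
proof -
  have Sc: "S \<in> carrier_mat r r" using P S(1) by auto
  have "det S * det S' = 1" using det_mult[OF Sc S(3)] S(2) by simp
  moreover have "const_term (det P) = det S"
    using comm_ring_hom.hom_det[OF const_term_hom, of P] S(1) by simp
  ultimately have "const_term (det P) \<noteq> 0" by auto
  then obtain g where g: "det P * g = 1" using unit_if_const_term_nonzero by blast
  note adj = adj_mat[OF P]
  have "P * (g \<cdot>\<^sub>m adj_mat P) = g \<cdot>\<^sub>m (P * adj_mat P)" by (rule mult_smult_distrib[OF P adj(1)])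
  also have "\<dots> = 1\<^sub>m r" unfolding adj(2) by (rule eq_matI) (auto simp: mult.assoc[symmetric] g mult.commute[of g])
  finally have 1: "P * (g \<cdot>\<^sub>m adj_mat P) = 1\<^sub>m r" .
  have "(g \<cdot>\<^sub>m adj_mat P) * P = g \<cdot>\<^sub>m (adj_mat P * P)" by (rule mult_smult_assoc_mat[OF adj(1) P])
  also have "\<dots> = 1\<^sub>m r" unfolding adj(3) by (rule eq_matI) (auto simp: mult.assoc[symmetric] g mult.commute[of g])
  finally show ?thesis using 1 adj(1) by (intro bexI[of _ "g \<cdot>\<^sub>m adj_mat P"]) auto
qed

lemma pullback_carrier [simp]: "pullback_mat t A \<in> carrier_mat n m \<longleftrightarrow> A \<in> carrier_mat n m"
  by (simp add: pullback_mat_def)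

lemma pullback_mult:
  "A \<in> carrier_mat n m \<Longrightarrow> B \<in> carrier_mat m l \<Longrightarrow> pullback_mat t (A * B) = pullback_mat t A * pullback_mat t B"
  unfolding pullback_mat_def
  by (rule semiring_hom.mat_hom_mult) (unfold_locales, simp_all add: subst_diag_add subst_diag_mult)

lemma pullback_one [simp]: "pullback_mat t (1\<^sub>m r) = 1\<^sub>m r"
  unfolding pullback_mat_def by (rule eq_matI) auto

lemma pullback_entry: "A \<in> carrier_mat n m \<Longrightarrow> i < n \<Longrightarrow> j < m \<Longrightarrow> pullback_mat t A $$ (i, j) = subst_diag t (A $$ (i, j))"
  by (auto simp: pullback_mat_def)

lemma pullback_pullback: "pullback_mat s (pullback_mat t A) = pullback_mat (\<lambda>i. s i * t i) A"
  unfolding pullback_mat_def by (rule eq_matI) (auto simp: subst_diag_compose)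

lemma iterate_carrier: "\<alpha> \<in> carrier_mat r r \<Longrightarrow> iterate_action t \<alpha> r j \<in> carrier_mat r r"
  by (induction j) (auto intro!: mult_carrier_mat[of _ r r])

text \<open>The cocycle relation: the composite of \<open>j + 1\<close> factors can also be built from the other end.\<close>

lemma iterate_shift:
  assumes "\<alpha> \<in> carrier_mat r r"
  shows "pullback_mat t (iterate_action t \<alpha> r j) * \<alpha> = iterate_action t \<alpha> r (Suc j)"
proof (induction j)
  case 0
  have "pullback_mat (\<lambda>i. 1) \<alpha> = \<alpha>"
    unfolding pullback_mat_def by (rule eq_matI) (auto intro!: mfps_eqI simp: mcoeff_subst_diag monomial_value_def)
  then show ?case using assms by simp
next
  case (Suc j)
  let ?I = "iterate_action t \<alpha> r j" and ?p = "\<lambda>j. pullback_mat (\<lambda>i. t i ^ j) \<alpha>"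
  have I: "?I \<in> carrier_mat r r" by (rule iterate_carrier[OF assms])
  have "pullback_mat t (iterate_action t \<alpha> r (Suc j)) * \<alpha> = pullback_mat t (?p j) * pullback_mat t ?I * \<alpha>"
    using assms I by (simp add: pullback_mult[of _ r r _ r])
  also have "pullback_mat t (?p j) = ?p (Suc j)" by (simp add: pullback_pullback)
  also have "?p (Suc j) * pullback_mat t ?I * \<alpha> = ?p (Suc j) * (pullback_mat t ?I * \<alpha>)"
    using assms I by (intro assoc_mult_mat[of _ r r _ r _ r]) auto
  finally show ?case unfolding Suc by simp
qed

lemma const_term_mat_mult:
  "A \<in> carrier_mat n m \<Longrightarrow> B \<in> carrier_mat m l \<Longrightarrow>
    map_mat const_term (A * B) = map_mat const_term A * map_mat (const_term :: ('n, 'k::comm_ring_1) mfps \<Rightarrow> 'k) B"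
  by (rule semiring_hom.mat_hom_mult) (unfold_locales, simp_all)

lemma const_term_pullback [simp]: "map_mat const_term (pullback_mat t A) = map_mat const_term A"
  unfolding pullback_mat_def by (rule eq_matI) auto

lemma const_term_iterate:
  assumes "\<alpha> \<in> carrier_mat r r"
  shows "map_mat const_term (iterate_action t \<alpha> r j) = map_mat const_term \<alpha> ^\<^sub>m j"
proof (induction j)
  case 0
  show ?case using assms by (auto intro!: eq_matI)
next
  case (Suc j)
  have "map_mat const_term (iterate_action t \<alpha> r (Suc j)) = map_mat const_term \<alpha> * map_mat const_term \<alpha> ^\<^sub>m j"
    using const_term_mat_mult[of "pullback_mat (\<lambda>i. t i ^ j) \<alpha>" r r "iterate_action t \<alpha> r j" r] assms iterate_carrier[OF assms]
    by (simp add: Suc)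
  then show ?case using mat_pow_commute[of "map_mat const_term \<alpha>" r j] assms by simp
qed

text \<open>Change of coordinates after which the action is the constant diagonal matrix \<open>D\<close> with entries
  \<open>\<zeta>\<close> to the power \<open>e u\<close>. First \<open>S\<close> diagonalizes the action on the fibre. Then \<open>S\<close> is corrected by averaging: the matrix
  \<open>P = (1/p) \<Sum>\<^sub>j D\<^sup>-\<^sup>j S I\<^sub>j\<close>, where \<open>I\<^sub>j\<close> is the \<open>j\<close>-fold composite of the action, satisfies
  \<open>t\<^sup>*P \<alpha> = D P\<close> by a cyclic shift of the summation index. Its constant term is \<open>S\<close>, so \<open>P\<close> is
  invertible.\<close>

theorem equivariant_module_linearizable:
  fixes \<alpha> :: "('n::finite, 'k::field_char_0) mfps mat"
  assumes \<alpha>: "\<alpha> \<in> carrier_mat r r" "iterate_action t \<alpha> r p = 1\<^sub>m r" and \<zeta>: "primitive_root \<zeta> p"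
  shows "\<exists>e S S' P Q. (\<forall>u. e u < p) \<and> S \<in> carrier_mat r r \<and> S' \<in> carrier_mat r r \<and> S * S' = 1\<^sub>m r \<and> S' * S = 1\<^sub>m r \<and>
    (\<forall>u<r. \<forall>v<r. (S * map_mat const_term \<alpha>) $$ (u, v) = \<zeta> ^ e u * S $$ (u, v)) \<and>
    P \<in> carrier_mat r r \<and> Q \<in> carrier_mat r r \<and> P * Q = 1\<^sub>m r \<and> Q * P = 1\<^sub>m r \<and>
    (\<forall>u<r. \<forall>v<r. (pullback_mat t P * \<alpha>) $$ (u, v) = mconst (\<zeta> ^ e u) * P $$ (u, v))"
proof -
  have p: "p > 0" using \<zeta> prime_gt_0_nat by (auto simp: primitive_root_def)
  let ?\<alpha>0 = "map_mat const_term \<alpha>" and ?I = "iterate_action t \<alpha> r"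
  have \<alpha>0: "?\<alpha>0 \<in> carrier_mat r r" using \<alpha>(1) by simp
  have "map_mat const_term (1\<^sub>m r :: ('n, 'k) mfps mat) = 1\<^sub>m r" by (rule eq_matI) auto
  then have \<alpha>0p: "?\<alpha>0 ^\<^sub>m p = 1\<^sub>m r" using const_term_iterate[OF \<alpha>(1), of t p] \<alpha>(2) by simp
  obtain e S S' where e: "\<And>u. e u < p" and S: "S \<in> carrier_mat r r" "S' \<in> carrier_mat r r"
      "S * S' = 1\<^sub>m r" "S' * S = 1\<^sub>m r"
    and eig: "\<forall>u<r. \<forall>v<r. (S * ?\<alpha>0) $$ (u, v) = \<zeta> ^ e u * S $$ (u, v)"
    using finite_order_diagonalizable[OF \<alpha>0 \<alpha>0p \<zeta>] by blast
  have nz: "\<zeta> \<noteq> 0" using \<zeta> p by (auto simp: primitive_root_def power_0_left split: if_splits)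
  let ?\<xi> = "inverse \<zeta>"
  have \<xi>p: "(?\<xi> ^ k) ^ p = 1" for k
    using \<zeta> by (metis mult.commute power_mult power_one primitive_root_def power_inverse inverse_1)
  define W where "W = (map_mat mconst S :: ('n, 'k) mfps mat)"
  have W: "W \<in> carrier_mat r r" using S by (simp add: W_def)
  have I: "?I j \<in> carrier_mat r r" for j by (rule iterate_carrier[OF \<alpha>(1)])
  have WI: "W * ?I j \<in> carrier_mat r r" for j using W I by simp
  have WI_shift: "pullback_mat t (W * ?I j) * \<alpha> = W * ?I (Suc j)" for j
  proof -
    have "pullback_mat t W = W" unfolding W_def pullback_mat_def by (rule eq_matI) auto
    then have "pullback_mat t (W * ?I j) * \<alpha> = (W * pullback_mat t (?I j)) * \<alpha>"
      using pullback_mult[OF W I] by simp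
    also have "\<dots> = W * (pullback_mat t (?I j) * \<alpha>)"
      using W I \<alpha>(1) by (intro assoc_mult_mat[of _ r r _ r _ r]) auto
    finally show ?thesis unfolding iterate_shift[OF \<alpha>(1)] .
  qed
  \<comment> \<open>The inverse powers of \<open>D\<close> appear as powers of \<open>inverse \<zeta>\<close>.\<close>
  define P where "P = mat r r (\<lambda>(u, v). mconst (inverse (of_nat p)) * (\<Sum>j<p. mconst ((?\<xi> ^ e u) ^ j) * (W * ?I j) $$ (u, v)))"
  have P: "P \<in> carrier_mat r r" by (simp add: P_def)
  have Pe: "P $$ (u, v) = mconst (inverse (of_nat p)) * (\<Sum>j<p. mconst ((?\<xi> ^ e u) ^ j) * (W * ?I j) $$ (u, v))"
    if "u < r" "v < r" for u v using that by (simp add: P_def)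
  have equiv: "(pullback_mat t P * \<alpha>) $$ (u, v) = mconst (\<zeta> ^ e u) * P $$ (u, v)" if uv: "u < r" "v < r" for u v
  proof -
    have "(pullback_mat t P * \<alpha>) $$ (u, v) = (\<Sum>x<r. subst_diag t (P $$ (u, x)) * \<alpha> $$ (x, v))"
      using mult_entry[of "pullback_mat t P" r r \<alpha> r u v] P \<alpha>(1) uv by (simp add: pullback_entry[OF P])
    also have "\<dots> = (\<Sum>x<r. \<Sum>j<p. mconst (inverse (of_nat p)) * (mconst ((?\<xi> ^ e u) ^ j) * (subst_diag t ((W * ?I j) $$ (u, x)) * \<alpha> $$ (x, v))))"
      by (intro sum.cong refl) (use uv in \<open>simp add: Pe subst_diag_mult subst_diag_sum sum_distrib_left sum_distrib_right mult.assoc del: index_mult_mat\<close>)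
    also have "\<dots> = (\<Sum>j<p. \<Sum>x<r. mconst (inverse (of_nat p)) * (mconst ((?\<xi> ^ e u) ^ j) * (subst_diag t ((W * ?I j) $$ (u, x)) * \<alpha> $$ (x, v))))"
      by (rule sum.swap)
    also have "\<dots> = (\<Sum>j<p. mconst (inverse (of_nat p)) * (mconst ((?\<xi> ^ e u) ^ j) * (W * ?I (Suc j)) $$ (u, v)))"
    proof (intro sum.cong refl)
      fix j
      have "(W * ?I (Suc j)) $$ (u, v) = (\<Sum>x<r. subst_diag t ((W * ?I j) $$ (u, x)) * \<alpha> $$ (x, v))"
        unfolding WI_shift[symmetric]
        using mult_entry[of "pullback_mat t (W * ?I j)" r r \<alpha> r u v] WI[of j] \<alpha>(1) uv
        by (simp add: pullback_entry[OF WI[of j]] del: index_mult_mat)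
      then show "(\<Sum>x<r. mconst (inverse (of_nat p)) * (mconst ((?\<xi> ^ e u) ^ j) * (subst_diag t ((W * ?I j) $$ (u, x)) * \<alpha> $$ (x, v))))
        = mconst (inverse (of_nat p)) * (mconst ((?\<xi> ^ e u) ^ j) * (W * ?I (Suc j)) $$ (u, v))"
        by (simp only: sum_distrib_left)
    qed
    also have "\<dots> = mconst (\<zeta> ^ e u) * (mconst (inverse (of_nat p)) * (\<Sum>j<p. mconst ((?\<xi> ^ e u) ^ Suc j) * (W * ?I (Suc j)) $$ (u, v)))"
      unfolding sum_distrib_left
    proof (intro sum.cong refl)
      fix j
      have "(?\<xi> ^ e u) ^ j = \<zeta> ^ e u * (?\<xi> ^ e u) ^ Suc j"
        using nz by (simp add: mult.assoc[symmetric] power_mult_distrib[symmetric])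
      then have "mconst ((?\<xi> ^ e u) ^ j) = mconst (\<zeta> ^ e u) * (mconst ((?\<xi> ^ e u) ^ Suc j) :: ('n, 'k) mfps)"
        by (simp only: mconst_mult)
      then show "mconst (inverse (of_nat p)) * (mconst ((?\<xi> ^ e u) ^ j) * (W * ?I (Suc j)) $$ (u, v))
        = mconst (\<zeta> ^ e u) * (mconst (inverse (of_nat p)) * (mconst ((?\<xi> ^ e u) ^ Suc j) * (W * ?I (Suc j)) $$ (u, v)))"
        by (simp only: mult_ac)
    qed
    also have "(\<Sum>j<p. mconst ((?\<xi> ^ e u) ^ Suc j) * (W * ?I (Suc j)) $$ (u, v)) = (\<Sum>j<p. mconst ((?\<xi> ^ e u) ^ j) * (W * ?I j) $$ (u, v))"
      by (rule sum_cyclic_shift[where h = "\<lambda>j. mconst ((?\<xi> ^ e u) ^ j) * (W * ?I j) $$ (u, v)"]) (simp add: \<xi>p \<alpha>(2))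
    finally show ?thesis using Pe[OF uv] by simp
  qed
  have "map_mat const_term P = S"
  proof (rule eq_matI)
    fix u v assume "u < dim_row S" "v < dim_col S"
    then have uv: "u < r" "v < r" using S by auto
    have "map_mat const_term W = S" unfolding W_def by (rule eq_matI) auto
    then have WIc: "map_mat const_term (W * ?I j) = S * ?\<alpha>0 ^\<^sub>m j" for j
      using const_term_mat_mult[OF W I] const_term_iterate[OF \<alpha>(1)] by simp
    have "const_term ((W * ?I j) $$ (u, v)) = (\<zeta> ^ e u) ^ j * S $$ (u, v)" for j
      using diagonalized_power_entry[OF \<alpha>0 S(1) eig uv, of j] unfolding WIc[symmetric] using WI[of j] uv by (simp del: index_mult_mat)
    then have "const_term (P $$ (u, v)) = inverse (of_nat p) * (\<Sum>j<p. (?\<xi> ^ e u) ^ j * ((\<zeta> ^ e u) ^ j * S $$ (u, v)))"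
      using uv by (simp add: Pe del: index_mult_mat)
    also have "(\<Sum>j<p. (?\<xi> ^ e u) ^ j * ((\<zeta> ^ e u) ^ j * S $$ (u, v))) = (\<Sum>j<p. S $$ (u, v))"
      using nz by (intro sum.cong refl) (simp add: mult.assoc[symmetric] power_mult_distrib[symmetric])
    finally show "map_mat const_term P $$ (u, v) = S $$ (u, v)" using p uv P by (simp add: mult.assoc[symmetric])
  qed (use P S in auto)
  then obtain Q where Q: "Q \<in> carrier_mat r r" "P * Q = 1\<^sub>m r" "Q * P = 1\<^sub>m r"
    using invertible_over_mfps[OF P _ S(3,2)] by blast
  show ?thesis
    by (rule exI[of _ e], rule exI[of _ S], rule exI[of _ S'], rule exI[of _ P], rule exI[of _ Q])
      (intro conjI allI impI, (simp only: e S eig[rule_format] P equiv Q)+)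
qed

section \<open>Equivariant matrix factorizations\<close>

text \<open>Any of the \<open>t\<^sub>i\<close> serves as primitive root, as it is different from \<open>1\<close>; its powers exhaust the roots of
  \<open>x\<^sup>p - 1\<close> in the field.\<close>

lemma exists_weights:
  fixes t :: "'n::finite \<Rightarrow> 'k::field_char_0"
  assumes "prime p" "torus_order t p" "\<forall>i. t i \<noteq> 1"
  shows "\<exists>\<zeta> c. primitive_root \<zeta> p \<and> (\<forall>i. t i = \<zeta> ^ c i) \<and> (\<forall>i. \<not> p dvd c i)"
proof -
  have p: "p > 0" using assms(1) prime_gt_0_nat by blast
  have tp: "t i ^ p = 1" for i using assms(2) by (simp add: torus_order_def)
  obtain i0 :: 'n where True by blast
  define \<zeta> where "\<zeta> = t i0"
  have \<zeta>: "primitive_root \<zeta> p" using assms(1,3) tp by (simp add: \<zeta>_def primitive_root_def)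
  let ?q = "monom 1 p - 1 :: 'k poly"
  have q: "coeff ?q p = 1" using p by simp
  then have q0: "?q \<noteq> 0" by (metis coeff_0 zero_neq_one)
  have roots: "{x. poly ?q x = 0} = {x. x ^ p = 1}" by (auto simp: poly_monom)
  have "degree ?q \<le> p" by (rule degree_le) (auto simp: coeff_eq_0)
  then have card: "card {x :: 'k. x ^ p = 1} \<le> p"
    using card_poly_roots_bound[OF q0] roots by simp
  have fin: "finite {x :: 'k. x ^ p = 1}" using poly_roots_finite[OF q0] roots by simp
  have inj: "inj_on (\<lambda>j. \<zeta> ^ j) {..<p}"
    by (rule inj_onI) (simp add: primitive_root_eq_iff[OF \<zeta>])
  have sub: "(\<lambda>j. \<zeta> ^ j) ` {..<p} \<subseteq> {x. x ^ p = 1}"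
    using \<zeta> by (auto simp: primitive_root_def power_mult[symmetric] mult.commute[of _ p]) (simp add: power_mult)
  have "(\<lambda>j. \<zeta> ^ j) ` {..<p} = {x. x ^ p = 1}"
    by (rule card_seteq[OF fin sub]) (simp add: card_image[OF inj] card)
  then have "\<forall>i. \<exists>j. t i = \<zeta> ^ j" using tp by (metis (mono_tags, lifting) imageE mem_Collect_eq)
  then obtain c where c: "\<And>i. t i = \<zeta> ^ c i" by metis
  have "\<not> p dvd c i" for i using primitive_root_eq_1_iff[OF \<zeta>, of "c i"] c assms(3) by metis
  then show ?thesis using \<zeta> c by blast
qed

lemma monomial_value_weight:
  assumes "\<And>i. t i = \<zeta> ^ c i" shows "monomial_value t a = \<zeta> ^ weight c a"
  by (simp add: monomial_value_def weight_def assms power_mult power_sum)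

lemma w_nonzero:
  fixes w :: "('n::finite, 'k::field) mfps"
  assumes "finite_dim_quotient (jacobian_ideal w)" shows "w \<noteq> 0"
proof
  assume w: "w = 0"
  obtain L where L: "\<And>i N. N \<ge> L \<Longrightarrow> var_power i N \<in> jacobian_ideal w"
    using exists_large_var_power[OF assms] by blast
  obtain i :: 'n where True by blast
  have "var_power i L = (0 :: ('n, 'k) mfps)" using L[of L i] w by (auto simp: jacobian_ideal_def)
  then have "mcoeff (var_power i L :: ('n, 'k) mfps) (Poly_Mapping.single i L) = 0" by simp
  then show False by (simp add: var_power.rep_eq)
qed

text \<open>The two products of the differentials have the same trace.\<close>

lemma ranks_equal:
  fixes w :: "('n::finite, 'k::field_char_0) mfps"
  assumes A: "matrix_factorization w A" and w: "w \<noteq> 0"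
  shows "even_rank A = odd_rank A"
proof -
  let ?r = "even_rank A" and ?s = "odd_rank A"
  have c: "d_even A \<in> carrier_mat ?s ?r" "d_odd A \<in> carrier_mat ?r ?s"
    and e: "d_odd A * d_even A = w \<cdot>\<^sub>m 1\<^sub>m ?r" and o: "d_even A * d_odd A = w \<cdot>\<^sub>m 1\<^sub>m ?s"
    using A by (auto simp: matrix_factorization_def)
  have "(\<Sum>u<?r. w) = (\<Sum>u<?r. (d_odd A * d_even A) $$ (u, u))" unfolding e by (intro sum.cong refl) simp
  also have "\<dots> = (\<Sum>u<?r. \<Sum>v<?s. d_odd A $$ (u, v) * d_even A $$ (v, u))"
    by (intro sum.cong refl) (rule mult_entry[OF c(2,1)], auto)
  also have "\<dots> = (\<Sum>v<?s. \<Sum>u<?r. d_odd A $$ (u, v) * d_even A $$ (v, u))" by (rule sum.swap)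
  also have "\<dots> = (\<Sum>v<?s. (d_even A * d_odd A) $$ (v, v))"
    by (intro sum.cong refl, subst mult_entry[OF c]) (auto simp: mult.commute)
  also have "\<dots> = (\<Sum>v<?s. w)" unfolding o by (intro sum.cong refl) simp
  finally have eq: "(\<Sum>u<?r. w) = (\<Sum>v<?s. w)" .
  obtain a where a: "mcoeff w a \<noteq> 0" using w mfps_eqI[of w 0] by auto
  have "mcoeff (\<Sum>u<?r. w) a = mcoeff (\<Sum>v<?s. w) a" using eq by (rule arg_cong)
  then have "of_nat ?r * mcoeff w a = of_nat ?s * mcoeff w a" unfolding mcoeff_sum by simp
  then show ?thesis using a by simp
qed

lemma conjugate_equivariant:
  assumes c: "d \<in> carrier_mat s r" "\<alpha>0 \<in> carrier_mat r r" "\<alpha>1 \<in> carrier_mat s s"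
    and P0: "P0 \<in> carrier_mat r r" "Q0 \<in> carrier_mat r r" "P0 * Q0 = 1\<^sub>m r" "Q0 * P0 = 1\<^sub>m r"
    and P1: "P1 \<in> carrier_mat s s"
    and D: "D0 \<in> carrier_mat r r" "D1 \<in> carrier_mat s s"
    and eq0: "pullback_mat t P0 * \<alpha>0 = D0 * P0" and eq1: "pullback_mat t P1 * \<alpha>1 = D1 * P1"
    and eqd: "pullback_mat t d * \<alpha>0 = \<alpha>1 * d"
  shows "pullback_mat t (P1 * d * Q0) * D0 = D1 * (P1 * d * Q0)"
proof -
  let ?t = "pullback_mat t"
  have tc: "?t d \<in> carrier_mat s r" "?t P0 \<in> carrier_mat r r" "?t Q0 \<in> carrier_mat r r" "?t P1 \<in> carrier_mat s s"
    using c P0 P1 by auto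
  have "?t Q0 * ?t P0 = 1\<^sub>m r" using pullback_mult[OF P0(2,1), of t] P0(4) by simp
  then have "\<alpha>0 * Q0 = (?t Q0 * ?t P0) * (\<alpha>0 * Q0)" using c P0 by simp
  also have "\<dots> = ?t Q0 * (?t P0 * \<alpha>0 * Q0)"
    using c P0 tc by (simp add: assoc_mult_mat[of _ r r _ r _ r])
  also have "?t P0 * \<alpha>0 * Q0 = D0 * (P0 * Q0)" unfolding eq0 using D P0 by (simp add: assoc_mult_mat[of _ r r _ r _ r])
  finally have Q: "?t Q0 * D0 = \<alpha>0 * Q0" using P0 D by simp
  have "?t (P1 * d * Q0) * D0 = ?t (P1 * d) * ?t Q0 * D0"
    using pullback_mult[of "P1 * d" s r Q0 r t] P1 c P0 by simp
  also have "\<dots> = ?t (P1 * d) * (?t Q0 * D0)"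
    using P1 c P0 D by (intro assoc_mult_mat[of _ s r _ r _ r]) auto
  also have "\<dots> = (?t P1 * ?t d) * (\<alpha>0 * Q0)" unfolding Q using pullback_mult[OF P1 c(1), of t] by simp
  also have "\<dots> = ((?t P1 * ?t d) * \<alpha>0) * Q0"
    using tc c P0 by (intro assoc_mult_mat[of _ s r _ r _ r, symmetric]) auto
  also have "(?t P1 * ?t d) * \<alpha>0 = ?t P1 * (\<alpha>1 * d)"
    unfolding eqd[symmetric] using tc c by (intro assoc_mult_mat[of _ s s _ r _ r]) auto
  also have "\<dots> = (?t P1 * \<alpha>1) * d"
    using tc c by (intro assoc_mult_mat[of _ s s _ s _ r, symmetric]) auto
  also have "\<dots> = D1 * (P1 * d)" unfolding eq1 using D P1 c by (intro assoc_mult_mat[of _ s s _ s _ r]) auto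
  also have "D1 * (P1 * d) * Q0 = D1 * (P1 * d * Q0)"
    using D P1 c P0 by (intro assoc_mult_mat[of _ s s _ r _ r]) auto
  finally show ?thesis .
qed

lemma conjugate_square:
  assumes c: "d \<in> carrier_mat s r" "d' \<in> carrier_mat r s"
    and P0: "P0 \<in> carrier_mat r r" "Q0 \<in> carrier_mat r r" "P0 * Q0 = 1\<^sub>m r"
    and P1: "P1 \<in> carrier_mat s s" "Q1 \<in> carrier_mat s s" "Q1 * P1 = 1\<^sub>m s"
    and sq: "d' * d = (w :: 'a::comm_ring_1) \<cdot>\<^sub>m 1\<^sub>m r"
  shows "(P0 * d' * Q1) * (P1 * d * Q0) = w \<cdot>\<^sub>m 1\<^sub>m r"
proof -
  have "(P0 * d' * Q1) * (P1 * d * Q0) = (P0 * d') * (Q1 * (P1 * d * Q0))"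
    using c P0 P1 by (intro assoc_mult_mat[of _ r s _ s _ r]) auto
  also have "Q1 * (P1 * d * Q0) = (Q1 * P1) * (d * Q0)"
  proof -
    have "P1 * d * Q0 = P1 * (d * Q0)" using c P0 P1 by (intro assoc_mult_mat[of _ s s _ r _ r]) auto
    moreover have "(Q1 * P1) * (d * Q0) = Q1 * (P1 * (d * Q0))"
      using c P0 P1 by (intro assoc_mult_mat[of _ s s _ s _ r]) auto
    ultimately show ?thesis by (simp only:)
  qed
  also have "\<dots> = d * Q0" unfolding P1(3) using c P0 by simp
  also have "(P0 * d') * (d * Q0) = P0 * (d' * (d * Q0))"
    using c P0 by (intro assoc_mult_mat[of _ r r _ s _ r]) auto
  also have "d' * (d * Q0) = (d' * d) * Q0" using c P0 by (intro assoc_mult_mat[of _ r s _ r _ r, symmetric]) auto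
  also have "\<dots> = w \<cdot>\<^sub>m Q0" unfolding sq using P0 by (simp add: mult_smult_assoc_mat[of "1\<^sub>m r" r r Q0 r])
  also have "P0 * (w \<cdot>\<^sub>m Q0) = w \<cdot>\<^sub>m (P0 * Q0)" by (rule mult_smult_distrib[OF P0(1,2)])
  finally show ?thesis using P0 by simp
qed

lemma scaled_rows:
  assumes "M \<in> carrier_mat r r" "P \<in> carrier_mat r r" "\<forall>u<r. \<forall>v<r. M $$ (u, v) = x u * P $$ (u, v)"
  shows "M = mat r r (\<lambda>(u, v). if u = v then x u else 0) * P"
proof (rule eq_matI)
  let ?D = "mat r r (\<lambda>(u, v). if u = v then x u else 0)"
  have D: "?D \<in> carrier_mat r r" by simp
  fix u v assume "u < dim_row (?D * P)" "v < dim_col (?D * P)"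
  then have uv: "u < r" "v < r" using assms by auto
  have "(?D * P) $$ (u, v) = (\<Sum>k<r. if k = u then x u * P $$ (u, v) else 0)"
    unfolding mult_entry[OF D assms(2) uv] by (intro sum.cong refl) (use uv in auto)
  then show "M $$ (u, v) = (?D * P) $$ (u, v)" using assms(3) uv by simp
qed (use assms in auto)

text \<open>The substitution multiplies the coefficient at \<open>x\<^sup>a\<close> by \<open>\<zeta>\<close> to the power \<open>weight c a\<close>. Comparing
  coefficients in the equivariance relation for diagonal actions gives the weight of each entry.\<close>

lemma homogeneous_entries:
  fixes d :: "('n::finite, 'k::field) mfps mat"
  assumes \<zeta>: "primitive_root \<zeta> p" and t: "\<And>i. t i = \<zeta> ^ c i" and d: "d \<in> carrier_mat s r"
    and eq: "pullback_mat t d * mat r r (\<lambda>(u, v). if u = v then mconst (\<zeta> ^ e0 u) else 0)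
      = mat s s (\<lambda>(u, v). if u = v then mconst (\<zeta> ^ e1 u) else 0) * d"
    and uv: "u < s" "v < r" and a: "mcoeff (d $$ (u, v)) a \<noteq> 0"
  shows "(weight c a + e0 v) mod p = e1 u mod p"
proof -
  let ?D0 = "mat r r (\<lambda>(u, v). if u = v then mconst (\<zeta> ^ e0 u) else 0) :: ('n, 'k) mfps mat"
  let ?D1 = "mat s s (\<lambda>(u, v). if u = v then mconst (\<zeta> ^ e1 u) else 0) :: ('n, 'k) mfps mat"
  have D: "?D0 \<in> carrier_mat r r" "?D1 \<in> carrier_mat s s" by auto
  have td: "pullback_mat t d \<in> carrier_mat s r" using d by simp
  have "(pullback_mat t d * ?D0) $$ (u, v) = (\<Sum>k<r. if k = v then subst_diag t (d $$ (u, v)) * mconst (\<zeta> ^ e0 v) else 0)"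
    unfolding mult_entry[OF td D(1) uv] by (intro sum.cong refl) (use uv in \<open>auto simp: pullback_entry[OF d]\<close>)
  moreover have "(?D1 * d) $$ (u, v) = (\<Sum>k<s. if k = u then mconst (\<zeta> ^ e1 u) * d $$ (u, v) else 0)"
    unfolding mult_entry[OF D(2) d uv] by (intro sum.cong refl) (use uv in auto)
  ultimately have "mconst (\<zeta> ^ e0 v) * subst_diag t (d $$ (u, v)) = mconst (\<zeta> ^ e1 u) * d $$ (u, v)"
    using uv eq by (simp add: mult.commute)
  then have "mcoeff (mconst (\<zeta> ^ e0 v) * subst_diag t (d $$ (u, v))) a = mcoeff (mconst (\<zeta> ^ e1 u) * d $$ (u, v)) a" by simp
  then have "\<zeta> ^ e0 v * (\<zeta> ^ weight c a * mcoeff (d $$ (u, v)) a) = \<zeta> ^ e1 u * mcoeff (d $$ (u, v)) a"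
    by (simp only: mcoeff_mconst_mult mcoeff_subst_diag monomial_value_weight[of t, OF t])
  then have "\<zeta> ^ (weight c a + e0 v) = \<zeta> ^ e1 u" using a by (simp add: power_add mult_ac)
  then show ?thesis using primitive_root_eq_iff[OF \<zeta>] by blast
qed

lemma ceiling_half: "\<lceil>real n / 2\<rceil> = int ((n + 1) div 2)"
proof -
  have "real n = 2 * real (n div 2) + real (n mod 2)" by (metis of_nat_add of_nat_mult of_nat_numeral mult_div_mod_eq)
  moreover have "n mod 2 < 2" by simp
  ultimately show ?thesis by (cases "n mod 2 = 0") (auto intro!: ceiling_unique simp: field_simps; presburger)+
qed

text \<open>In the coordinates given by \<open>P0\<close> and \<open>P1\<close> the factorization is homogeneous, so that the Lefschetz formula
  and the arithmetic of \<open>divisible_by_prime_power\<close> apply to it.\<close>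

theorem equivariant_supertrace:
  fixes w :: "('n::finite, 'k::field_char_0) mfps"
  assumes w: "isolated_singularity w" and p: "prime p"
    and \<zeta>: "primitive_root \<zeta> p" and t: "\<And>i. t i = \<zeta> ^ c i" and c: "\<And>i. \<not> p dvd c i"
    and A: "matrix_factorization w A"
    and P0: "P0 \<in> carrier_mat (even_rank A) (even_rank A)" "Q0 \<in> carrier_mat (even_rank A) (even_rank A)"
      "P0 * Q0 = 1\<^sub>m (even_rank A)" "Q0 * P0 = 1\<^sub>m (even_rank A)"
    and P1: "P1 \<in> carrier_mat (odd_rank A) (odd_rank A)" "Q1 \<in> carrier_mat (odd_rank A) (odd_rank A)"
      "P1 * Q1 = 1\<^sub>m (odd_rank A)" "Q1 * P1 = 1\<^sub>m (odd_rank A)"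
    and c0: "\<alpha>0 \<in> carrier_mat (even_rank A) (even_rank A)" and c1: "\<alpha>1 \<in> carrier_mat (odd_rank A) (odd_rank A)"
    and lin0: "\<forall>u<even_rank A. \<forall>v<even_rank A. (pullback_mat t P0 * \<alpha>0) $$ (u, v) = mconst (\<zeta> ^ e0 u) * P0 $$ (u, v)"
    and lin1: "\<forall>u<odd_rank A. \<forall>v<odd_rank A. (pullback_mat t P1 * \<alpha>1) $$ (u, v) = mconst (\<zeta> ^ e1 u) * P1 $$ (u, v)"
    and eq_even: "pullback_mat t (d_even A) * \<alpha>0 = \<alpha>1 * d_even A"
    and eq_odd: "pullback_mat t (d_odd A) * \<alpha>1 = \<alpha>0 * d_odd A"
    and bound: "m * (p - 1) + 1 \<le> (CARD('n) + 1) div 2"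
  shows "\<exists>G. Xp ^ p - 1 dvd ((\<Sum>u<even_rank A. Xp ^ e0 u) - (\<Sum>u<odd_rank A. Xp ^ e1 u)) - of_nat (p ^ m) * G"
proof -
  define r where "r = even_rank A"
  define s where "s = odd_rank A"
  note rs = r_def[symmetric] s_def[symmetric]
  have mf: "d_even A \<in> carrier_mat s r" "d_odd A \<in> carrier_mat r s"
    "d_odd A * d_even A = w \<cdot>\<^sub>m 1\<^sub>m r" "d_even A * d_odd A = w \<cdot>\<^sub>m 1\<^sub>m s"
    using A by (auto simp: matrix_factorization_def r_def s_def)
  note P0 = P0[unfolded rs] and P1 = P1[unfolded rs] and c0 = c0[unfolded rs] and c1 = c1[unfolded rs]
  let ?D0 = "mat r r (\<lambda>(u, v). if u = v then mconst (\<zeta> ^ e0 u) else 0) :: ('n, 'k) mfps mat"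
  let ?D1 = "mat s s (\<lambda>(u, v). if u = v then mconst (\<zeta> ^ e1 u) else 0) :: ('n, 'k) mfps mat"
  have D: "?D0 \<in> carrier_mat r r" "?D1 \<in> carrier_mat s s" by auto
  have "pullback_mat t P0 * \<alpha>0 \<in> carrier_mat r r" using P0 c0 by (intro mult_carrier_mat[of _ r r]) auto
  then have eq0: "pullback_mat t P0 * \<alpha>0 = ?D0 * P0" using P0(1) lin0[unfolded rs] by (rule scaled_rows)
  have "pullback_mat t P1 * \<alpha>1 \<in> carrier_mat s s" using P1 c1 by (intro mult_carrier_mat[of _ s s]) auto
  then have eq1: "pullback_mat t P1 * \<alpha>1 = ?D1 * P1" using P1(1) lin1[unfolded rs] by (rule scaled_rows)
  define a where "a = P1 * d_even A * Q0"
  define b where "b = P0 * d_odd A * Q1"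
  have ab: "a \<in> carrier_mat s r" "b \<in> carrier_mat r s"
    using mf P0 P1 by (auto simp: a_def b_def intro!: mult_carrier_mat)
  have ba: "b * a = w \<cdot>\<^sub>m 1\<^sub>m r"
    unfolding a_def b_def by (rule conjugate_square[OF mf(1,2) P0(1,2,3) P1(1,2,4) mf(3)])
  have ab': "a * b = w \<cdot>\<^sub>m 1\<^sub>m s"
    unfolding a_def b_def by (rule conjugate_square[OF mf(2,1) P1(1,2,3) P0(1,2,4) mf(4)])
  have eqa: "pullback_mat t a * ?D0 = ?D1 * a"
    unfolding a_def by (rule conjugate_equivariant[OF mf(1) c0 c1 P0 P1(1) D eq0 eq1 eq_even])
  have eqb: "pullback_mat t b * ?D1 = ?D0 * b"
    unfolding b_def by (rule conjugate_equivariant[OF mf(2) c1 c0 P1 P0(1) D(2,1) eq1 eq0 eq_odd])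
  define e where "e = (\<lambda>u. if u < r then e0 u else e1 (u - r))"
  define \<delta> where "\<delta> = (\<lambda>u v. if u < r \<and> \<not> v < r then b $$ (u, v - r) else if \<not> u < r \<and> v < r then a $$ (u - r, v) else 0)"
  interpret H: homogeneous_factorization "{..<r + s}" "\<lambda>u. u < r" e c p w \<delta>
  proof
    show "finite {..<r + s}" by simp
    show "prime p" "\<not> p dvd c i" for i by (rule p, rule c)
    show "(u < r) \<noteq> (v < r)" if "\<delta> u v \<noteq> 0" for u v using that by (auto simp: \<delta>_def split: if_splits)
    show "(\<Sum>x<r + s. \<delta> u x * \<delta> x v) = (if u = v then w else 0)" if uv: "u \<in> {..<r + s}" "v \<in> {..<r + s}" for u v
    proof -
      have split: "(\<Sum>x<r + s. \<delta> u x * \<delta> x v) = (\<Sum>x<r. \<delta> u x * \<delta> x v) + (\<Sum>y<s. \<delta> u (r + y) * \<delta> (r + y) v)"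
        by (rule sum_lessThan_add)
      show ?thesis
      proof (cases "u < r"; cases "v < r")
        assume u: "u < r" "v < r"
        have "(\<Sum>x<r. \<delta> u x * \<delta> x v) = 0" using u by (intro sum.neutral) (auto simp: \<delta>_def)
        moreover have "(\<Sum>y<s. \<delta> u (r + y) * \<delta> (r + y) v) = (b * a) $$ (u, v)"
          unfolding mult_entry[OF ab(2,1) u] by (intro sum.cong refl) (use u in \<open>simp add: \<delta>_def\<close>)
        ultimately show ?thesis unfolding split ba using u by simp
      next
        assume u: "u < r" "\<not> v < r"
        then show ?thesis unfolding split by (auto simp: \<delta>_def intro!: sum.neutral)
      next
        assume u: "\<not> u < r" "v < r"
        then show ?thesis unfolding split by (auto simp: \<delta>_def intro!: sum.neutral)
      next
        assume u: "\<not> u < r" "\<not> v < r"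
        then have u': "u - r < s" "v - r < s" using uv by auto
        have "(\<Sum>y<s. \<delta> u (r + y) * \<delta> (r + y) v) = 0" using u by (intro sum.neutral) (auto simp: \<delta>_def)
        moreover have "(\<Sum>x<r. \<delta> u x * \<delta> x v) = (a * b) $$ (u - r, v - r)"
          unfolding mult_entry[OF ab u'] by (intro sum.cong refl) (use u in \<open>simp add: \<delta>_def\<close>)
        ultimately show ?thesis unfolding split ab' using u u' by auto
      qed
    qed
    show "(weight c x + e v) mod p = e u mod p"
      if uv: "u \<in> {..<r + s}" "v \<in> {..<r + s}" and x: "mcoeff (\<delta> u v) x \<noteq> 0" for u v x
    proof (cases "u < r")
      case True
      then have v: "\<not> v < r" using x by (auto simp: \<delta>_def)
      then have "mcoeff (b $$ (u, v - r)) x \<noteq> 0" "v - r < s" using x True uv by (auto simp: \<delta>_def)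
      then show ?thesis using homogeneous_entries[OF \<zeta> t ab(2) eqb True] True v by (simp add: e_def)
    next
      case False
      then have v: "v < r" using x by (auto simp: \<delta>_def split: if_splits)
      then have "mcoeff (a $$ (u - r, v)) x \<noteq> 0" "u - r < s" using x False uv by (auto simp: \<delta>_def)
      then show ?thesis using homogeneous_entries[OF \<zeta> t ab(1) eqa _ v] False v by (simp add: e_def)
    qed
  qed
  have fin: "finite_dim_quotient (jacobian_ideal w)" using w by (simp add: isolated_singularity_def)
  obtain H where H: "cyc p dvd H.F * pcompose H.F (Xp ^ (p - 1)) - H * (\<Prod>i\<in>UNIV. 1 - Xp ^ c i)"
    using H.supertrace_norm_divisible[OF fin] by blast
  have F: "H.F = (\<Sum>u<r. Xp ^ e0 u) - (\<Sum>u<s. Xp ^ e1 u)"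
    unfolding H.F_def sum_lessThan_add by (simp add: sgn_of_def e_def sum_negf)
  have "r = s" using ranks_equal[OF A w_nonzero[OF fin]] by (simp add: r_def s_def)
  then have "poly H.F 1 = 0" unfolding F by (simp add: poly_sum)
  from divisible_by_prime_power[OF p this H bound, unfolded F] show ?thesis unfolding r_def s_def .
qed

section \<open>The representation ring of a cyclic group of prime order\<close>

definition character :: "('g, 'k::field) rep \<Rightarrow> 'g \<Rightarrow> 'k" where
  "character V g = (\<Sum>i<fst V. snd V g $$ (i, i))"

lemma trace_commute:
  fixes A B :: "'k::comm_ring_1 mat"
  assumes "A \<in> carrier_mat n m" "B \<in> carrier_mat m n"
  shows "(\<Sum>i<n. (A * B) $$ (i, i)) = (\<Sum>i<m. (B * A) $$ (i, i))"
proof -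
  have "(\<Sum>i<n. (A * B) $$ (i, i)) = (\<Sum>i<n. \<Sum>k<m. A $$ (i, k) * B $$ (k, i))"
    by (intro sum.cong refl) (rule mult_entry[OF assms], auto)
  also have "\<dots> = (\<Sum>k<m. \<Sum>i<n. A $$ (i, k) * B $$ (k, i))" by (rule sum.swap)
  also have "\<dots> = (\<Sum>k<m. (B * A) $$ (k, k))"
    by (intro sum.cong refl, subst mult_entry[OF assms(2,1)]) (auto simp: mult.commute)
  finally show ?thesis .
qed

lemma repsD:
  assumes "V \<in> reps G"
  shows "g \<in> carrier G \<Longrightarrow> snd V g \<in> carrier_mat (fst V) (fst V)" "snd V \<one>\<^bsub>G\<^esub> = 1\<^sub>m (fst V)"
    "g \<in> carrier G \<Longrightarrow> h \<in> carrier G \<Longrightarrow> snd V (g \<otimes>\<^bsub>G\<^esub> h) = snd V g * snd V h"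
  using assms by (auto simp: reps_def)

lemma character_iso:
  assumes V: "V \<in> reps G" and W: "W \<in> reps G" and iso: "rep_iso G V W" and g: "g \<in> carrier G"
  shows "character V g = character W g"
proof -
  obtain P Q where P: "P \<in> carrier_mat (fst W) (fst V)" "Q \<in> carrier_mat (fst V) (fst W)"
    "P * Q = 1\<^sub>m (fst W)" "Q * P = 1\<^sub>m (fst V)" "P * snd V g = snd W g * P"
    using iso g unfolding rep_iso_def by blast
  note c = repsD(1)[OF V g] repsD(1)[OF W g]
  have "snd W g = snd W g * P * Q"
    using P c by (simp add: assoc_mult_mat[of "snd W g" "fst W" "fst W" P "fst V" Q "fst W"])
  then have "character W g = (\<Sum>i<fst W. (snd W g * P * Q) $$ (i, i))" by (simp only: character_def)
  also have "\<dots> = (\<Sum>i<fst V. (Q * (snd W g * P)) $$ (i, i))"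
    using P c by (intro trace_commute) auto
  also have "Q * (snd W g * P) = snd V g"
    unfolding P(5)[symmetric] assoc_mult_mat[OF P(2,1) c(1), symmetric] P(4) by (rule left_mult_one_mat[OF c(1)])
  finally show ?thesis by (simp only: character_def)
qed

lemma character_sum:
  assumes V: "V \<in> reps G" and W: "W \<in> reps G" and g: "g \<in> carrier G"
  shows "character (V \<oplus>\<^sub>r W) g = character V g + character W g"
  using repsD(1)[OF V g] repsD(1)[OF W g]
  by (simp add: character_def rep_sum_def sum_lessThan_add)

lemma reps_sum:
  assumes G: "group G" and V: "V \<in> reps G" and W: "W \<in> reps G" shows "V \<oplus>\<^sub>r W \<in> reps G"
proof -
  have "snd (V \<oplus>\<^sub>r W) (g \<otimes>\<^bsub>G\<^esub> h) = snd (V \<oplus>\<^sub>r W) g * snd (V \<oplus>\<^sub>r W) h" if g: "g \<in> carrier G" "h \<in> carrier G" for g h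
  proof -
    note c = repsD(1)[OF V g(1)] repsD(1)[OF V g(2)] repsD(1)[OF W g(1)] repsD(1)[OF W g(2)]
    have "snd (V \<oplus>\<^sub>r W) g * snd (V \<oplus>\<^sub>r W) h = four_block_mat (snd V g * snd V h + 0\<^sub>m (fst V) (fst W) * 0\<^sub>m (fst W) (fst V))
        (snd V g * 0\<^sub>m (fst V) (fst W) + 0\<^sub>m (fst V) (fst W) * snd W h)
        (0\<^sub>m (fst W) (fst V) * snd V h + snd W g * 0\<^sub>m (fst W) (fst V))
        (0\<^sub>m (fst W) (fst V) * 0\<^sub>m (fst V) (fst W) + snd W g * snd W h)"
      unfolding rep_sum_def snd_conv using c by (intro mult_four_block_mat) auto
    also have "\<dots> = snd (V \<oplus>\<^sub>r W) (g \<otimes>\<^bsub>G\<^esub> h)"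
      unfolding rep_sum_def snd_conv using c by (simp add: repsD(3)[OF V g] repsD(3)[OF W g])
    finally show ?thesis by simp
  qed
  moreover have "snd (V \<oplus>\<^sub>r W) g \<in> carrier_mat (fst V + fst W) (fst V + fst W)" if "g \<in> carrier G" for g
    using repsD(1)[OF V that] repsD(1)[OF W that] by (simp add: rep_sum_def)
  moreover have "snd (V \<oplus>\<^sub>r W) \<one>\<^bsub>G\<^esub> = 1\<^sub>m (fst V + fst W)"
    using repsD(2)[OF V] repsD(2)[OF W] by (simp add: rep_sum_def)
  ultimately show ?thesis unfolding reps_def by (auto simp: rep_sum_def)
qed

lemma reps_zero: "rep_zero \<in> reps G"
  by (auto simp: reps_def rep_zero_def)

lemma character_zero [simp]: "character rep_zero g = 0"
  by (simp add: character_def rep_zero_def)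

text \<open>The representation of the cyclic group in which the generator acts by \<open>M\<close>.\<close>

definition linear_rep :: "nat \<Rightarrow> 'k::field mat \<Rightarrow> (int, 'k) rep" where
  "linear_rep d M = (d, \<lambda>j. M ^\<^sub>m nat j)"

lemma pow_mat_add: "M \<in> carrier_mat d d \<Longrightarrow> M ^\<^sub>m (a + b) = M ^\<^sub>m a * M ^\<^sub>m b" for M :: "'k::comm_ring_1 mat"
proof (induction b)
  case (Suc b)
  have c: "M ^\<^sub>m a \<in> carrier_mat d d" "M ^\<^sub>m b \<in> carrier_mat d d" using Suc.prems by (auto intro: pow_carrier_mat)
  show ?case using Suc assoc_mult_mat[OF c Suc.prems] by simp
qed simp

lemma pow_mat_mult_one: "M \<in> carrier_mat d d \<Longrightarrow> M ^\<^sub>m p = 1\<^sub>m d \<Longrightarrow> M ^\<^sub>m (p * q) = 1\<^sub>m d" for M :: "'k::comm_ring_1 mat"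
proof (induction q)
  case (Suc q)
  have "M ^\<^sub>m (p * Suc q) = M ^\<^sub>m p * M ^\<^sub>m (p * q)" using pow_mat_add[OF Suc.prems(1), of p "p * q"] by simp
  then show ?case using Suc by simp
qed simp

lemma pow_mat_mod:
  fixes M :: "'k::comm_ring_1 mat"
  assumes M: "M \<in> carrier_mat d d" "M ^\<^sub>m p = 1\<^sub>m d" shows "M ^\<^sub>m (k mod p) = M ^\<^sub>m k"
proof -
  have "M ^\<^sub>m (p * (k div p) + k mod p) = M ^\<^sub>m (p * (k div p)) * M ^\<^sub>m (k mod p)" by (rule pow_mat_add[OF M(1)])
  also have "\<dots> = M ^\<^sub>m (k mod p)"
    unfolding pow_mat_mult_one[OF M] by (rule left_mult_one_mat[OF pow_carrier_mat[OF M(1)]])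
  finally show ?thesis by simp
qed

lemma linear_rep_reps:
  assumes M: "M \<in> carrier_mat d d" "M ^\<^sub>m p = 1\<^sub>m d" and p: "p > 0"
  shows "linear_rep d M \<in> reps (integer_mod_group p)"
proof -
  have "M ^\<^sub>m nat ((g + h) mod int p) = M ^\<^sub>m nat g * M ^\<^sub>m nat h" if "0 \<le> g" "0 \<le> h" for g h
  proof -
    have "nat ((g + h) mod int p) = (nat g + nat h) mod p"
      using that by (simp add: nat_mod_distrib nat_add_distrib)
    then show ?thesis using pow_mat_mod[OF M] pow_mat_add[OF M(1)] by simp
  qed
  then show ?thesis
    using p M pow_carrier_mat[OF M(1)] by (auto simp: reps_def linear_rep_def carrier_integer_mod_group)
qed

lemma reps_cyclic_power:
  assumes V: "V \<in> reps (integer_mod_group p)" and p: "prime p" and k: "k < p"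
  shows "snd V (int k) = snd V 1 ^\<^sub>m k"
  using k
proof (induction k)
  case 0
  have "snd V 1 \<in> carrier_mat (fst V) (fst V)"
    using repsD(1)[OF V] prime_gt_1_nat[OF p] by (simp add: carrier_integer_mod_group)
  then show ?case using repsD(2)[OF V] by simp
next
  case (Suc k)
  have "snd V (int k \<otimes>\<^bsub>integer_mod_group p\<^esub> 1) = snd V (int k) * snd V 1"
    using Suc.prems prime_gt_1_nat[OF p] by (intro repsD(3)[OF V]) (auto simp: carrier_integer_mod_group)
  moreover have "(int k + 1) mod int p = int (Suc k)" using Suc.prems by simp
  ultimately show ?case using Suc by simp
qed

lemma reps_cyclic_order:
  assumes V: "V \<in> reps (integer_mod_group p)" and p: "prime p"
  shows "snd V 1 \<in> carrier_mat (fst V) (fst V)" "snd V 1 ^\<^sub>m p = 1\<^sub>m (fst V)"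
proof -
  have p1: "p > 1" using prime_gt_1_nat[OF p] .
  show "snd V 1 \<in> carrier_mat (fst V) (fst V)" using repsD(1)[OF V] p1 by (simp add: carrier_integer_mod_group)
  have "snd V (int (p - 1)) = snd V 1 ^\<^sub>m (p - 1)" using p1 by (intro reps_cyclic_power[OF V p]) simp
  then have "snd V 1 ^\<^sub>m Suc (p - 1) = snd V (int (p - 1)) * snd V 1" by (simp only: pow_mat.simps)
  also have "\<dots> = snd V (int (p - 1) \<otimes>\<^bsub>integer_mod_group p\<^esub> 1)"
    using p1 by (intro repsD(3)[OF V, symmetric]) (auto simp: carrier_integer_mod_group)
  also have "int (p - 1) \<otimes>\<^bsub>integer_mod_group p\<^esub> 1 = \<one>\<^bsub>integer_mod_group p\<^esub>" using p1 by (simp add: of_nat_diff)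
  finally show "snd V 1 ^\<^sub>m p = 1\<^sub>m (fst V)" using p1 repsD(2)[OF V] by simp
qed

lemma diagonalized_trace:
  fixes M :: "'k::field mat"
  assumes M: "M \<in> carrier_mat d d" and S: "S \<in> carrier_mat d d" "S' \<in> carrier_mat d d" "S * S' = 1\<^sub>m d" "S' * S = 1\<^sub>m d"
    and eig: "\<forall>u<d. \<forall>v<d. (S * M) $$ (u, v) = x u * S $$ (u, v)"
  shows "(\<Sum>i<d. (M ^\<^sub>m j) $$ (i, i)) = (\<Sum>u<d. x u ^ j)"
proof -
  have c: "M ^\<^sub>m j \<in> carrier_mat d d" using M by (rule pow_carrier_mat)
  have Sa: "S * M ^\<^sub>m j \<in> carrier_mat d d" using S(1) c by (rule mult_carrier_mat)
  have "M ^\<^sub>m j = S' * (S * M ^\<^sub>m j)"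
    unfolding assoc_mult_mat[OF S(2,1) c, symmetric] S(4) by (rule left_mult_one_mat[OF c, symmetric])
  then have "(\<Sum>i<d. (M ^\<^sub>m j) $$ (i, i)) = (\<Sum>i<d. (S' * (S * M ^\<^sub>m j)) $$ (i, i))" by (simp only:)
  also have "\<dots> = (\<Sum>i<d. ((S * M ^\<^sub>m j) * S') $$ (i, i))" by (rule trace_commute[OF S(2) Sa])
  also have "\<dots> = (\<Sum>u<d. x u ^ j * (S * S') $$ (u, u))"
  proof (intro sum.cong refl)
    fix u assume "u \<in> {..<d}"
    then have u: "u < d" by simp
    have "((S * M ^\<^sub>m j) * S') $$ (u, u) = (\<Sum>k<d. x u ^ j * (S $$ (u, k) * S' $$ (k, u)))"
      unfolding mult_entry[OF Sa S(2) u u]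
      by (intro sum.cong refl) (simp only: diagonalized_power_entry[OF M S(1) eig u] lessThan_iff mult.assoc)
    then show "((S * M ^\<^sub>m j) * S') $$ (u, u) = x u ^ j * (S * S') $$ (u, u)"
      using mult_entry[OF S(1,2) u u] by (simp only: sum_distrib_left)
  qed
  also have "\<dots> = (\<Sum>u<d. x u ^ j)" unfolding S(3) by (intro sum.cong refl) simp
  finally show ?thesis .
qed

text \<open>Fourier inversion: the multiplicity of the eigenvalue with exponent \<open>l\<close> is read off from the traces of all
  powers. The factor \<open>\<zeta>\<^sup>-\<^sup>l\<close> is written with the exponent \<open>p - l\<close>.\<close>

lemma multiplicity_from_character:
  fixes e :: "nat \<Rightarrow> nat"
  assumes \<zeta>: "primitive_root (\<zeta> :: 'k::field) p" and e: "\<And>u. e u < p" and l: "l < p"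
  shows "(\<Sum>j<p. (\<zeta> ^ (p - l)) ^ j * (\<Sum>u<d. (\<zeta> ^ e u) ^ j)) = of_nat p * of_nat (card {u. u < d \<and> e u = l})"
proof -
  have "(\<Sum>j<p. (\<zeta> ^ (p - l)) ^ j * (\<Sum>u<d. (\<zeta> ^ e u) ^ j)) = (\<Sum>j<p. \<Sum>u<d. (\<zeta> ^ (p - l + e u)) ^ j)"
    by (intro sum.cong refl) (simp only: sum_distrib_left power_mult_distrib[symmetric] power_add[symmetric])
  also have "\<dots> = (\<Sum>u<d. \<Sum>j<p. (\<zeta> ^ (p - l + e u)) ^ j)" by (rule sum.swap)
  also have "\<dots> = (\<Sum>u<d. if e u = l then of_nat p else 0)"
  proof (intro sum.cong refl)
    fix u
    have "p dvd p - l + e u \<longleftrightarrow> e u = l"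
    proof
      assume "p dvd p - l + e u"
      then obtain q where q: "p - l + e u = p * q" by (elim dvdE)
      then have "p * q < p * 2" "p * q > 0" using e[of u] l by linarith+
      then have "q = 1" by (simp add: less_2_cases_iff)
      then show "e u = l" using q l by simp
    qed (use l in auto)
    then show "(\<Sum>j<p. (\<zeta> ^ (p - l + e u)) ^ j) = (if e u = l then of_nat p else 0)"
      unfolding sum_primitive_root[OF \<zeta>] by simp
  qed
  also have "\<dots> = of_nat p * of_nat (card {u. u < d \<and> e u = l})"
    by (simp add: sum.If_cases Int_def mult.commute)
  finally show ?thesis .
qed

lemma count_map_upt: "count (mset (map e [0..<d])) l = card {u. u < d \<and> e u = l}"
proof (induction d)
  case (Suc d)
  have "{u. u < Suc d \<and> e u = l} = (if e d = l then insert d {u. u < d \<and> e u = l} else {u. u < d \<and> e u = l})"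
    by (auto simp: less_Suc_eq)
  then show ?case using Suc by simp
qed simp

text \<open>Diagonalize both generators. By \<open>multiplicity_from_character\<close> their eigenvalues coincide up to a
  permutation \<open>\<pi>\<close>. Permuting the rows of the second diagonalizing matrix by \<open>\<pi>\<close> gives a matrix \<open>R\<close> that diagonalizes
  the second generator to the same diagonal matrix as the first.\<close>

lemma rep_iso_if_equal_characters:
  fixes V W :: "(int, 'k::field_char_0) rep"
  assumes \<zeta>: "primitive_root (\<zeta> :: 'k) p" and V: "V \<in> reps (integer_mod_group p)" and W: "W \<in> reps (integer_mod_group p)"
    and eq: "\<And>g. g \<in> carrier (integer_mod_group p) \<Longrightarrow> character V g = character W g"
  shows "rep_iso (integer_mod_group p) V W"
proof -
  have p: "prime p" "p > 0" using \<zeta> prime_gt_0_nat by (auto simp: primitive_root_def)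
  let ?dV = "fst V" and ?dW = "fst W" and ?A = "snd V 1" and ?B = "snd W 1"
  note A = reps_cyclic_order[OF V p(1)] and B = reps_cyclic_order[OF W p(1)]
  obtain e S S' where e: "\<And>u. e u < p" and S: "S \<in> carrier_mat ?dV ?dV" "S' \<in> carrier_mat ?dV ?dV"
      "S * S' = 1\<^sub>m ?dV" "S' * S = 1\<^sub>m ?dV"
    and eS: "\<forall>u<?dV. \<forall>v<?dV. (S * ?A) $$ (u, v) = \<zeta> ^ e u * S $$ (u, v)"
    using finite_order_diagonalizable[OF A \<zeta>] by blast
  obtain f T T' where f: "\<And>u. f u < p" and T: "T \<in> carrier_mat ?dW ?dW" "T' \<in> carrier_mat ?dW ?dW"
      "T * T' = 1\<^sub>m ?dW" "T' * T = 1\<^sub>m ?dW"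
    and fT: "\<forall>u<?dW. \<forall>v<?dW. (T * ?B) $$ (u, v) = \<zeta> ^ f u * T $$ (u, v)"
    using finite_order_diagonalizable[OF B \<zeta>] by blast
  have sums: "(\<Sum>u<?dV. (\<zeta> ^ e u) ^ j) = (\<Sum>u<?dW. (\<zeta> ^ f u) ^ j)" if "j < p" for j
  proof -
    have "character V (int j) = character W (int j)" using eq that by (simp add: carrier_integer_mod_group)
    then show ?thesis
      unfolding character_def reps_cyclic_power[OF V p(1) that] reps_cyclic_power[OF W p(1) that]
        diagonalized_trace[OF A(1) S eS] diagonalized_trace[OF B(1) T fT] .
  qed
  have card: "card {u. u < ?dV \<and> e u = l} = card {u. u < ?dW \<and> f u = l}" for l
  proof (cases "l < p")
    case True
    have "(of_nat p * of_nat (card {u. u < ?dV \<and> e u = l}) :: 'k) = of_nat p * of_nat (card {u. u < ?dW \<and> f u = l})"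
      unfolding multiplicity_from_character[OF \<zeta> e True, symmetric] multiplicity_from_character[OF \<zeta> f True, symmetric]
      by (intro sum.cong refl) (simp only: sums lessThan_iff)
    then show ?thesis using p by simp
  next
    case False
    then have "e u \<noteq> l" "f u \<noteq> l" for u using e[of u] f[of u] by auto
    then show ?thesis by simp
  qed
  have "mset (map e [0..<?dV]) = mset (map f [0..<?dW])"
    by (rule multiset_eqI) (simp only: count_map_upt card)
  from permutation_Ex_bij[OF this] obtain \<pi> where bij: "bij_betw \<pi> {..<?dV} {..<?dW}"
    and nth: "\<forall>u<?dV. map e [0..<?dV] ! u = map f [0..<?dW] ! \<pi> u" by auto
  have \<pi>lt: "\<pi> u < ?dW" if "u < ?dV" for u using bij_betwE[OF bij] that by blast
  have "e u = f (\<pi> u)" if "u < ?dV" for u using nth \<pi>lt[OF that] that by simp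
  note \<pi> = bij this
  have dim: "?dV = ?dW" using bij_betw_same_card[OF \<pi>(1)] by simp
  have \<pi>inj: "\<pi> u = \<pi> v \<longleftrightarrow> u = v" if "u < ?dV" "v < ?dV" for u v
    using \<pi>(1) that by (auto simp: bij_betw_def inj_on_def)
  define R where "R = mat ?dV ?dV (\<lambda>(u, v). T $$ (\<pi> u, v))"
  define R' where "R' = mat ?dV ?dV (\<lambda>(u, v). T' $$ (u, \<pi> v))"
  have R: "R \<in> carrier_mat ?dV ?dV" "R' \<in> carrier_mat ?dV ?dV" by (auto simp: R_def R'_def)
  have T2: "T \<in> carrier_mat ?dV ?dV" "T' \<in> carrier_mat ?dV ?dV" "?B \<in> carrier_mat ?dV ?dV" using T B dim by auto
  have RR': "R * R' = 1\<^sub>m ?dV"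
  proof (rule eq_matI)
    fix u v assume "u < dim_row (1\<^sub>m ?dV :: 'k mat)" "v < dim_col (1\<^sub>m ?dV :: 'k mat)"
    then have uv: "u < ?dV" "v < ?dV" by auto
    have lt: "\<pi> u < ?dV" "\<pi> v < ?dV" using \<pi>lt uv dim by auto
    have "(R * R') $$ (u, v) = (\<Sum>k<?dV. T $$ (\<pi> u, k) * T' $$ (k, \<pi> v))"
      unfolding mult_entry[OF R uv] by (intro sum.cong refl) (use uv in \<open>simp add: R_def R'_def\<close>)
    also have "\<dots> = (T * T') $$ (\<pi> u, \<pi> v)" by (rule mult_entry[OF T2(1,2) lt, symmetric])
    also have "\<dots> = 1\<^sub>m ?dV $$ (u, v)" unfolding T(3) using lt uv dim \<pi>inj[OF uv] by simp
    finally show "(R * R') $$ (u, v) = 1\<^sub>m ?dV $$ (u, v)" .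
  qed (use R in auto)
  have R'R: "R' * R = 1\<^sub>m ?dV" by (rule mat_mult_left_right_inverse[OF R RR'])
  have RB: "(R * ?B) $$ (u, v) = \<zeta> ^ e u * R $$ (u, v)" if uv: "u < ?dV" "v < ?dV" for u v
  proof -
    have lt: "\<pi> u < ?dV" using \<pi>lt uv dim by auto
    have "(R * ?B) $$ (u, v) = (\<Sum>k<?dV. T $$ (\<pi> u, k) * ?B $$ (k, v))"
      unfolding mult_entry[OF R(1) T2(3) uv] by (intro sum.cong refl) (use uv in \<open>simp add: R_def\<close>)
    also have "\<dots> = (T * ?B) $$ (\<pi> u, v)" by (rule mult_entry[OF T2(1,3) lt uv(2), symmetric])
    also have "\<dots> = \<zeta> ^ f (\<pi> u) * T $$ (\<pi> u, v)" using fT lt uv dim by simp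
    finally show ?thesis using \<pi>(2)[OF uv(1)] uv by (simp add: R_def)
  qed
  have RBj: "\<forall>u<?dV. \<forall>v<?dV. (R * ?B) $$ (u, v) = \<zeta> ^ e u * R $$ (u, v)" using RB by blast
  define P where "P = R' * S"
  define Q where "Q = S' * R"
  have PQ: "P \<in> carrier_mat ?dV ?dV" "Q \<in> carrier_mat ?dV ?dV" using R S by (auto simp: P_def Q_def intro!: mult_carrier_mat)
  have QP1: "Q * P = 1\<^sub>m ?dV"
  proof -
    have "Q * P = S' * (R * (R' * S))" unfolding P_def Q_def using R S by (intro assoc_mult_mat[of _ ?dV ?dV _ ?dV _ ?dV]) auto
    also have "R * (R' * S) = (R * R') * S" using R S by (intro assoc_mult_mat[of _ ?dV ?dV _ ?dV _ ?dV, symmetric]) auto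
    finally show ?thesis using RR' S by simp
  qed
  then have PQ1: "P * Q = 1\<^sub>m ?dV" by (rule mat_mult_left_right_inverse[OF PQ(2,1)])
  have inter: "P * snd V g = snd W g * P" if g: "g \<in> carrier (integer_mod_group p)" for g
  proof -
    obtain j where j: "g = int j" "j < p"
      using g p(2) by (metis atLeastLessThan_iff carrier_integer_mod_group less_numeral_extra(3) nat_0_le nat_less_iff)
    note Vj = reps_cyclic_power[OF V p(1) j(2)] and Wj = reps_cyclic_power[OF W p(1) j(2)]
    let ?Aj = "?A ^\<^sub>m j" and ?Bj = "?B ^\<^sub>m j"
    have cj: "?Aj \<in> carrier_mat ?dV ?dV" "?Bj \<in> carrier_mat ?dV ?dV"
      using pow_carrier_mat[OF A(1)] pow_carrier_mat[OF T2(3)] by auto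
    define E where "E = mat ?dV ?dV (\<lambda>(u, v). if u = v then (\<zeta> ^ e u) ^ j else 0)"
    have E: "E \<in> carrier_mat ?dV ?dV" by (simp add: E_def)
    have SA: "S * ?Aj = E * S" and RB': "R * ?Bj = E * R"
    proof -
      have mult_E: "(E * X) $$ (u, v) = (\<zeta> ^ e u) ^ j * X $$ (u, v)"
        if "X \<in> carrier_mat ?dV ?dV" "u < ?dV" "v < ?dV" for X u v
      proof -
        have "(E * X) $$ (u, v) = (\<Sum>k<?dV. if k = u then (\<zeta> ^ e u) ^ j * X $$ (u, v) else 0)"
          unfolding mult_entry[OF E that] by (intro sum.cong refl) (use that in \<open>simp add: E_def\<close>)
        then show ?thesis using that by simp
      qed
      show "S * ?Aj = E * S"
        by (rule eq_matI) (use S cj E in \<open>auto simp: mult_E diagonalized_power_entry[OF A(1) S(1) eS] simp del: index_mult_mat(1)\<close>)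
      show "R * ?Bj = E * R"
        by (rule eq_matI) (use R cj E in \<open>auto simp: mult_E diagonalized_power_entry[OF T2(3) R(1) RBj] simp del: index_mult_mat(1)\<close>)
    qed
    have "P * ?Aj = R' * (S * ?Aj)" unfolding P_def using R S cj by (intro assoc_mult_mat[of _ ?dV ?dV _ ?dV _ ?dV]) auto
    also have "\<dots> = (R' * E) * S" unfolding SA using R S E by (intro assoc_mult_mat[of _ ?dV ?dV _ ?dV _ ?dV, symmetric]) auto
    also have "R' * E = ?Bj * R'"
    proof -
      have "R' * E = R' * (E * (R * R'))" using RR' E R by simp
      also have "E * (R * R') = (R * ?Bj) * R'" unfolding RB' using E R by (intro assoc_mult_mat[of _ ?dV ?dV _ ?dV _ ?dV, symmetric]) auto
      also have "R' * ((R * ?Bj) * R') = (R' * (R * ?Bj)) * R'" using cj R by (intro assoc_mult_mat[of _ ?dV ?dV _ ?dV _ ?dV, symmetric]) auto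
      also have "R' * (R * ?Bj) = (R' * R) * ?Bj" using cj R by (intro assoc_mult_mat[of _ ?dV ?dV _ ?dV _ ?dV, symmetric]) auto
      finally show ?thesis unfolding R'R left_mult_one_mat[OF cj(2)] .
    qed
    also have "?Bj * R' * S = ?Bj * P" unfolding P_def using R S cj by (intro assoc_mult_mat[of _ ?dV ?dV _ ?dV _ ?dV]) auto
    finally show ?thesis unfolding j(1) Vj Wj .
  qed
  show ?thesis
    unfolding rep_iso_def using PQ PQ1 QP1 inter by (intro bexI[of _ P] bexI[of _ Q] conjI ballI) (simp_all add: dim[symmetric])
qed

subsection \<open>Virtual characters\<close>

definition eval_int :: "int poly \<Rightarrow> 'k::comm_ring_1 \<Rightarrow> 'k" where
  "eval_int f x = poly (map_poly of_int f) x"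

lemma eval_int_0 [simp]: "eval_int 0 x = 0"
  and eval_int_pCons [simp]: "eval_int (pCons a f) x = of_int a + x * eval_int f x"
  by (simp_all add: eval_int_def map_poly_pCons)

lemma eval_int_add: "eval_int (f + g) x = eval_int f x + eval_int g x"
  by (induction f g rule: poly_induct2) (simp_all add: algebra_simps)

lemma eval_int_smult: "eval_int (smult a f) x = of_int a * eval_int f x"
  by (induction f) (simp_all add: algebra_simps)

lemma eval_int_mult: "eval_int (f * g) x = eval_int f x * eval_int g x"
  by (induction f) (simp_all add: mult_pCons_left eval_int_add eval_int_smult algebra_simps)

lemma eval_int_1 [simp]: "eval_int 1 x = 1"
  by (simp add: one_pCons)

lemma eval_int_diff: "eval_int (f - g) x = eval_int f x - eval_int g x"
  using eval_int_add[of "f - g" g x] by simp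

lemma eval_int_power: "eval_int (f ^ n) x = eval_int f x ^ n"
  by (induction n) (simp_all add: eval_int_mult)

lemma eval_int_sum: "eval_int (sum f A) x = (\<Sum>a\<in>A. eval_int (f a) x)"
  by (induction A rule: infinite_finite_induct) (simp_all add: eval_int_add)

lemma eval_int_of_nat: "eval_int (of_nat n) x = of_nat n"
  by (induction n) (simp_all add: eval_int_add)

text \<open>The lists repeat each exponent as often as its coefficient says, the positive coefficients going
  to the first list and the negative ones to the second.\<close>

lemma eval_int_difference_of_lists:
  "\<exists>xs ys. \<forall>x :: 'k::comm_ring_1. eval_int f x = (\<Sum>i\<leftarrow>xs. x ^ i) - (\<Sum>i\<leftarrow>ys. x ^ i)"
proof (induction f)
  case 0
  show ?case by (intro exI[of _ "[]"]) simp
next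
  case (pCons a f)
  then obtain xs ys where f: "\<And>x :: 'k. eval_int f x = (\<Sum>i\<leftarrow>xs. x ^ i) - (\<Sum>i\<leftarrow>ys. x ^ i)" by blast
  have rep: "(\<Sum>i\<leftarrow>replicate n 0 @ map Suc zs. x ^ i) = of_nat n + x * (\<Sum>i\<leftarrow>zs. x ^ i)" for n zs and x :: 'k
    by (simp add: sum_list_replicate o_def sum_list_const_mult)
  have a: "(of_int a :: 'k) = of_nat (nat a) - of_nat (nat (- a))"
    by (cases "a \<ge> 0") (simp_all add: of_nat_nat)
  show ?case
    by (rule exI[of _ "replicate (nat a) 0 @ map Suc xs"], rule exI[of _ "replicate (nat (- a)) 0 @ map Suc ys"])
      (simp only: rep eval_int_pCons f a, simp add: algebra_simps)
qed

text \<open>Characters are additive and invariant under isomorphism, so they can be cancelled; conversely they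
  determine representations up to isomorphism.\<close>

lemma vrep_rel_iff:
  fixes V W V' W' :: "(int, 'k::field_char_0) rep"
  assumes \<zeta>: "primitive_root (\<zeta> :: 'k) p"
  shows "((V, W), (V', W')) \<in> vrep_rel (integer_mod_group p) \<longleftrightarrow>
    V \<in> reps (integer_mod_group p) \<and> W \<in> reps (integer_mod_group p) \<and>
    V' \<in> reps (integer_mod_group p) \<and> W' \<in> reps (integer_mod_group p) \<and>
    (\<forall>g\<in>carrier (integer_mod_group p). character V g + character W' g = character V' g + character W g)"
    (is "?L \<longleftrightarrow> ?R")
proof -
  let ?G = "integer_mod_group p"
  note S = reps_sum[OF group_integer_mod_group[of p]]
  show ?thesis
  proof
    assume ?L
    then have r: "V \<in> reps ?G" "W \<in> reps ?G" "V' \<in> reps ?G" "W' \<in> reps ?G"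
      and "\<exists>U\<in>reps ?G. rep_iso ?G (V \<oplus>\<^sub>r W' \<oplus>\<^sub>r U) (V' \<oplus>\<^sub>r W \<oplus>\<^sub>r U)" by (auto simp: vrep_rel_def)
    then obtain U where U: "U \<in> reps ?G" "rep_iso ?G (V \<oplus>\<^sub>r W' \<oplus>\<^sub>r U) (V' \<oplus>\<^sub>r W \<oplus>\<^sub>r U)" by blast
    have "character V g + character W' g = character V' g + character W g" if g: "g \<in> carrier ?G" for g
      using character_iso[OF S[OF S[OF r(1,4)] U(1)] S[OF S[OF r(3,2)] U(1)] U(2) g]
      by (simp add: character_sum[OF _ _ g] S r U(1))
    then show ?R using r by blast
  next
    assume R: ?R
    then have r: "V \<in> reps ?G" "W \<in> reps ?G" "V' \<in> reps ?G" "W' \<in> reps ?G" by auto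
    have "rep_iso ?G (V \<oplus>\<^sub>r W' \<oplus>\<^sub>r rep_zero) (V' \<oplus>\<^sub>r W \<oplus>\<^sub>r rep_zero)"
    proof (rule rep_iso_if_equal_characters[OF \<zeta> S[OF S[OF r(1,4)] reps_zero] S[OF S[OF r(3,2)] reps_zero]])
      fix g assume g: "g \<in> carrier ?G"
      then have "character V g + character W' g = character V' g + character W g" using R by blast
      then show "character (V \<oplus>\<^sub>r W' \<oplus>\<^sub>r rep_zero) g = character (V' \<oplus>\<^sub>r W \<oplus>\<^sub>r rep_zero) g"
        by (simp add: character_sum[OF _ _ g] S r reps_zero)
    qed
    then show ?L using r reps_zero unfolding vrep_rel_def by blast
  qed
qed

context
  fixes \<zeta> :: "'k::field_char_0" and p :: nat and G :: "int monoid"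
  assumes \<zeta>: "primitive_root \<zeta> p"
  defines G: "G \<equiv> integer_mod_group p"
begin

lemma mem_vrep:
  fixes V W X Y :: "(int, 'k) rep"
  shows "(X, Y) \<in> vrep G V W \<longleftrightarrow> V \<in> reps G \<and> W \<in> reps G \<and> X \<in> reps G \<and> Y \<in> reps G \<and>
    (\<forall>g\<in>carrier G. character V g + character Y g = character X g + character W g)"
  unfolding vrep_def Image_singleton_iff G by (rule vrep_rel_iff[OF \<zeta>])

lemma vrep_eqI:
  fixes V W V' W' :: "(int, 'k) rep"
  assumes "V \<in> reps G" "W \<in> reps G" "V' \<in> reps G" "W' \<in> reps G"
    and eq: "\<And>g. g \<in> carrier G \<Longrightarrow> character V g - character W g = character V' g - character W' g"
  shows "vrep G V W = vrep G V' W'"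
proof -
  have iff: "(a + y = x + b) = (a' + y = x + b')" if "a - b = a' - b'" for a b a' b' x y :: 'k
  proof -
    have "(a + y = x + b) = (a - b = x - y)" for a b :: 'k
    proof
      assume "a + y = x + b"
      then have "a = x + b - y" by (simp only: eq_diff_eq)
      then show "a - b = x - y" by simp
    next
      assume "a - b = x - y"
      then have "a = x - y + b" by (simp only: diff_eq_eq)
      then show "a + y = x + b" by simp
    qed
    then show ?thesis using that by simp
  qed
  have "(X, Y) \<in> vrep G V W \<longleftrightarrow> (X, Y) \<in> vrep G V' W'" for X Y
  proof -
    have "(\<forall>g\<in>carrier G. character V g + character Y g = character X g + character W g) \<longleftrightarrow>
        (\<forall>g\<in>carrier G. character V' g + character Y g = character X g + character W' g)"
      by (intro ball_cong refl iff eq)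
    then show ?thesis unfolding mem_vrep using assms(1-4) by simp
  qed
  then show ?thesis by auto
qed

lemma vrep_in_carrier:
  fixes V W :: "(int, 'k) rep"
  assumes "V \<in> reps G" "W \<in> reps G" shows "vrep G V W \<in> carrier (rep_ring G)"
  using assms by (auto simp: rep_ring_def vrep_def intro!: quotientI)

lemma add_vrep:
  fixes V W V' W' :: "(int, 'k) rep"
  assumes r: "V \<in> reps G" "W \<in> reps G" "V' \<in> reps G" "W' \<in> reps G"
  shows "vrep G V W \<oplus>\<^bsub>rep_ring G\<^esub> vrep G V' W' = vrep G (V \<oplus>\<^sub>r V') (W \<oplus>\<^sub>r W')"
proof -
  have "group G" unfolding G by (rule group_integer_mod_group)
  note S = reps_sum[OF this]
  have difference_add: "(a + a') - (b + b') = (v + v') - (w + w')"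
    if "v + b = a + w" "v' + b' = a' + w'" for a a' b b' v v' w w' :: 'k
  proof -
    have "a = v + b - w" "a' = v' + b' - w'" using that by simp_all
    then show ?thesis by (simp add: algebra_simps)
  qed
  have *: "vrep G (A \<oplus>\<^sub>r A') (B \<oplus>\<^sub>r B') = vrep G (V \<oplus>\<^sub>r V') (W \<oplus>\<^sub>r W')"
    if AB: "(A, B) \<in> vrep G V W" "(A', B') \<in> vrep G V' W'" for A B A' B'
  proof (rule vrep_eqI)
    have m: "A \<in> reps G" "B \<in> reps G" "A' \<in> reps G" "B' \<in> reps G" using AB unfolding mem_vrep by auto
    show "A \<oplus>\<^sub>r A' \<in> reps G" "B \<oplus>\<^sub>r B' \<in> reps G" "V \<oplus>\<^sub>r V' \<in> reps G" "W \<oplus>\<^sub>r W' \<in> reps G"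
      by (rule S[OF m(1,3)], rule S[OF m(2,4)], rule S[OF r(1,3)], rule S[OF r(2,4)])
    fix g assume g: "g \<in> carrier G"
    have "character V g + character B g = character A g + character W g"
      "character V' g + character B' g = character A' g + character W' g"
      using AB g unfolding mem_vrep by auto
    then show "character (A \<oplus>\<^sub>r A') g - character (B \<oplus>\<^sub>r B') g = character (V \<oplus>\<^sub>r V') g - character (W \<oplus>\<^sub>r W') g"
      unfolding character_sum[OF m(1,3) g] character_sum[OF m(2,4) g] character_sum[OF r(1,3) g] character_sum[OF r(2,4) g]
      by (rule difference_add)
  qed
  have "(V, W) \<in> vrep G V W" "(V', W') \<in> vrep G V' W'" unfolding mem_vrep using r by auto
  then have "(\<Union>(A, B)\<in>vrep G V W. \<Union>(A', B')\<in>vrep G V' W'. vrep G (A \<oplus>\<^sub>r A') (B \<oplus>\<^sub>r B'))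
      = vrep G (V \<oplus>\<^sub>r V') (W \<oplus>\<^sub>r W')"
    using * by fast
  then show ?thesis by (simp add: rep_ring_def)
qed

lemma add_pow_vrep:
  fixes V W :: "(int, 'k) rep"
  assumes r: "V \<in> reps G" "W \<in> reps G"
  shows "\<exists>V' W'. V' \<in> reps G \<and> W' \<in> reps G \<and> add_pow (rep_ring G) (n :: nat) (vrep G V W) = vrep G V' W' \<and>
    (\<forall>g\<in>carrier G. character V' g = of_nat n * character V g \<and> character W' g = of_nat n * character W g)"
proof (induction n)
  case 0
  have "add_pow (rep_ring G) (0 :: nat) (vrep G V W) = vrep G rep_zero rep_zero"
    by (simp add: add_pow_def rep_ring_def)
  then show ?case using reps_zero by (intro exI[of _ rep_zero]) simp
next
  case (Suc n)
  then obtain V' W' where n: "V' \<in> reps G" "W' \<in> reps G" "add_pow (rep_ring G) n (vrep G V W) = vrep G V' W'"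
    "\<And>g. g \<in> carrier G \<Longrightarrow> character V' g = of_nat n * character V g \<and> character W' g = of_nat n * character W g" by blast
  have "group G" unfolding G by (rule group_integer_mod_group)
  note S = reps_sum[OF this]
  have "add_pow (rep_ring G) (Suc n) (vrep G V W) = vrep G V' W' \<oplus>\<^bsub>rep_ring G\<^esub> vrep G V W"
    using n(3) by (simp add: add_pow_def)
  also have "\<dots> = vrep G (V' \<oplus>\<^sub>r V) (W' \<oplus>\<^sub>r W)" by (rule add_vrep[OF n(1,2) r])
  finally have "add_pow (rep_ring G) (Suc n) (vrep G V W) = vrep G (V' \<oplus>\<^sub>r V) (W' \<oplus>\<^sub>r W)" .
  then show ?case
    using S[OF n(1) r(1)] S[OF n(2) r(2)] n(4) character_sum[OF n(1) r(1)] character_sum[OF n(2) r(2)]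
    by - (rule exI[of _ "V' \<oplus>\<^sub>r V"], rule exI[of _ "W' \<oplus>\<^sub>r W"], simp add: algebra_simps)
qed

lemma carrier_G: "g \<in> carrier G \<longleftrightarrow> (\<exists>j. g = int j \<and> j < p)"
proof -
  have "p \<noteq> 0" using \<zeta> by (auto simp: primitive_root_def dest: prime_gt_0_nat)
  then show ?thesis
    unfolding G by (auto simp: carrier_integer_mod_group intro: exI[of _ "nat g"])
qed

text \<open>The direct sum of the one-dimensional representations with the exponents in \<open>es\<close>.\<close>

lemma exists_diagonal_rep:
  "\<exists>V :: (int, 'k) rep. V \<in> reps G \<and> (\<forall>j. character V (int j) = (\<Sum>i\<leftarrow>es. (\<zeta> ^ j) ^ i))"
proof -
  let ?d = "length es" and ?x = "\<lambda>u. \<zeta> ^ (es ! u)"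
  define M where "M = mat ?d ?d (\<lambda>(u, v). if u = v then ?x u else 0)"
  have M: "M \<in> carrier_mat ?d ?d" by (simp add: M_def)
  have one: "1\<^sub>m ?d \<in> carrier_mat ?d ?d" "1\<^sub>m ?d * 1\<^sub>m ?d = (1\<^sub>m ?d :: 'k mat)" by auto
  have eig: "\<forall>u<?d. \<forall>v<?d. (1\<^sub>m ?d * M) $$ (u, v) = ?x u * 1\<^sub>m ?d $$ (u, v)"
    unfolding left_mult_one_mat[OF M] by (auto simp: M_def)
  have p0: "p > 0" using \<zeta> prime_gt_0_nat by (auto simp: primitive_root_def)
  have "M ^\<^sub>m p = 1\<^sub>m ?d"
  proof (rule eq_matI)
    fix u v assume "u < dim_row (1\<^sub>m ?d :: 'k mat)" "v < dim_col (1\<^sub>m ?d :: 'k mat)"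
    then have uv: "u < ?d" "v < ?d" by auto
    have "(M ^\<^sub>m p) $$ (u, v) = ?x u ^ p * 1\<^sub>m ?d $$ (u, v)"
      using diagonalized_power_entry[OF M one(1) eig uv, of p] unfolding left_mult_one_mat[OF pow_carrier_mat[OF M]] .
    also have "?x u ^ p = 1" using \<zeta> by (metis mult.commute power_mult power_one primitive_root_def)
    finally show "(M ^\<^sub>m p) $$ (u, v) = 1\<^sub>m ?d $$ (u, v)" by simp
  qed (use pow_carrier_mat[OF M, of p] in auto)
  then have "linear_rep ?d M \<in> reps G" unfolding G by (rule linear_rep_reps[OF M _ p0])
  moreover have "character (linear_rep ?d M) (int j) = (\<Sum>i\<leftarrow>es. (\<zeta> ^ j) ^ i)" for j
  proof -
    have "character (linear_rep ?d M) (int j) = (\<Sum>u<?d. ?x u ^ j)"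
      using diagonalized_trace[OF M one(1,1,2,2) eig, of j] by (simp add: character_def linear_rep_def)
    also have "\<dots> = (\<Sum>u<?d. (\<zeta> ^ j) ^ (es ! u))" by (intro sum.cong refl) (simp only: power_mult[symmetric] mult.commute)
    finally show ?thesis by (simp add: sum_list_sum_nth lessThan_atLeast0)
  qed
  ultimately show ?thesis by blast
qed

text \<open>The virtual character with values \<open>f(\<zeta>\<^sup>j)\<close> comes from a virtual representation \<open>Y\<close>, whose multiplicities
  are the coefficients of \<open>f\<close>. Then \<open>n\<close> times \<open>Y\<close> has the character of the given class.\<close>

lemma vrep_divisible:
  fixes V W :: "(int, 'k) rep"
  assumes r: "V \<in> reps G" "W \<in> reps G"
    and eq: "\<And>j. j < p \<Longrightarrow> character V (int j) - character W (int j) = of_nat n * eval_int f (\<zeta> ^ j)"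
  shows "\<exists>Y\<in>carrier (rep_ring G). vrep G V W = add_pow (rep_ring G) (n :: nat) Y"
proof -
  obtain xs ys where f: "\<And>x :: 'k. eval_int f x = (\<Sum>i\<leftarrow>xs. x ^ i) - (\<Sum>i\<leftarrow>ys. x ^ i)"
    using eval_int_difference_of_lists[of f] by blast
  obtain V1 :: "(int, 'k) rep" where V1: "V1 \<in> reps G" "\<And>j. character V1 (int j) = (\<Sum>i\<leftarrow>xs. (\<zeta> ^ j) ^ i)"
    using exists_diagonal_rep by blast
  obtain W1 :: "(int, 'k) rep" where W1: "W1 \<in> reps G" "\<And>j. character W1 (int j) = (\<Sum>i\<leftarrow>ys. (\<zeta> ^ j) ^ i)"
    using exists_diagonal_rep by blast
  obtain V' W' where n: "V' \<in> reps G" "W' \<in> reps G" "add_pow (rep_ring G) n (vrep G V1 W1) = vrep G V' W'"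
    "\<And>g. g \<in> carrier G \<Longrightarrow> character V' g = of_nat n * character V1 g \<and> character W' g = of_nat n * character W1 g"
    using add_pow_vrep[OF V1(1) W1(1)] by blast
  have "vrep G V W = vrep G V' W'"
  proof (rule vrep_eqI[OF r n(1,2)])
    fix g assume g: "g \<in> carrier G"
    then obtain j where j: "g = int j" "j < p" unfolding carrier_G by blast
    have "character V' g - character W' g = of_nat n * (character V1 g - character W1 g)"
      using n(4)[OF g] by (simp add: right_diff_distrib)
    also have "\<dots> = of_nat n * eval_int f (\<zeta> ^ j)" unfolding j f V1 W1 ..
    finally show "character V g - character W g = character V' g - character W' g" using eq[OF j(2)] j(1) by simp
  qed
  then show ?thesis using n(3) vrep_in_carrier[OF V1(1) W1(1)] by metis
qed

end

section \<open>Divisibility of the class of the fibre\<close>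

theorem proposition3p18:
  fixes w :: "('n::finite, 'k::field_char_0) mfps"
    and t :: "'n \<Rightarrow> 'k"
    and p m :: nat
    and A :: "('n, 'k) mfps eq_mat_fact"
  assumes "isolated_singularity w"
    and "diagonal_symmetry t w"
    and "prime p"
    and "torus_order t p"
    and "\<forall>i. t i \<noteq> 1"
    and "equivariant_mf t p w A"
    and "\<lceil>real CARD('n) / 2\<rceil> - 1 \<ge> int m * (int p - 1)"
  shows "\<exists>Y \<in> carrier (rep_ring (integer_mod_group p)).
           fiber_class p A = add_pow (rep_ring (integer_mod_group p)) (p ^ m) Y"
proof -
  let ?G = "integer_mod_group p"
  obtain \<zeta> c where \<zeta>: "primitive_root \<zeta> p" and t: "\<And>i. t i = \<zeta> ^ c i" and c: "\<And>i. \<not> p dvd c i"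
    using exists_weights[OF assms(3,4,5)] by blast
  define r s \<alpha>0 \<alpha>1 where "r = even_rank A" "s = odd_rank A" "\<alpha>0 = act_even A" "\<alpha>1 = act_odd A"
  note defs = r_s_\<alpha>0_\<alpha>1_def
  have mf: "matrix_factorization w A"
    and \<alpha>0: "\<alpha>0 \<in> carrier_mat r r" "iterate_action t \<alpha>0 r p = 1\<^sub>m r"
    and \<alpha>1: "\<alpha>1 \<in> carrier_mat s s" "iterate_action t \<alpha>1 s p = 1\<^sub>m s"
    and eq: "pullback_mat t (d_even A) * \<alpha>0 = \<alpha>1 * d_even A" "pullback_mat t (d_odd A) * \<alpha>1 = \<alpha>0 * d_odd A"
    using assms(6) by (auto simp: equivariant_mf_def defs)
  obtain e0 S0 S0' P0 Q0 where S0: "S0 \<in> carrier_mat r r" "S0' \<in> carrier_mat r r" "S0 * S0' = 1\<^sub>m r" "S0' * S0 = 1\<^sub>m r"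
    and e0: "\<forall>u<r. \<forall>v<r. (S0 * map_mat const_term \<alpha>0) $$ (u, v) = \<zeta> ^ e0 u * S0 $$ (u, v)"
    and P0: "P0 \<in> carrier_mat r r" "Q0 \<in> carrier_mat r r" "P0 * Q0 = 1\<^sub>m r" "Q0 * P0 = 1\<^sub>m r"
    and lin0: "\<forall>u<r. \<forall>v<r. (pullback_mat t P0 * \<alpha>0) $$ (u, v) = mconst (\<zeta> ^ e0 u) * P0 $$ (u, v)"
    using equivariant_module_linearizable[OF \<alpha>0 \<zeta>] by blast
  obtain e1 S1 S1' P1 Q1 where S1: "S1 \<in> carrier_mat s s" "S1' \<in> carrier_mat s s" "S1 * S1' = 1\<^sub>m s" "S1' * S1 = 1\<^sub>m s"
    and e1: "\<forall>u<s. \<forall>v<s. (S1 * map_mat const_term \<alpha>1) $$ (u, v) = \<zeta> ^ e1 u * S1 $$ (u, v)"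
    and P1: "P1 \<in> carrier_mat s s" "Q1 \<in> carrier_mat s s" "P1 * Q1 = 1\<^sub>m s" "Q1 * P1 = 1\<^sub>m s"
    and lin1: "\<forall>u<s. \<forall>v<s. (pullback_mat t P1 * \<alpha>1) $$ (u, v) = mconst (\<zeta> ^ e1 u) * P1 $$ (u, v)"
    using equivariant_module_linearizable[OF \<alpha>1 \<zeta>] by blast
  have p: "p > 0" using assms(3) prime_gt_0_nat by blast
  have "int (m * (p - 1) + 1) \<le> int ((CARD('n) + 1) div 2)"
    using assms(7) p unfolding ceiling_half by (simp add: of_nat_diff)
  then have bound: "m * (p - 1) + 1 \<le> (CARD('n) + 1) div 2" by linarith
  obtain f where f: "Xp ^ p - 1 dvd ((\<Sum>u<r. Xp ^ e0 u) - (\<Sum>u<s. Xp ^ e1 u)) - of_nat (p ^ m) * f"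
    using equivariant_supertrace[OF assms(1,3) \<zeta> t c mf P0[unfolded defs] P1[unfolded defs]
        \<alpha>0(1)[unfolded defs] \<alpha>1(1)[unfolded defs] lin0[unfolded defs] lin1[unfolded defs]
        eq[unfolded defs] bound] unfolding defs by blast
  let ?V = "fiber_rep r \<alpha>0" and ?W = "fiber_rep s \<alpha>1"
  have fib: "fiber_rep d \<alpha> = linear_rep d (map_mat const_term \<alpha>)" for d and \<alpha> :: "('n, 'k) mfps mat"
    by (simp add: fiber_rep_def linear_rep_def)
  have const: "map_mat const_term \<alpha> \<in> carrier_mat d d \<and> map_mat const_term \<alpha> ^\<^sub>m p = 1\<^sub>m d"
    if "\<alpha> \<in> carrier_mat d d" "iterate_action t \<alpha> d p = 1\<^sub>m d" for d and \<alpha> :: "('n, 'k) mfps mat"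
  proof -
    have "map_mat const_term (1\<^sub>m d :: ('n, 'k) mfps mat) = 1\<^sub>m d" by (rule eq_matI) auto
    then show ?thesis using const_term_iterate[OF that(1), of t p] that by simp
  qed
  note c0 = const[OF \<alpha>0] and c1 = const[OF \<alpha>1]
  have V: "?V \<in> reps ?G" unfolding fib using c0 p by (intro linear_rep_reps) auto
  have W: "?W \<in> reps ?G" unfolding fib using c1 p by (intro linear_rep_reps) auto
  have "character ?V (int j) - character ?W (int j) = of_nat (p ^ m) * eval_int f (\<zeta> ^ j)" for j
  proof -
    have V: "character ?V (int j) = (\<Sum>u<r. (\<zeta> ^ j) ^ e0 u)"
      unfolding character_def fib linear_rep_def fst_conv snd_conv nat_int
        diagonalized_trace[OF conjunct1[OF c0] S0 e0]
      by (simp only: power_mult[symmetric] mult.commute)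
    have W: "character ?W (int j) = (\<Sum>u<s. (\<zeta> ^ j) ^ e1 u)"
      unfolding character_def fib linear_rep_def fst_conv snd_conv nat_int
        diagonalized_trace[OF conjunct1[OF c1] S1 e1]
      by (simp only: power_mult[symmetric] mult.commute)
    obtain K where K: "((\<Sum>u<r. Xp ^ e0 u) - (\<Sum>u<s. Xp ^ e1 u)) - of_nat (p ^ m) * f = (Xp ^ p - 1) * K"
      using f by (elim dvdE)
    have "(\<zeta> ^ j) ^ p = 1" using \<zeta> by (metis mult.commute power_mult power_one primitive_root_def)
    then have "eval_int (((\<Sum>u<r. Xp ^ e0 u) - (\<Sum>u<s. Xp ^ e1 u)) - of_nat (p ^ m) * f) (\<zeta> ^ j) = 0"
      unfolding K by (simp add: eval_int_mult eval_int_diff eval_int_power)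
    then show ?thesis
      unfolding V W by (simp add: eval_int_mult eval_int_diff eval_int_power eval_int_sum eval_int_of_nat del: of_nat_power)
  qed
  then show ?thesis
    unfolding fiber_class_def defs[symmetric] by (intro vrep_divisible[OF \<zeta> V W])
qed

end
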